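(* Let $D_1$ be the open unit ball of $\mathbb{R}^2$ and, for $\nu<0$, consider the eigenvalue problem (in $\lambda\in\mathbb{R}$) $$\Delta^2 u+\nu u=-\lambda\Delta u \ \text{ in } D_1,\qquad u=\partial_r u=0\ \text{ on }\partial D_1.$$ There exist increasing differentiable functions $\lambda_{k,\ell}:\,]-\infty,0[\,\to\mathbb{R}:\nu\mapsto\lambda_{k,\ell}(\nu)$, for $k\in\mathbb{N}$ and $\ell\in\mathbb{N}^*$, such that for each $\nu\in\,]-\infty,0[$ the spectrum of the problem is exactly $\{\lambda_{k,\ell}(\nu)\mid k\in\mathbb{N},\ \ell\in\mathbb{N}^*\}$. Moreover $$\lim_{\nu\to-\infty}\lambda_{k,\ell}(\nu)=-\infty\quad\text{and}\quad\lim_{\nu\to0}\lambda_{k,\ell}(\nu)=j_{k+1,\ell}^2.$$ Associated to $\lambda_{k,\ell}(\nu)$ is a space of eigenfunctions of the form, in polar coordinates, $R_{k,\ell}(r)\bigl(c_1\cos(k\theta)+c_2\sin(k\theta)\bigr)$ where $c_1,c_2\in\mathbb{R}$ and $$R_{k,\ell}(r):=c\,J_k(\alpha_{k,\ell}\,r)+d\,I_k\Bigl(\frac{\kappa}{\alpha_{k,\ell}}\,r\Bigr),\qquad \kappa=\sqrt{-\nu},$$ for some $(c,d)\neq(0,0)$ suitably chosen (depending on $\kappa$, $k$ and $\ell$). In addition, $R_{k,\ell}$ possesses $\ell-1$ roots in $]0,1[$, all of which are simple.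
   Context: $\mathbb{N}=\{0,1,2,\dots\}$, $\mathbb{N}^*=\{1,2,\dots\}$. $J_k$ (resp. $I_k$) is the Bessel function (resp. modified Bessel function) of the first kind of order $k$, and $(j_{k,\ell})_{\ell\ge1}$ are the positive roots of $J_k$ in increasing order. The spectrum is the set of $\lambda\in\mathbb{R}$ for which the problem has a nontrivial solution (eigenfunction). For $\kappa=\sqrt{-\nu}>0$, $\alpha_{k,\ell}=\alpha_{k,\ell}(\kappa)$ denotes the $\ell$-th positive root, in increasing order, of $$F_k(\alpha)=\frac{\kappa}{\alpha}J_k(\alpha)I_k'\Bigl(\frac{\kappa}{\alpha}\Bigr)-\alpha I_k\Bigl(\frac{\kappa}{\alpha}\Bigr)J_k'(\alpha),\qquad \alpha>0.$$ $]a,b[$ denotes an open interval. *)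

theory Defs
  imports "HOL-Analysis.Analysis"
begin

definition bessel_J :: "nat \<Rightarrow> real \<Rightarrow> real" where
  "bessel_J k x = (\<Sum>m. (-1) ^ m / (fact m * fact (m + k)) * (x / 2) ^ (2 * m + k))"

definition bessel_I :: "nat \<Rightarrow> real \<Rightarrow> real" where
  "bessel_I k x = (\<Sum>m. 1 / (fact m * fact (m + k)) * (x / 2) ^ (2 * m + k))"

text \<open>
  The \<open>l\<close>-th positive root of \<open>f\<close> in increasing order, for \<open>l \<ge> 1\<close>: the root \<open>x > 0\<close> such that
  exactly \<open>l\<close> roots, \<open>x\<close> included, lie in \<open>]0,x]\<close>. For \<open>l \<ge> 1\<close> the cardinality condition
  forces that set of roots to be finite; the value at \<open>l = 0\<close> is irrelevant.
\<close>
definition pos_root :: "(real \<Rightarrow> real) \<Rightarrow> nat \<Rightarrow> real" where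
  "pos_root f l = (THE x. 0 < x \<and> f x = 0 \<and> card {y. 0 < y \<and> y \<le> x \<and> f y = 0} = l)"

definition bessel_root :: "nat \<Rightarrow> nat \<Rightarrow> real" where
  "bessel_root k l = pos_root (bessel_J k) l"

definition F :: "real \<Rightarrow> nat \<Rightarrow> real \<Rightarrow> real" where
  "F \<kappa> k \<alpha> =
     \<kappa> / \<alpha> * bessel_J k \<alpha> * deriv (bessel_I k) (\<kappa> / \<alpha>)
     - \<alpha> * bessel_I k (\<kappa> / \<alpha>) * deriv (bessel_J k) \<alpha>"

definition alpha :: "real \<Rightarrow> nat \<Rightarrow> nat \<Rightarrow> real" where
  "alpha \<kappa> k l = pos_root (F \<kappa> k) l"

definition partial :: "'a::euclidean_space \<Rightarrow> ('a \<Rightarrow> real) \<Rightarrow> 'a \<Rightarrow> real" where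
  "partial i f x = frechet_derivative f (at x) i"

definition laplacian :: "('a::euclidean_space \<Rightarrow> real) \<Rightarrow> 'a \<Rightarrow> real" where
  "laplacian f x = (\<Sum>i\<in>Basis. partial i (partial i f) x)"

text \<open>\<open>f\<close> is of class \<open>C\<^sup>n\<close> on \<open>S\<close>; meant for open \<open>S\<close>.\<close>
primrec Cn_on :: "nat \<Rightarrow> 'a::euclidean_space set \<Rightarrow> ('a \<Rightarrow> real) \<Rightarrow> bool" where
  "Cn_on 0 S f \<longleftrightarrow> continuous_on S f"
| "Cn_on (Suc n) S f \<longleftrightarrow>
     (\<forall>x\<in>S. f differentiable (at x)) \<and> (\<forall>i\<in>Basis. Cn_on n S (partial i f))"

text \<open>
  \<open>f\<close> is of class \<open>C\<^sup>1\<close> up to the boundary, \<open>g\<close> being the gradient; meant for closed balls,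
  where the derivative within \<open>S\<close> is unique also at boundary points.
\<close>
definition C1_closed_on :: "'a::euclidean_space set \<Rightarrow> ('a \<Rightarrow> real) \<Rightarrow> bool" where
  "C1_closed_on S f \<longleftrightarrow>
     (\<exists>g. continuous_on S g \<and> (\<forall>x\<in>S. (f has_derivative (\<lambda>h. g x \<bullet> h)) (at x within S)))"

text \<open>
  Classical solutions, of class \<open>C\<^sup>4\<close> inside and \<open>C\<^sup>1\<close> up to the boundary. Only the values
  of \<open>u\<close> on the closed disc matter; accordingly the radial derivative at a boundary point is
  the one-sided one, from inside.
\<close>
definition is_solution :: "real \<Rightarrow> real \<Rightarrow> (real^2 \<Rightarrow> real) \<Rightarrow> bool" where
  "is_solution \<nu> lam u \<longleftrightarrow>
     Cn_on 4 (ball 0 1) u \<and> C1_closed_on (cball 0 1) u \<and>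
     (\<forall>x\<in>ball 0 1. laplacian (laplacian u) x + \<nu> * u x = - lam * laplacian u x) \<and>
     (\<forall>x\<in>sphere 0 1. u x = 0 \<and>
        ((\<lambda>r. u (r *\<^sub>R x)) has_real_derivative 0) (at_left 1))"

definition is_eigenfunction :: "real \<Rightarrow> real \<Rightarrow> (real^2 \<Rightarrow> real) \<Rightarrow> bool" where
  "is_eigenfunction \<nu> lam u \<longleftrightarrow> is_solution \<nu> lam u \<and> (\<exists>x\<in>ball 0 1. u x \<noteq> 0)"

definition spectrum :: "real \<Rightarrow> real set" where
  "spectrum \<nu> = {lam. \<exists>u. is_eigenfunction \<nu> lam u}"

text \<open>
  \<open>u\<close> is given on the closed unit disc by \<open>R(r) \<Theta>(\<theta>)\<close> in polar coordinates; this determines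
  \<open>u\<close> there.
\<close>
definition has_polar_form :: "(real^2 \<Rightarrow> real) \<Rightarrow> (real \<Rightarrow> real) \<Rightarrow> (real \<Rightarrow> real) \<Rightarrow> bool" where
  "has_polar_form u R \<Theta> \<longleftrightarrow>
     (\<forall>r\<in>{0..1}. \<forall>\<theta>. u (vector [r * cos \<theta>, r * sin \<theta>]) = R r * \<Theta> \<theta>)"

definition radial :: "real \<Rightarrow> nat \<Rightarrow> nat \<Rightarrow> real \<Rightarrow> real \<Rightarrow> real \<Rightarrow> real" where
  "radial \<kappa> k l c d r =
     c * bessel_J k (alpha \<kappa> k l * r) + d * bessel_I k (\<kappa> / alpha \<kappa> k l * r)"

definition angular :: "nat \<Rightarrow> real \<Rightarrow> real \<Rightarrow> real \<Rightarrow> real" where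
  "angular k c1 c2 \<theta> = c1 * cos (real k * \<theta>) + c2 * sin (real k * \<theta>)"

end

(* Write C_k(x) = sum_m (-x)^m / (m! (m+k)!), so that J_k(a) = (a/2)^k C_k(a^2/4) and
   I_k(b) = (b/2)^k C_k(-b^2/4). With x = alpha^2/4 and y = kappa^2/(4 alpha^2) the equation F = 0
   becomes phi(x) = phi(-y) for the single function phi(x) = x C_{k+1}(x) / C_k(x), which increases
   on every interval free of zeros of C_k because the Turan-type expression
   C_k^2 + x C_{k+1}^2 - k C_k C_{k+1} is positive on the whole real line. On each interval between
   the l-th zeros of C_k and C_{k+1} one can solve for y, and the product x y = kappa^2/16 is a
   decreasing function of x there; its inverse gives alpha_{k,l} as a differentiable function of
   kappa, and lambda = 4 (x - y).

   The number of zeros of the radial factor is counted between the critical points of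
   C_k(x r^2) / C_k(-y r^2): an energy argument shows that the values at these points alternate in
   sign and decrease in modulus.

   Conversely, for an eigenfunction u and lambda = 4 (X - Y), nu = -16 X Y, the functions
   Delta u - 4 Y u and Delta u + 4 X u solve Helmholtz equations, so each Fourier mode of u on
   circles is r^k (A C_k(X r^2) + B C_k(-Y r^2)). If F has no zero at alpha for any k, the boundary
   conditions force A = B = 0 for all modes, hence u = 0 by density of trigonometric polynomials. *)

theory Submission
  imports Defs
begin

section \<open>The Bessel-Clifford function\<close>

text \<open>The Clifford normalisation puts J_k on the positive and I_k on the negative half-line of
  one entire function, so one recurrence and one Riccati equation serve both. The delicate point is
  that x y decreases along phi(x) = phi(-y) = s. By the Riccati equation this compares y - s^2 + k s
  with x + s^2 - k s. The Turan inequality of index k bounds y only from below; that of index k + 1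
  supplies the upper bound, so that s^2 - k s < y < s^2 - (k+1) s. The remaining gap is closed by x
  >= 1, which holds because C_k has no zero below 1. In the converse direction u is only C^1 up to
  the boundary, so Delta u has no boundary values. Hence both Helmholtz equations are solved mode by
  mode inside the disc, where regularity at the centre singles out one solution up to a factor. The
  boundary conditions are imposed on u alone, which is recovered from the difference of the two
  Helmholtz solutions. No sign condition on lambda arises: X - Y = lambda/4 and X Y = -nu/16 > 0
  always have a positive solution (X, Y).\<close>

definition clifford :: "nat \<Rightarrow> real \<Rightarrow> real" where
  "clifford k x = (\<Sum>m. (-1) ^ m / (fact m * fact (m + k)) * x ^ m)"

lemma summable_clifford: "summable (\<lambda>m. (-1) ^ m / (fact m * fact (m + k)) * x ^ m :: real)"
proof (rule summable_comparison_test')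
  show "summable (\<lambda>m. inverse (fact m) * \<bar>x\<bar> ^ m)"
    by (rule summable_exp)
  show "norm ((-1) ^ m / (fact m * fact (m + k)) * x ^ m) \<le> inverse (fact m) * \<bar>x\<bar> ^ m" for m
  proof -
    have "(fact m :: real) * 1 \<le> fact m * fact (m + k)"
      by (intro mult_left_mono fact_ge_1) auto
    then have "1 / (fact m * fact (m + k)) \<le> inverse (fact m :: real)"
      by (simp add: divide_simps)
    then show ?thesis
      using mult_right_mono[of _ _ "\<bar>x\<bar> ^ m"] by (fastforce simp: abs_mult power_abs)
  qed
qed

text \<open>Termwise differentiation shifts the index and changes the sign. The chain rule is built
  in so that the rule can serve as an introduction rule for derivatives.\<close>

lemma clifford_has_derivative [derivative_intros]:
  "(f has_field_derivative f') (at x within S) \<Longrightarrow>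
    ((\<lambda>x. clifford k (f x)) has_field_derivative - clifford (k + 1) (f x) * f') (at x within S)"
proof -
  have "(clifford k has_field_derivative - clifford (k + 1) x) (at x)" for x
  proof -
    have "diffs (\<lambda>m. (-1) ^ m / (fact m * fact (m + k)) :: real) =
        (\<lambda>m. - ((-1) ^ m / (fact m * fact (m + (k + 1)))))"
    proof
      fix m
      have "(fact (Suc m) :: real) = (real m + 1) * fact m" by simp
      then show "diffs (\<lambda>m. (-1) ^ m / (fact m * fact (m + k)) :: real) m =
          - ((-1) ^ m / (fact m * fact (m + (k + 1))))"
        by (simp add: diffs_def del: fact_Suc) (simp add: divide_simps)
    qed
    with termdiffs_strong_converges_everywhere[OF summable_clifford, of k x]
    show ?thesis
      unfolding clifford_def by (simp add: suminf_minus[OF summable_clifford[of "k + 1", simplified]])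
  qed
  from DERIV_chain2[OF this]
  show "(f has_field_derivative f') (at x within S) \<Longrightarrow> ?thesis" .
qed

lemma isCont_clifford [simp]: "isCont (clifford k) x"
  using clifford_has_derivative[OF DERIV_ident] by (rule DERIV_isCont)

lemma continuous_clifford [continuous_intros]:
  "continuous net f \<Longrightarrow> continuous net (\<lambda>x. clifford k (f x))"
  unfolding continuous_def using isCont_tendsto_compose[OF isCont_clifford] by blast

lemma continuous_on_clifford [continuous_intros]:
  "continuous_on S f \<Longrightarrow> continuous_on S (\<lambda>x. clifford k (f x))"
  by (rule continuous_on_compose2[of UNIV "clifford k"]) (auto intro: continuous_at_imp_continuous_on)

lemma clifford_0: "clifford k 0 = 1 / fact k"
  unfolding clifford_def by (subst suminf_finite[of "{0}"]) auto

text \<open>Holds coefficient by coefficient. Together with the derivative rule it is the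
  differential equation x C'' + (k+1) C' + C = 0 of C = \<open>clifford k\<close>.\<close>

lemma clifford_recurrence:
  "clifford k x = (real k + 1) * clifford (k + 1) x - x * clifford (k + 2) x"
proof -
  define c where "c k m = (-1) ^ m / (fact m * fact (m + k)) * x ^ m" for k m
  have sm: "summable (c k)" for k unfolding c_def by (rule summable_clifford)
  have cl: "clifford k x = (\<Sum>m. c k m)" for k by (simp add: c_def clifford_def)
  have h: "suminf (c k) = c k 0 + (\<Sum>m. c k (Suc m))" for k
    using suminf_split_head[OF sm, of k] by simp
  have eq: "c k (Suc m) = (real k + 1) * c (k + 1) (Suc m) - x * c (k + 2) m" for m
  proof -
    have "(fact (Suc m + (k + 1)) :: real) = (real m + real k + 2) * fact (Suc m + k)"
      "(fact (Suc m) :: real) = (real m + 1) * fact m" "m + (k + 2) = Suc m + (k + 1)"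
      by (simp_all add: algebra_simps)
    moreover have "real m + real k + 2 \<noteq> 0" "real m + 1 \<noteq> 0" by linarith+
    ultimately show ?thesis
      unfolding c_def by (simp add: divide_simps del: fact_Suc) (simp add: algebra_simps)
  qed
  have eq0: "c k 0 = (real k + 1) * c (k + 1) 0"
    by (simp add: c_def divide_simps)
  have sS: "summable (\<lambda>m. c k (Suc m))" for k
    using sm by (simp add: summable_Suc_iff)
  have "clifford k x = c k 0 + (\<Sum>m. (real k + 1) * c (k + 1) (Suc m) - x * c (k + 2) m)"
    by (simp add: cl h[of k] eq)
  also have "(\<Sum>m. (real k + 1) * c (k + 1) (Suc m) - x * c (k + 2) m) =
     (real k + 1) * (\<Sum>m. c (k + 1) (Suc m)) - x * (\<Sum>m. c (k + 2) m)"
    by (subst suminf_diff[symmetric])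
       (auto intro!: summable_mult sS sm simp: suminf_mult[OF sS] suminf_mult[OF sm])
  finally show ?thesis
    unfolding cl h[of "k+1"] eq0 by (simp add: algebra_simps)
qed

text \<open>For x \<le> 0 all terms are nonnegative; for 0 < x < 1 the series alternates with
  decreasing terms and is bounded below by its first two. The range up to 1, not just 0, later
  forces every zero to be at least 1.\<close>

lemma clifford_pos:
  assumes "x < 1" shows "clifford k x > 0"
proof (cases "x \<le> 0")
  case True
  have *: "0 \<le> (-1) ^ m / (fact m * fact (m + k)) * x ^ m" for m
  proof -
    have "(-1) ^ m * x ^ m = (-x) ^ m" by (simp add: power_mult_distrib[symmetric])
    then show ?thesis using True by (simp add: field_simps)
  qed
  show ?thesis
    unfolding clifford_def by (rule suminf_pos2[OF summable_clifford *, of 0]) auto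
next
  case False
  define a where "a m = x ^ m / (fact m * fact (m + k))" for m
  have a: "(-1) ^ m / (fact m * fact (m + k)) * x ^ m = (-1) ^ m * a m" for m
    by (simp add: a_def)
  have "a \<longlonglongrightarrow> 0"
  proof -
    have "(\<lambda>m. norm ((-1) ^ m * a m)) \<longlonglongrightarrow> 0"
      using summable_LIMSEQ_zero[OF summable_clifford[of k x, unfolded a]] tendsto_norm_zero by blast
    moreover have "norm ((-1) ^ m * a m) = a m" for m
      using False by (simp add: a_def abs_mult power_abs)
    ultimately show ?thesis by simp
  qed
  moreover have "0 \<le> a m" for m using False by (simp add: a_def)
  moreover have "a (Suc m) \<le> a m" for m
  proof -
    have "x * x ^ m \<le> ((real m + 1) * (real m + k + 1)) * x ^ m"
    proof (rule mult_right_mono)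
      have "1 * 1 \<le> (real m + 1) * (real m + k + 1)" by (rule mult_mono) auto
      then show "x \<le> (real m + 1) * (real m + k + 1)" using assms by linarith
    qed (use False in auto)
    then show ?thesis
      by (simp add: a_def divide_simps) (simp add: algebra_simps)
  qed
  ultimately have "(\<Sum>i<2*1. (-1)^i * a i) \<le> (\<Sum>i. (-1)^i * a i)"
    by (rule summable_Leibniz'(2))
  then have "a 0 - a 1 \<le> clifford k x"
    unfolding clifford_def a by (simp add: numeral_2_eq_2)
  moreover have "a 1 < a 0"
  proof -
    have "x < 1 + real k" using assms by simp
    then show ?thesis by (simp add: a_def divide_simps)
  qed
  ultimately show ?thesis by linarith
qed

text \<open>For x = a^2/4 with a > 0 this is (2/a)^(2k) (J_k(a)^2 - J_{k-1}(a) J_{k+1}(a)), the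
  classical Turan determinant.\<close>

definition turan :: "nat \<Rightarrow> real \<Rightarrow> real" where
  "turan k x = (clifford k x)\<^sup>2 + x * (clifford (k + 1) x)\<^sup>2 - k * clifford k x * clifford (k + 1) x"

text \<open>Converts the positivity of \<open>turan (k + 1)\<close> into a second inequality between
  \<open>clifford k\<close> and \<open>clifford (k + 1)\<close>.\<close>

lemma turan_recurrence: "x * turan (k + 1) x = turan k x - clifford k x * clifford (k + 1) x"
  unfolding turan_def
  by (simp add: clifford_recurrence[of k x]) algebra

text \<open>\<open>t\<^sup>k\<^sup>+\<^sup>1 turan k (t x)\<close> has the non-negative derivative \<open>t\<^sup>k (clifford k (t x))\<^sup>2\<close>, and it is
  positive for small \<open>t > 0\<close>.\<close>
lemma turan_pos: "turan k x > 0"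
proof -
  define H where "H t = t ^ (k + 1) * turan k (t * x)" for t
  have H': "(H has_real_derivative t ^ k * (clifford k (t * x))\<^sup>2) (at t)" for t
  proof -
    have "(H has_real_derivative (real k + 1) * t ^ k * turan k (t * x) + t ^ (k + 1) *
       (x * (k * clifford k (t * x) * clifford (k + 2) (t * x)
            - (real k + 1) * (clifford (k + 1) (t * x))\<^sup>2))) (at t)"
      unfolding H_def turan_def
      apply (rule derivative_eq_intros refl | simp)+
      apply (simp add: clifford_recurrence[of k "t * x"])
      by algebra
    moreover have "(real k + 1) * t ^ k * turan k (t * x) + t ^ (k + 1) *
       (x * (k * clifford k (t * x) * clifford (k + 2) (t * x)
            - (real k + 1) * (clifford (k + 1) (t * x))\<^sup>2)) = t ^ k * (clifford k (t * x))\<^sup>2"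
      unfolding turan_def by (simp add: clifford_recurrence[of k "t * x"]) algebra
    ultimately show ?thesis by simp
  qed
  \<comment> \<open>\<open>H\<close> vanishes at t = 0, so strict positivity has to come from nearby
    points: \<open>turan k\<close> has the value 1 / (k! (k+1)!) at 0.\<close>
  have "isCont (\<lambda>t. turan k (t * x)) 0"
    unfolding turan_def by (intro continuous_intros)
  moreover have "turan k (0 * x) > 0"
    by (simp add: turan_def clifford_0 power2_eq_square divide_simps)
  ultimately have "\<forall>\<^sub>F t in at 0. turan k (t * x) > 0"
    unfolding isCont_def by (rule order_tendstoD)
  then obtain d where d: "d > 0" "\<And>t. t \<noteq> 0 \<Longrightarrow> \<bar>t\<bar> < d \<Longrightarrow> turan k (t * x) > 0"
    by (auto simp: eventually_at dist_norm)
  define s where "s = min 1 (d / 2)"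
  have "H s > 0" unfolding H_def using d s_def by (intro mult_pos_pos) auto
  also have "H s \<le> H 1"
    by (rule DERIV_nonneg_imp_nondecreasing) (use H' d(1) in \<open>auto simp: s_def intro!: exI\<close>)
  finally show ?thesis by (simp add: H_def)
qed

text \<open>A common zero would make \<open>turan k\<close> vanish. As
  \<open>clifford (k + 1)\<close> is minus the derivative, all zeros are simple.\<close>

lemma clifford_zero_simple: "clifford k x = 0 \<Longrightarrow> clifford (k + 1) x \<noteq> 0"
  using turan_pos[of k x] by (auto simp: turan_def)

text \<open>Minus x times the logarithmic derivative of \<open>clifford k\<close>: it is (a/2)
  J_{k+1}(a) / J_k(a) at a^2/4 and -(b/2) I_{k+1}(b) / I_k(b) at -b^2/4. At a pole, division by zero
  yields the value 0, so equations between ratios come with a condition that excludes poles.\<close>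

definition clifford_ratio :: "nat \<Rightarrow> real \<Rightarrow> real" where
  "clifford_ratio k x = x * clifford (k + 1) x / clifford k x"

lemma clifford_ratio_DERIV:
  assumes "clifford k x \<noteq> 0"
  shows "(clifford_ratio k has_real_derivative turan k x / (clifford k x)\<^sup>2) (at x)"
proof -
  have "x * clifford (k + 2) x = (real k + 1) * clifford (k + 1) x - clifford k x"
    using clifford_recurrence[of k x] by simp
  then have *: "x * (clifford k x * clifford (k + 2) x) =
      clifford k x * ((real k + 1) * clifford (k + 1) x - clifford k x)"
    by (metis mult.left_commute)
  show ?thesis
    unfolding clifford_ratio_def turan_def
    using assms
    apply -
    apply (rule derivative_eq_intros refl | simp)+
    using * by (simp add: divide_simps) algebra
qed

text \<open>Expresses the derivative through the point and the value alone, so that the slopes at x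
  and at -y can be compared when the ratio has the same value at both.\<close>

lemma clifford_ratio_riccati:
  assumes "clifford k x \<noteq> 0"
  shows "x * (turan k x / (clifford k x)\<^sup>2) =
    x + (clifford_ratio k x)\<^sup>2 - k * clifford_ratio k x"
  using assms unfolding clifford_ratio_def turan_def
  by (simp add: divide_simps power2_eq_square) (simp add: algebra_simps)

lemma isCont_clifford_ratio: "clifford k x \<noteq> 0 \<Longrightarrow> isCont (clifford_ratio k) x"
  using clifford_ratio_DERIV DERIV_isCont by blast

lemma clifford_ratio_strict_mono:
  assumes "a < b" "\<And>x. a \<le> x \<Longrightarrow> x \<le> b \<Longrightarrow> clifford k x \<noteq> 0"
  shows "clifford_ratio k a < clifford_ratio k b"
proof (rule DERIV_pos_imp_increasing[OF assms(1)])
  fix x assume "a \<le> x" "x \<le> b"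
  then have "clifford k x \<noteq> 0" using assms(2) by blast
  with clifford_ratio_DERIV[OF this] turan_pos[of k x]
  show "\<exists>y. (clifford_ratio k has_real_derivative y) (at x) \<and> y > 0"
    by (intro exI[of _ "turan k x / (clifford k x)\<^sup>2"]) auto
qed

section \<open>Zeros\<close>

text \<open>An increasing enumeration has exactly m roots up to its m-th member, which is what the
  definite description counts. Monotonicity is asked from index 1 on, since the member of index 0 is
  not a root.\<close>

lemma pos_root_eqI:
  assumes mono: "\<And>i j. 1 \<le> i \<Longrightarrow> i < j \<Longrightarrow> z i < z j"
    and zeros: "{x. 0 < x \<and> f x = 0} = z ` {1..}" and "1 \<le> l"
  shows "pos_root f l = z l"
proof -
  have inj: "i = j" if "z i = z j" "1 \<le> i" "1 \<le> j" for i j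
    using mono[of i j] mono[of j i] that by (metis less_irrefl linorder_neqE_nat)
  have card: "card {y. 0 < y \<and> y \<le> z m \<and> f y = 0} = m" if "1 \<le> m" for m
  proof -
    have le: "z i \<le> z m \<longleftrightarrow> i \<le> m" if "1 \<le> i" for i
      using mono[of i m] mono[of m i] that \<open>1 \<le> m\<close> by (metis leD le_less linorder_not_less)
    have "{y. 0 < y \<and> y \<le> z m \<and> f y = 0} = {x. 0 < x \<and> f x = 0} \<inter> {..z m}" by auto
    also have "\<dots> = z ` {1..m}" using le zeros by auto
    finally show ?thesis
      using inj by (simp add: card_image inj_on_def)
  qed
  show ?thesis unfolding pos_root_def
  proof (rule the_equality)
    show "0 < z l \<and> f (z l) = 0 \<and> card {y. 0 < y \<and> y \<le> z l \<and> f y = 0} = l"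
      using zeros card[OF \<open>1 \<le> l\<close>] \<open>1 \<le> l\<close> by (auto simp: set_eq_iff)
  next
    fix x assume x: "0 < x \<and> f x = 0 \<and> card {y. 0 < y \<and> y \<le> x \<and> f y = 0} = l"
    then obtain m where "1 \<le> m" "x = z m" using zeros by auto
    with card[of m] x show "x = z l" by simp
  qed
qed

text \<open>Iterates "the next element of Z after x", starting from the placeholder 0. An element
  left out would exceed every member of the strictly increasing sequence, against local
  finiteness.\<close>

lemma enumerate_zeros:
  fixes Z :: "real set"
  assumes pos: "Z \<subseteq> {0<..}" and fin: "\<And>x. finite (Z \<inter> {..x})" and unb: "\<And>x. \<exists>y\<in>Z. x < y"
  shows "\<exists>z :: nat \<Rightarrow> real. z 0 = 0 \<and> strict_mono z \<and> Z = z ` {1..}"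
proof -
  have next_zero: "\<exists>y\<in>Z. x < y \<and> (\<forall>t\<in>Z. x < t \<longrightarrow> y \<le> t)" for x
  proof -
    obtain b where b: "b \<in> Z" "x < b" using unb by blast
    define A where "A = Z \<inter> {..b} \<inter> {x<..}"
    have A: "finite A" "b \<in> A" using fin b by (auto simp: A_def)
    then have "Min A \<in> A" by (intro Min_in) auto
    moreover have "Min A \<le> t" if "t \<in> Z" "x < t" for t
    proof (cases "t \<le> b")
      case True then show ?thesis using that A by (intro Min_le) (auto simp: A_def)
    next
      case False
      with Min_le[OF A] show ?thesis by simp
    qed
    ultimately show ?thesis by (auto simp: A_def)
  qed
  define nx where "nx x = (SOME y. y \<in> Z \<and> x < y \<and> (\<forall>t\<in>Z. x < t \<longrightarrow> y \<le> t))" for x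
  have nx: "nx x \<in> Z" "x < nx x" "\<And>t. t \<in> Z \<Longrightarrow> x < t \<Longrightarrow> nx x \<le> t" for x
    using someI_ex[of "\<lambda>y. y \<in> Z \<and> x < y \<and> (\<forall>t\<in>Z. x < t \<longrightarrow> y \<le> t)"] next_zero[of x]
    unfolding nx_def by blast+
  define z where "z = rec_nat 0 (\<lambda>_. nx)"
  have z0: "z 0 = 0" and zS: "z (Suc n) = nx (z n)" for n by (simp_all add: z_def)
  have sm: "strict_mono z" by (rule strict_monoI_Suc) (simp add: zS nx)
  have "z ` {1..} \<subseteq> Z" using nx(1) zS by (auto simp: Suc_le_eq gr0_conv_Suc)
  moreover have "t \<in> z ` {1..}" if "t \<in> Z" for t
  proof (rule ccontr)
    assume *: "t \<notin> z ` {1..}"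
    have "z n < t" for n
    proof (induction n)
      case 0 then show ?case using pos that z0 by auto
    next
      case (Suc n)
      then have "z (Suc n) \<le> t" using nx(3) that zS by simp
      moreover have "z (Suc n) \<noteq> t" using * by auto
      ultimately show ?case by simp
    qed
    then have "z ` {1..} \<subseteq> Z \<inter> {..t}" using \<open>z ` {1..} \<subseteq> Z\<close> by (auto intro: less_imp_le)
    then have "finite (z ` {1..})" using fin finite_subset by blast
    moreover have "inj_on z {1..}"
      using strict_mono_eq[OF sm] by (auto simp: inj_on_def)
    ultimately show False
      using finite_imageD infinite_Ici by blast
  qed
  ultimately show ?thesis using z0 sm by (intro exI[of _ z]) auto
qed

text \<open>An accumulation point of zeros is itself a zero, and the difference quotients there
  vanish along zeros tending to it, against simplicity.\<close>

lemma finite_simple_zeros: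
  fixes f f' :: "real \<Rightarrow> real"
  assumes der: "\<And>x. (f has_real_derivative f' x) (at x)"
    and simple: "\<And>x. f x = 0 \<Longrightarrow> f' x \<noteq> 0"
  shows "finite {x \<in> {a..b}. f x = 0}"
proof (rule ccontr)
  assume inf: "infinite {x \<in> {a..b}. f x = 0}"
  have "\<exists>x\<in>{a..b}. x islimpt {x \<in> {a..b}. f x = 0}"
    using inf by (intro Heine_Borel_imp_Bolzano_Weierstrass) auto
  then obtain x where x: "x \<in> {a..b}" "x islimpt {x \<in> {a..b}. f x = 0}"
    by blast
  have "f x = 0"
  proof -
    have "closed {x. f x = 0}"
      by (intro closed_Collect_eq continuous_at_imp_continuous_on) (auto intro: DERIV_isCont der)
    moreover have "x islimpt {x. f x = 0}" using x(2) by (rule islimpt_subset) auto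
    ultimately show ?thesis by (auto simp: closed_limpt)
  qed
  have "((\<lambda>y. (f y - f x) / (y - x)) \<longlongrightarrow> f' x) (at x)"
    using der by (simp add: has_field_derivative_iff)
  then have "\<forall>\<^sub>F y in at x. (f y - f x) / (y - x) \<noteq> 0"
    using simple[OF \<open>f x = 0\<close>] by (rule tendsto_imp_eventually_ne)
  then have "\<forall>\<^sub>F y in at x. f y \<noteq> 0"
    by eventually_elim (auto simp: \<open>f x = 0\<close>)
  then show False
    using x(2) by (auto simp: islimpt_def eventually_at_topological)
qed

text \<open>If \<open>clifford k\<close> had no zero beyond \<open>a\<close>, then by the Riccati equation of the ratio the Pruefer
  angle \<open>arctan ((clifford_ratio k x - k/2) / sqrt x)\<close> would grow at least as fast as \<open>sqrt x\<close>.\<close>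
lemma clifford_zeros_unbounded: "\<exists>x>a. clifford k x = 0"
proof (rule ccontr)
  assume "\<not> ?thesis"
  then have nz: "clifford k x \<noteq> 0" if "a < x" for x using that by auto
  \<comment> \<open>By the Riccati equation the numerator of the derivative of \<theta> at t is t +
    p^2 - p - k^2/2; from t = k^2/2 + 1 on it is at least p^2 - p + 1 > 0.\<close>
  define b where "b = max (a + 1) ((real k)\<^sup>2 / 2 + 1)"
  define p where "p x = clifford_ratio k x - k / 2" for x
  define \<theta> where "\<theta> x = arctan (p x / sqrt x) - sqrt x" for x
  have b: "a < b" "b \<ge> (real k)\<^sup>2 / 2 + 1" by (auto simp: b_def)
  have "(real k)\<^sup>2 / 2 \<ge> 0" by simp
  then have "b > 0" using b(2) by linarith
  have mono: "\<theta> b \<le> \<theta> x" if "b \<le> x" for x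
  proof (rule DERIV_nonneg_imp_nondecreasing[OF that])
    fix t assume t: "b \<le> t" "t \<le> x"
    have "t > 0" using t \<open>b > 0\<close> by simp
    define s where "s = sqrt t"
    have s: "s > 0" "t = s\<^sup>2" using \<open>t > 0\<close> by (auto simp: s_def)
    define r where "r = turan k t / (clifford k t)\<^sup>2"
    have r: "s\<^sup>2 * r = s\<^sup>2 + (p t)\<^sup>2 - (real k)\<^sup>2 / 4"
    proof -
      have "t * r = t + (clifford_ratio k t)\<^sup>2 - k * clifford_ratio k t"
        unfolding r_def using t b by (intro clifford_ratio_riccati nz) auto
      then show ?thesis
        unfolding s(2)[symmetric] by (simp add: p_def power2_eq_square algebra_simps)
    qed
    have dr: "(clifford_ratio k has_real_derivative r) (at t)"
      unfolding r_def using t b by (intro clifford_ratio_DERIV nz) auto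
    have dp: "((\<lambda>x. p x / sqrt x) has_real_derivative r / s - p t / (2 * s ^ 3)) (at t)"
      unfolding p_def using \<open>t > 0\<close> s
      apply -
      apply (rule derivative_eq_intros dr refl | simp)+
      by (simp add: s_def[symmetric] divide_simps power2_eq_square power3_eq_cube)
    have "(\<theta> has_real_derivative (r / s - p t / (2 * s ^ 3)) / (1 + (p t / s)\<^sup>2) - 1 / (2 * s)) (at t)"
    proof -
      have "(sqrt has_real_derivative 1 / (2 * s)) (at t)"
        using DERIV_real_sqrt[OF \<open>t > 0\<close>] by (simp add: s_def inverse_eq_divide mult.commute)
      note DERIV_diff[OF DERIV_chain2[OF DERIV_arctan dp] this]
      moreover have "inverse (1 + (p t / sqrt t)\<^sup>2) * D = D / (1 + (p t / s)\<^sup>2)" for D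
        by (simp only: s_def divide_inverse mult.commute)
      ultimately show ?thesis
        unfolding \<theta>_def by simp
    qed
    moreover have "(r / s - p t / (2 * s ^ 3)) / (1 + (p t / s)\<^sup>2) - 1 / (2 * s) =
        (2 * s\<^sup>2 * r - p t - (s\<^sup>2 + (p t)\<^sup>2)) / (2 * s * (s\<^sup>2 + (p t)\<^sup>2))"
    proof -
      have "s\<^sup>2 + (p t)\<^sup>2 > 0" "1 + (p t / s)\<^sup>2 > 0" using s(1)
        by (intro add_pos_nonneg; simp)+
      then have "s\<^sup>2 + (p t)\<^sup>2 \<noteq> 0" "1 + (p t / s)\<^sup>2 \<noteq> 0"
        by auto
      moreover have "1 + (p t / s)\<^sup>2 = (s\<^sup>2 + (p t)\<^sup>2) / s\<^sup>2" using s(1)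
        by (simp add: divide_simps)
      ultimately show ?thesis using s(1)
        by (simp add: divide_simps) (simp add: power2_eq_square power3_eq_cube algebra_simps)
    qed
    moreover have "\<dots> \<ge> 0"
    proof -
      have "s\<^sup>2 \<ge> (real k)\<^sup>2 / 2 + 1" using t b s by simp
      moreover have "(p t - 1/2)\<^sup>2 \<ge> 0" by simp
      ultimately have "2 * s\<^sup>2 * r - p t - (s\<^sup>2 + (p t)\<^sup>2) \<ge> 0"
        using r by (simp add: power2_eq_square algebra_simps)
      then show ?thesis using s(1) by simp
    qed
    ultimately show "\<exists>y. (\<theta> has_real_derivative y) (at t) \<and> 0 \<le> y" by metis
  qed
  \<comment> \<open>At this point monotonicity of \<theta> would push the arctangent up to at least
    4 + b, beyond its bound 2.\<close>
  define x where "x = (\<bar>\<theta> b\<bar> + 4 + b)\<^sup>2"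
  have "b * 1 \<le> (\<bar>\<theta> b\<bar> + 4 + b) * (\<bar>\<theta> b\<bar> + 4 + b)" using \<open>b > 0\<close> by (intro mult_mono) auto
  then have "b \<le> x" by (simp add: x_def power2_eq_square)
  then have "\<theta> b \<le> \<theta> x" by (rule mono)
  moreover have "sqrt x = \<bar>\<theta> b\<bar> + 4 + b" using \<open>b > 0\<close> by (simp add: x_def)
  moreover have "arctan (p x / sqrt x) < 2"
    using arctan_ubound[of "p x / sqrt x"] pi_half_less_two by linarith
  ultimately show False using \<open>b > 0\<close> unfolding \<theta>_def by linarith
qed

lemma clifford_zeros_enumeration:
  "\<exists>z :: nat \<Rightarrow> real. z 0 = 0 \<and> strict_mono z \<and> {x. 0 < x \<and> clifford k x = 0} = z ` {1..}"
proof (rule enumerate_zeros)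
  show "{x. 0 < x \<and> clifford k x = 0} \<subseteq> {0<..}" by auto
  show "\<exists>y\<in>{x. 0 < x \<and> clifford k x = 0}. x < y" for x
    using clifford_zeros_unbounded[of "max 0 x" k] by auto
  fix b
  have "finite {x \<in> {0..b}. clifford k x = 0}"
    by (rule finite_simple_zeros[of _ "\<lambda>x. - clifford (k + 1) x"])
       (use clifford_has_derivative[OF DERIV_ident] clifford_zero_simple in auto)
  then show "finite ({x. 0 < x \<and> clifford k x = 0} \<inter> {..b})"
    by (rule rev_finite_subset) auto
qed

text \<open>The positive zeros are numbered from 1; \<open>clifford_zero k 0 = 0\<close> is the singular
  point of the equation.\<close>
definition clifford_zero :: "nat \<Rightarrow> nat \<Rightarrow> real" where
  "clifford_zero k = (SOME z. z 0 = 0 \<and> strict_mono z \<and> {x. 0 < x \<and> clifford k x = 0} = z ` {1..})"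

lemma clifford_zero_0: "clifford_zero k 0 = 0"
  and clifford_zero_strict_mono: "strict_mono (clifford_zero k)"
  and clifford_zeros: "{x. 0 < x \<and> clifford k x = 0} = clifford_zero k ` {1..}"
  using someI_ex[OF clifford_zeros_enumeration[of k]] unfolding clifford_zero_def by auto

lemma clifford_zero_less_iff: "clifford_zero k i < clifford_zero k j \<longleftrightarrow> i < j"
  by (rule strict_mono_less[OF clifford_zero_strict_mono])

lemma clifford_clifford_zero: "1 \<le> i \<Longrightarrow> clifford k (clifford_zero k i) = 0"
  and clifford_zero_pos: "1 \<le> i \<Longrightarrow> 0 < clifford_zero k i"
  using clifford_zeros[of k] by (auto simp: set_eq_iff)

lemma clifford_zero_ge_1: "1 \<le> i \<Longrightarrow> 1 \<le> clifford_zero k i"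
  using clifford_pos[of "clifford_zero k i" k] clifford_clifford_zero[of i k] by force

lemma clifford_zeroE:
  assumes "0 < x" "clifford k x = 0"
  obtains i where "1 \<le> i" "x = clifford_zero k i"
  using assms clifford_zeros[of k] by auto

lemma clifford_nonzero_between:
  assumes "clifford_zero k i < x" "x < clifford_zero k (Suc i)"
  shows "clifford k x \<noteq> 0"
proof
  assume "clifford k x = 0"
  moreover have "0 < x" using assms clifford_zero_pos[of i k] clifford_zero_0[of k]
    by (cases i) auto
  ultimately obtain j where "x = clifford_zero k j" by (elim clifford_zeroE)
  then show False using assms clifford_zero_less_iff by auto
qed

lemma clifford_zero_interval:
  assumes "0 < x" "clifford k x \<noteq> 0"
  obtains i where "clifford_zero k i < x" "x < clifford_zero k (Suc i)"
proof -
  obtain y where "y > x" "clifford k y = 0" using clifford_zeros_unbounded by blast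
  then obtain n where n: "x < clifford_zero k n" using assms by (metis clifford_zeroE less_trans)
  define m where "m = (LEAST n. x < clifford_zero k n)"
  have m: "x < clifford_zero k m" unfolding m_def using n by (rule LeastI)
  have "m \<noteq> 0" using m assms clifford_zero_0 by (metis less_asym)
  then obtain i where i: "m = Suc i" using not0_implies_Suc by blast
  have "\<not> x < clifford_zero k i"
    using not_less_Least[of i "\<lambda>n. x < clifford_zero k n"] i unfolding m_def by auto
  moreover have "x \<noteq> clifford_zero k i"
    using assms clifford_clifford_zero[of i k] clifford_zero_0[of k] by (cases i) auto
  ultimately show ?thesis using that m i by force
qed

section \<open>Sign changes at consecutive zeros and interlacing\<close>

lemma clifford_ratio_strict_mono_between:
  assumes "clifford_zero k i < a" "a < b" "b < clifford_zero k (Suc i)"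
  shows "clifford_ratio k a < clifford_ratio k b"
  using assms by (intro clifford_ratio_strict_mono clifford_nonzero_between[of k i]) auto

text \<open>These values are minus the slopes of \<open>clifford k\<close> at consecutive zeros.
  With slopes of equal sign the function would cross zero once more in between.\<close>

lemma clifford_Suc_opposite_signs:
  assumes "1 \<le> i"
  shows "clifford (k + 1) (clifford_zero k i) * clifford (k + 1) (clifford_zero k (Suc i)) < 0"
proof (rule ccontr)
  let ?a = "clifford_zero k i" and ?b = "clifford_zero k (Suc i)"
  \<comment> \<open>Multiplying by the slope at the left zero makes both slopes positive under the
    assumption to be refuted.\<close>
  define s where "s = - clifford (k + 1) ?a"
  have ab: "?a < ?b" by (simp add: clifford_zero_less_iff)
  have zero: "clifford k ?a = 0" "clifford k ?b = 0" using assms by (auto intro: clifford_clifford_zero)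
  assume "\<not> ?thesis"
  moreover have "clifford (k + 1) ?a \<noteq> 0" "clifford (k + 1) ?b \<noteq> 0"
    using zero clifford_zero_simple by auto
  ultimately have s: "s * - clifford (k + 1) ?a > 0" "s * - clifford (k + 1) ?b > 0"
    by (auto simp: s_def not_less zero_less_mult_iff mult_le_0_iff order.order_iff_strict)
  define g where "g x = s * clifford k x" for x
  have g: "(g has_real_derivative s * - clifford (k + 1) x) (at x)" for x
    unfolding g_def by (rule derivative_eq_intros refl | simp)+
  obtain d1 where d1: "d1 > 0" "\<And>h. h > 0 \<Longrightarrow> h < d1 \<Longrightarrow> g ?a < g (?a + h)"
    using DERIV_pos_inc_right[OF g s(1)] by auto
  obtain d2 where d2: "d2 > 0" "\<And>h. h > 0 \<Longrightarrow> h < d2 \<Longrightarrow> g (?b - h) < g ?b"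
    using DERIV_pos_inc_left[OF g s(2)] by auto
  \<comment> \<open>A third keeps the two test points inside their neighbourhoods and in the right
    order.\<close>
  define h where "h = min (min d1 d2) (?b - ?a) / 3"
  have "min (min d1 d2) (?b - ?a) > 0" using d1 d2 ab by auto
  then have "h > 0" "h \<le> d1 / 3" "h \<le> d2 / 3" "h \<le> (?b - ?a) / 3" unfolding h_def by auto
  moreover have "u + h < v - h" if "h \<le> (v - u) / 3" "u < v" for u v :: real
  proof -
    have "3 * h \<le> v - u" using that(1) by simp
    then show ?thesis using that(2) by linarith
  qed
  ultimately have h: "h > 0" "h < d1" "h < d2" "?a + h < ?b - h" using d1(1) d2(1) ab by auto
  then have "g (?a + h) > 0" "g (?b - h) < 0" using d1 d2 zero by (force simp: g_def)+
  moreover have "continuous_on {?a + h..?b - h} g"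
    using g by (intro continuous_at_imp_continuous_on) (auto intro: DERIV_isCont)
  ultimately obtain x where "?a + h \<le> x" "x \<le> ?b - h" "g x = 0"
    using IVT2'[of g "?b - h" 0 "?a + h"] h by auto
  moreover from this have "clifford k x \<noteq> 0" using h by (intro clifford_nonzero_between[of k i]) auto
  moreover have "s \<noteq> 0" using s by auto
  ultimately show False by (simp add: g_def)
qed

text \<open>Between two poles the ratio runs through all real values and so meets any continuous w.
  To apply the intermediate value theorem on the closed interval, the equation is multiplied by
  \<open>clifford k\<close>; the signs at the ends then differ by the preceding lemma.\<close>

lemma clifford_ratio_intersection:
  assumes "1 \<le> i" and cont: "continuous_on {clifford_zero k i..clifford_zero k (Suc i)} w"
  obtains x where "clifford_zero k i < x" "x < clifford_zero k (Suc i)" "clifford_ratio k x = w x"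
proof -
  let ?a = "clifford_zero k i" and ?b = "clifford_zero k (Suc i)"
  define s where "s = clifford (k + 1) ?b"
  define g where "g x = s * (x * clifford (k + 1) x - w x * clifford k x)" for x
  have ab: "?a < ?b" "?a > 0" using clifford_zero_pos assms by (simp_all add: clifford_zero_less_iff)
  have zero: "clifford k ?a = 0" "clifford k ?b = 0" using assms by (auto intro: clifford_clifford_zero)
  have sa: "clifford (k + 1) ?a * s < 0" unfolding s_def by (rule clifford_Suc_opposite_signs[OF assms(1)])
  then have "s \<noteq> 0" by auto
  have "g ?a = ?a * (clifford (k + 1) ?a * s)" by (simp add: g_def zero)
  then have ga: "g ?a < 0" using sa ab by (simp add: mult_pos_neg)
  have "g ?b = ?b * (s * s)" by (simp add: g_def zero s_def)
  moreover have "s * s > 0" using \<open>s \<noteq> 0\<close> by (metis not_real_square_gt_zero)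
  ultimately have gb: "g ?b > 0" using ab by simp
  have "continuous_on {?a..?b} g" unfolding g_def by (intro continuous_intros cont)
  then obtain x where x: "?a \<le> x" "x \<le> ?b" "g x = 0"
    using IVT'[of g ?a 0 ?b] ga gb ab by auto
  then have "?a \<noteq> x" "?b \<noteq> x" using ga gb by auto
  then have lt: "?a < x" "x < ?b" using x by auto
  then have "clifford k x \<noteq> 0" by (rule clifford_nonzero_between)
  then have "clifford_ratio k x = w x"
    using x(3) \<open>s \<noteq> 0\<close> by (simp add: g_def clifford_ratio_def divide_simps)
  with lt that show ?thesis by blast
qed

text \<open>The first interval starts at 0, where the ratio is 0 instead of having a pole. It
  therefore never takes the negative values found on the left half-line, which is why roots are
  numbered from the first positive zero on.\<close>

lemma clifford_ratio_pos_first: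
  assumes "0 < x" "x < clifford_zero k 1"
  shows "0 < clifford_ratio k x"
proof -
  have "clifford k t \<noteq> 0" if "0 \<le> t" "t \<le> x" for t
    using that assms clifford_pos[of 0 k] clifford_nonzero_between[of k 0 t] clifford_zero_0[of k]
    by (cases "t = 0") auto
  then have "clifford_ratio k 0 < clifford_ratio k x" using assms(1) by (intro clifford_ratio_strict_mono)
  then show ?thesis by (simp add: clifford_ratio_def)
qed

lemma clifford_ratio_neg:
  assumes "x < 0"
  shows "clifford_ratio k x < 0"
  using assms clifford_pos[of x] by (simp add: clifford_ratio_def divide_neg_pos mult_neg_pos)

text \<open>Off the poles, the positive zeros of \<open>clifford (k + 1)\<close> are those of the
  ratio: none before the first zero of \<open>clifford k\<close>, then exactly one between
  consecutive zeros.\<close>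

lemma clifford_zero_interlace:
  assumes "1 \<le> l"
  shows "clifford_zero k l < clifford_zero (k + 1) l" "clifford_zero (k + 1) l < clifford_zero k (Suc l)"
    "\<And>x. clifford_zero k l < x \<Longrightarrow> x < clifford_zero k (Suc l) \<Longrightarrow>
       clifford_ratio k x < 0 \<longleftrightarrow> x < clifford_zero (k + 1) l"
proof -
  have "\<exists>x. clifford_zero k i < x \<and> x < clifford_zero k (Suc i) \<and> clifford_ratio k x = 0" if "1 \<le> i" for i
    using clifford_ratio_intersection[OF that, of k "\<lambda>_. 0"] by (auto intro!: continuous_intros)
  then obtain m where m: "\<And>i. 1 \<le> i \<Longrightarrow> clifford_zero k i < m i \<and> m i < clifford_zero k (Suc i) \<and> clifford_ratio k (m i) = 0"
    by metis
  have mpos: "0 < m i" if "1 \<le> i" for i using m[OF that] clifford_zero_pos[OF that] by (meson less_trans)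
  have m0: "clifford (k + 1) (m i) = 0" if "1 \<le> i" for i
    using m[OF that] mpos[OF that] clifford_nonzero_between[of k i "m i"] by (auto simp: clifford_ratio_def)
  have mono: "m i < m j" if "1 \<le> i" "i < j" for i j
  proof -
    have "m i < clifford_zero k (Suc i)" using m that by auto
    also have "\<dots> \<le> clifford_zero k j"
      using that by (simp add: strict_mono_less_eq[OF clifford_zero_strict_mono])
    also have "\<dots> < m j" using m that by auto
    finally show ?thesis .
  qed
  have eq: "{x. 0 < x \<and> clifford (k + 1) x = 0} = m ` {1..}"
  proof (intro equalityI subsetI)
    fix x assume "x \<in> {x. 0 < x \<and> clifford (k + 1) x = 0}"
    then have x: "0 < x" "clifford (k + 1) x = 0" by auto
    then have nz: "clifford k x \<noteq> 0" using clifford_zero_simple by blast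
    obtain i where i: "clifford_zero k i < x" "x < clifford_zero k (Suc i)"
      using clifford_zero_interval[OF x(1) nz] .
    have r0: "clifford_ratio k x = 0" using x by (simp add: clifford_ratio_def)
    have "i \<noteq> 0" using clifford_ratio_pos_first[of x k] i r0 x by (cases i) auto
    then have "1 \<le> i" by simp
    have "x = m i"
      using clifford_ratio_strict_mono_between[of k i x "m i"] clifford_ratio_strict_mono_between[of k i "m i" x]
        m[OF \<open>1 \<le> i\<close>] i r0 by (metis less_irrefl linorder_neqE_linordered_idom)
    then show "x \<in> m ` {1..}" using \<open>1 \<le> i\<close> by auto
  qed (use m0 mpos in auto)
  \<comment> \<open>\<open>pos_root\<close> does not depend on the enumeration, so it identifies the
    zeros \<open>m\<close> just found with the ones numbered by
    \<open>clifford_zero\<close>.\<close>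
  have "pos_root (clifford (k + 1)) l = m l" by (rule pos_root_eqI[OF mono eq assms])
  moreover have "pos_root (clifford (k + 1)) l = clifford_zero (k + 1) l"
    by (rule pos_root_eqI[OF _ clifford_zeros assms]) (simp add: clifford_zero_less_iff)
  ultimately have ml: "clifford_zero (k + 1) l = m l" by simp
  then show "clifford_zero k l < clifford_zero (k + 1) l" "clifford_zero (k + 1) l < clifford_zero k (Suc l)"
    using m[OF assms] by auto
  fix x assume x: "clifford_zero k l < x" "x < clifford_zero k (Suc l)"
  show "clifford_ratio k x < 0 \<longleftrightarrow> x < clifford_zero (k + 1) l"
    unfolding ml using clifford_ratio_strict_mono_between[of k l x "m l"]
      clifford_ratio_strict_mono_between[of k l "m l" x] m[OF assms] x
    by (metis less_asym less_irrefl linorder_neqE_linordered_idom)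
qed

section \<open>Eigenvalues\<close>

lemma clifford_nonzero: "x < 1 \<Longrightarrow> clifford k x \<noteq> 0"
  using clifford_pos[of x k] by simp

text \<open>The two Turan inequalities, of index k and k + 1, taken at -y and rewritten by the
  Riccati equation as bounds for y in terms of the ratio.\<close>

lemma clifford_ratio_minus_bounds:
  assumes "0 < y"
  shows "(clifford_ratio k (- y))\<^sup>2 - k * clifford_ratio k (- y) < y"
    and "y < (clifford_ratio k (- y))\<^sup>2 - (real k + 1) * clifford_ratio k (- y)"
proof -
  let ?c = "clifford k (- y)"
  have c: "?c > 0" using assms by (intro clifford_pos) auto
  note riccati = clifford_ratio_riccati[of k "- y", OF less_imp_neq[OF c, symmetric]]
  have "- y * (turan k (- y) / ?c\<^sup>2) < 0"
    using assms turan_pos[of k "- y"] c by (intro mult_neg_pos) auto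
  then show "(clifford_ratio k (- y))\<^sup>2 - k * clifford_ratio k (- y) < y"
    unfolding riccati by simp
  have "0 < y * (y * turan (k + 1) (- y)) / ?c\<^sup>2"
    using assms turan_pos[of "k + 1" "- y"] c by (intro divide_pos_pos mult_pos_pos) auto
  also have "\<dots> = - y * ((- y * turan (k + 1) (- y)) / ?c\<^sup>2)" by simp
  also have "\<dots> = - y * (turan k (- y) / ?c\<^sup>2) - clifford_ratio k (- y)"
    unfolding turan_recurrence clifford_ratio_def using c
    by (simp add: divide_simps power2_eq_square) (simp add: algebra_simps)
  finally show "y < (clifford_ratio k (- y))\<^sup>2 - (real k + 1) * clifford_ratio k (- y)"
    unfolding riccati by (simp add: algebra_simps)
qed

lemma clifford_ratio_minus_less_iff:
  assumes "0 < x" "0 < y"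
  shows "clifford_ratio k (- x) < clifford_ratio k (- y) \<longleftrightarrow> y < x"
proof -
  have *: "clifford_ratio k (- b) < clifford_ratio k (- a)" if "0 < a" "a < b" for a b
  proof (rule clifford_ratio_strict_mono)
    fix t assume "- b \<le> t" "t \<le> - a"
    then show "clifford k t \<noteq> 0" using that by (intro clifford_nonzero) auto
  qed (use that in auto)
  show ?thesis using *[of x y] *[of y x] assms by (metis less_asym linorder_neqE_linordered_idom)
qed

lemma clifford_ratio_minus_surj:
  assumes "s < 0"
  obtains y where "0 < y" "clifford_ratio k (- y) = s"
proof -
  \<comment> \<open>The map t^2 - (k+1) t decreases for negative t. Exceeding its value at s,
    \<open>b\<close> is so large that the upper bound above forces the ratio at -b below s.\<close>
  define b where "b = s\<^sup>2 - (real k + 1) * s + 1"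
  have "(real k + 1) * s \<le> 0" using assms by (intro mult_nonneg_nonpos) auto
  then have b: "b > 0" unfolding b_def using zero_le_power2[of s] by linarith
  define p where "p = clifford_ratio k (- b)"
  have p: "b < p\<^sup>2 - (real k + 1) * p" using clifford_ratio_minus_bounds(2)[OF b] by (simp add: p_def)
  have "p < s"
  proof (rule ccontr)
    assume "\<not> p < s"
    moreover have "p < 0" using clifford_ratio_neg[of "- b" k] b by (simp add: p_def)
    ultimately have "(s - p) * (s + p - (real k + 1)) \<ge> 0"
      using assms by (intro mult_nonpos_nonpos) auto
    with p show False by (simp add: b_def algebra_simps power2_eq_square)
  qed
  moreover have "continuous_on {- b..0} (clifford_ratio k)"
    by (intro continuous_at_imp_continuous_on ballI isCont_clifford_ratio clifford_nonzero) auto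
  ultimately obtain x where "- b \<le> x" "x \<le> 0" "clifford_ratio k x = s"
    using IVT'[of "clifford_ratio k" "- b" s 0] b assms by (auto simp: p_def clifford_ratio_def)
  moreover from this have "x \<noteq> 0" using assms by (auto simp: clifford_ratio_def)
  ultimately show ?thesis using that[of "- x"] by simp
qed

section \<open>Inverse branch on the negative axis and the product of the two arguments\<close>

lemma DERIV_inverse_open:
  fixes f g :: "real \<Rightarrow> real"
  assumes "open S" "x \<in> S" and der: "(f has_real_derivative d) (at x)" "d \<noteq> 0"
    and diff: "\<And>z. z \<in> S \<Longrightarrow> \<exists>d. (f has_real_derivative d) (at z)"
    and inv: "\<And>z. z \<in> S \<Longrightarrow> g (f z) = z"
  shows "(g has_real_derivative inverse d) (at (f x))"
  unfolding has_field_derivative_def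
proof (rule has_derivative_inverse_strong[where f = f])
  show "continuous_on S f"
    using diff by (intro continuous_at_imp_continuous_on) (auto intro: DERIV_isCont)
  show "(f has_derivative (*) d) (at x)" using der(1) by (simp add: has_field_derivative_def)
  show "(*) d \<circ> (*) (inverse d) = id" using der(2) by (auto simp: fun_eq_iff)
qed (use assms in auto)

text \<open>The inverse of y \<mapsto> \<open>clifford_ratio k (- y)\<close> on y > 0, a decreasing
  bijection onto the negative reals; meant for s < 0.\<close>

definition clifford_level :: "nat \<Rightarrow> real \<Rightarrow> real" where
  "clifford_level k s = (THE y. 0 < y \<and> clifford_ratio k (- y) = s)"

lemma clifford_level_ratio: "0 < y \<Longrightarrow> clifford_level k (clifford_ratio k (- y)) = y"
  unfolding clifford_level_def
proof (rule the_equality)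
  fix z assume "0 < y" "0 < z \<and> clifford_ratio k (- z) = clifford_ratio k (- y)"
  then show "z = y"
    using clifford_ratio_minus_less_iff[of z y k] clifford_ratio_minus_less_iff[of y z k] by auto
qed simp

lemma clifford_level:
  assumes "s < 0"
  shows "0 < clifford_level k s" "clifford_ratio k (- clifford_level k s) = s"
  using clifford_ratio_minus_surj[OF assms] clifford_level_ratio by metis+

lemma clifford_level_DERIV:
  fixes k :: nat
  assumes "s < 0"
  defines "y \<equiv> clifford_level k s"
  shows "(clifford_level k has_real_derivative - inverse (turan k (- y) / (clifford k (- y))\<^sup>2)) (at s)"
proof -
  have y: "0 < y" "clifford_ratio k (- y) = s" using clifford_level assms by auto
  have nz: "clifford k (- t) \<noteq> 0" if "t > 0" for t using that by (intro clifford_nonzero) auto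
  have der: "((\<lambda>y. clifford_ratio k (- y)) has_real_derivative turan k (- t) / (clifford k (- t))\<^sup>2 * (- 1)) (at t)"
    if "t > 0" for t
    by (rule DERIV_chain2[where g = uminus, OF clifford_ratio_DERIV[OF nz[OF that]]])
      (auto intro!: derivative_eq_intros)
  have "(clifford_level k has_real_derivative inverse (turan k (- y) / (clifford k (- y))\<^sup>2 * (- 1)))
      (at (clifford_ratio k (- y)))"
  proof (rule DERIV_inverse_open[of "{0<..}" y "\<lambda>y. clifford_ratio k (- y)"])
    show "turan k (- y) / (clifford k (- y))\<^sup>2 * - 1 \<noteq> 0"
      using nz[OF y(1)] turan_pos[of k "- y"] by auto
  qed (use y der clifford_level_ratio in auto)
  then show ?thesis by (simp add: y(2) inverse_minus_eq)
qed

definition clifford_product :: "nat \<Rightarrow> real \<Rightarrow> real" where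
  "clifford_product k x = x * clifford_level k (clifford_ratio k x)"

text \<open>With s the common ratio and A, B its slopes at x and -y, the derivative of the product
  is y - x A / B. The Riccati equation turns x A and y B into polynomials in x, y and s, so that
  \<open>y * B < x * A\<close> becomes an algebraic inequality.\<close>

lemma clifford_product_DERIV_neg:
  assumes l: "1 \<le> l" and x: "clifford_zero k l < x" "x < clifford_zero (k + 1) l"
  shows "\<exists>d<0. (clifford_product k has_real_derivative d) (at x)"
proof -
  have x': "x < clifford_zero k (Suc l)" using clifford_zero_interlace(2)[OF l, of k] x by simp
  have nz: "clifford k x \<noteq> 0" using x x' by (intro clifford_nonzero_between[of k l]) auto
  define s where "s = clifford_ratio k x"
  define y where "y = clifford_level k s"
  have s: "s < 0" using clifford_zero_interlace(3)[OF l, of k x] x x' by (simp add: s_def)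
  have y: "0 < y" "clifford_ratio k (- y) = s" using clifford_level[OF s] by (auto simp: y_def)
  have nzy: "clifford k (- y) > 0" using y by (intro clifford_pos) auto
  define A where "A = turan k x / (clifford k x)\<^sup>2"
  define B where "B = turan k (- y) / (clifford k (- y))\<^sup>2"
  have B: "B > 0" unfolding B_def using turan_pos[of k "- y"] nzy by auto
  have dA: "(clifford_ratio k has_real_derivative A) (at x)"
    unfolding A_def by (rule clifford_ratio_DERIV[OF nz])
  have dB: "(clifford_level k has_real_derivative - inverse B) (at (clifford_ratio k x))"
    using clifford_level_DERIV[OF s] unfolding B_def s_def y_def .
  have "((\<lambda>x. x * clifford_level k (clifford_ratio k x)) has_real_derivative
      1 * clifford_level k (clifford_ratio k x) + (- inverse B * A) * x) (at x)"
    by (rule DERIV_mult[OF DERIV_ident DERIV_chain2[OF dB dA]])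
  then have der: "(clifford_product k has_real_derivative y - x * A / B) (at x)"
    unfolding clifford_product_def by (simp add: y_def s_def divide_inverse mult_ac)
  have xA: "x * A = x + s\<^sup>2 - k * s"
    unfolding A_def s_def by (rule clifford_ratio_riccati[OF nz])
  have yB: "- y * B = - y + s\<^sup>2 - k * s"
    using clifford_ratio_riccati[of k "- y"] nzy unfolding B_def y(2) by simp
  have b1: "s\<^sup>2 - k * s < y" and b2: "y < s\<^sup>2 - (real k + 1) * s"
    using clifford_ratio_minus_bounds[OF y(1), of k] unfolding y(2) by auto
  \<comment> \<open>The bound \<open>b2\<close> gives y B < -s and x A > x + y + s, so this
    inequality is all that remains. It follows from (1 + s)^2 >= 0 once x \<ge> 1 and s^2 <
    y.\<close>
  have "- 2 * s < x + y"
  proof -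
    have "x \<ge> 1" using clifford_zero_ge_1[OF l, of k] x by linarith
    have "k * s \<le> 0" using s by (intro mult_nonneg_nonpos) auto
    then have "s\<^sup>2 < y" using b1 by linarith
    moreover have "(1 + s)\<^sup>2 \<ge> 0" by simp
    ultimately show ?thesis using \<open>x \<ge> 1\<close> by (simp add: power2_eq_square algebra_simps)
  qed
  then have "y * B < x * A" using xA yB b2 by (simp add: algebra_simps)
  then have "y - x * A / B < 0" using B by (simp add: field_simps)
  with der show ?thesis by blast
qed

lemma clifford_product_strict_antimono:
  assumes l: "1 \<le> l" and "clifford_zero k l < a" "a < b" "b < clifford_zero (k + 1) l"
  shows "clifford_product k b < clifford_product k a"
  using assms clifford_product_DERIV_neg[OF l, of k]
  by (intro DERIV_neg_imp_decreasing[of a b]) (auto, meson less_le_trans le_less_trans)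

text \<open>With \<open>\<alpha> = 2 sqrt x\<close> and \<open>\<kappa> = 4 sqrt q\<close>, this is the root of \<open>F \<kappa> k\<close> between the \<open>l\<close>-th zeros
  of \<open>J\<^sub>k\<close> and \<open>J\<^sub>k\<^sub>+\<^sub>1\<close>.\<close>
definition root_param :: "nat \<Rightarrow> nat \<Rightarrow> real \<Rightarrow> real" where
  "root_param k l q = (THE x. clifford_zero k l < x \<and> x < clifford_zero k (Suc l) \<and>
     clifford_ratio k x = clifford_ratio k (- (q / x)))"

text \<open>On the left the unknown x meets a curve that itself depends on q; on the right q is a
  value of a function not depending on q, which can be inverted. An intersection has negative ratio,
  hence lies before the zero of \<open>clifford (k + 1)\<close>.\<close>

lemma intersection_iff_product:
  assumes l: "1 \<le> l" and "0 < q" and x: "clifford_zero k l < x" "x < clifford_zero k (Suc l)"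
  shows "clifford_ratio k x = clifford_ratio k (- (q / x)) \<longleftrightarrow>
    x < clifford_zero (k + 1) l \<and> clifford_product k x = q"
proof -
  have "0 < x" using clifford_zero_pos[OF l, of k] x by simp
  then have q: "0 < q / x" using \<open>0 < q\<close> by simp
  show ?thesis
  proof
    assume *: "clifford_ratio k x = clifford_ratio k (- (q / x))"
    also have "\<dots> < 0" using q by (intro clifford_ratio_neg) auto
    finally have "x < clifford_zero (k + 1) l" using clifford_zero_interlace(3)[OF l x] by simp
    moreover have "clifford_product k x = q"
      unfolding clifford_product_def * clifford_level_ratio[OF q] using \<open>0 < x\<close> by simp
    ultimately show "x < clifford_zero (k + 1) l \<and> clifford_product k x = q" ..
  next
    assume *: "x < clifford_zero (k + 1) l \<and> clifford_product k x = q"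
    then have s: "clifford_ratio k x < 0" using clifford_zero_interlace(3)[OF l x] by simp
    from * have "q / x = clifford_level k (clifford_ratio k x)"
      using \<open>0 < x\<close> by (auto simp: clifford_product_def)
    then show "clifford_ratio k x = clifford_ratio k (- (q / x))"
      using clifford_level(2)[OF s, of k] by simp
  qed
qed

lemma root_param_unique:
  assumes l: "1 \<le> l" and "0 < q" and x: "clifford_zero k l < x" "x < clifford_zero k (Suc l)"
    and eq: "clifford_ratio k x = clifford_ratio k (- (q / x))"
  shows "root_param k l q = x"
  unfolding root_param_def
proof (rule the_equality)
  fix t assume t: "clifford_zero k l < t \<and> t < clifford_zero k (Suc l) \<and>
     clifford_ratio k t = clifford_ratio k (- (q / t))"
  have 1: "x < clifford_zero (k + 1) l" "clifford_product k x = q"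
    using intersection_iff_product[OF l \<open>0 < q\<close> x] eq by auto
  have 2: "t < clifford_zero (k + 1) l" "clifford_product k t = q"
    using intersection_iff_product[OF l \<open>0 < q\<close>, of k t] t by auto
  show "t = x"
    using clifford_product_strict_antimono[OF l, of k t x] clifford_product_strict_antimono[OF l, of k x t]
      1 2 x t by (metis less_irrefl linorder_neqE_linordered_idom)
qed (use assms in auto)

lemma root_param:
  assumes l: "1 \<le> l" and "0 < q"
  shows "clifford_zero k l < root_param k l q" "root_param k l q < clifford_zero (k + 1) l"
    "root_param k l q < clifford_zero k (Suc l)"
    "clifford_ratio k (root_param k l q) = clifford_ratio k (- (q / root_param k l q))"
    "clifford_product k (root_param k l q) = q"
proof -
  have "continuous_on {clifford_zero k l..clifford_zero k (Suc l)} (\<lambda>x. clifford_ratio k (- (q / x)))"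
  proof (intro continuous_at_imp_continuous_on ballI)
    fix x assume "x \<in> {clifford_zero k l..clifford_zero k (Suc l)}"
    then have "0 < x" using clifford_zero_pos[OF l, of k] by simp
    then have "0 < q / x" using \<open>0 < q\<close> by simp
    then have "isCont (clifford_ratio k) (- (q / x))"
      by (intro isCont_clifford_ratio clifford_nonzero) auto
    moreover have "isCont (\<lambda>x. - (q / x)) x"
      using \<open>0 < x\<close> by (auto intro!: continuous_intros)
    ultimately show "isCont (\<lambda>x. clifford_ratio k (- (q / x))) x"
      by (rule isCont_o2[rotated])
  qed
  then obtain x where x: "clifford_zero k l < x" "x < clifford_zero k (Suc l)"
      "clifford_ratio k x = clifford_ratio k (- (q / x))"
    using clifford_ratio_intersection[OF l] by metis
  have eq: "root_param k l q = x" using root_param_unique[OF assms x] .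
  show "clifford_zero k l < root_param k l q" "root_param k l q < clifford_zero k (Suc l)"
    "clifford_ratio k (root_param k l q) = clifford_ratio k (- (q / root_param k l q))"
    using x by (simp_all add: eq)
  show "root_param k l q < clifford_zero (k + 1) l" "clifford_product k (root_param k l q) = q"
    unfolding eq using intersection_iff_product[OF assms x(1,2)] x(3) by auto
qed

lemma root_param_pos: "1 \<le> l \<Longrightarrow> 0 < q \<Longrightarrow> 0 < root_param k l q"
  using root_param(1) clifford_zero_pos less_trans by blast

text \<open>Left inverse property, the hypothesis of the inverse function theorem in
  \<open>root_param_differentiable\<close>.\<close>

lemma root_param_product:
  assumes l: "1 \<le> l" and x: "clifford_zero k l < x" "x < clifford_zero (k + 1) l"
  shows "0 < clifford_product k x" "root_param k l (clifford_product k x) = x"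
proof -
  have x': "x < clifford_zero k (Suc l)" using clifford_zero_interlace(2)[OF l, of k] x by simp
  have "0 < x" using clifford_zero_pos[OF l, of k] x by simp
  moreover have "0 < clifford_level k (clifford_ratio k x)"
    using clifford_zero_interlace(3)[OF l x(1) x'] x(2) by (intro clifford_level) simp
  ultimately show *: "0 < clifford_product k x" by (simp add: clifford_product_def)
  show "root_param k l (clifford_product k x) = x"
    using intersection_iff_product[OF l * x(1) x'] x by (intro root_param_unique[OF l * x(1) x']) auto
qed

lemma root_param_strict_antimono:
  assumes l: "1 \<le> l" and q: "0 < p" "p < q"
  shows "root_param k l q < root_param k l p"
proof (rule ccontr)
  assume "\<not> ?thesis"
  moreover have "root_param k l q \<noteq> root_param k l p"
    using root_param(5)[OF l, of p k] root_param(5)[OF l, of q k] q by auto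
  ultimately have "clifford_product k (root_param k l q) < clifford_product k (root_param k l p)"
    using q by (intro clifford_product_strict_antimono[OF l] root_param[OF l]) auto
  then show False using root_param(5)[OF l, of p k] root_param(5)[OF l, of q k] q by auto
qed

text \<open>As q grows, x = \<open>root_param k l q\<close> falls and y = q / x rises, so both terms
  of 4 (x - y) move in the same direction.\<close>

lemma root_param_quotient_strict_mono:
  assumes l: "1 \<le> l" and q: "0 < p" "p < q"
  shows "p / root_param k l p < q / root_param k l q"
proof -
  have "p / root_param k l p < q / root_param k l p"
    using q root_param_pos[OF l, of p k] by (simp add: divide_strict_right_mono)
  also have "\<dots> < q / root_param k l q"
    using q root_param_pos[OF l, of q k] root_param_pos[OF l, of p k] root_param_strict_antimono[OF assms]
    by (intro divide_strict_left_mono) auto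
  finally show ?thesis .
qed

lemma root_param_differentiable:
  assumes l: "1 \<le> l" and q: "0 < q"
  shows "\<exists>d. (root_param k l has_real_derivative d) (at q)"
proof -
  let ?x = "root_param k l q" and ?S = "{clifford_zero k l<..<clifford_zero (k + 1) l}"
  have x: "?x \<in> ?S" using root_param[OF assms] by simp
  then obtain d where d: "d < 0" "(clifford_product k has_real_derivative d) (at ?x)"
    using clifford_product_DERIV_neg[OF l, of k ?x] by auto
  have "(root_param k l has_real_derivative inverse d) (at (clifford_product k ?x))"
  proof (rule DERIV_inverse_open[of ?S ?x "clifford_product k" d])
    fix z assume z: "z \<in> ?S"
    then show "\<exists>d. (clifford_product k has_real_derivative d) (at z)"
      using clifford_product_DERIV_neg[OF l, of k z] by auto
    show "root_param k l (clifford_product k z) = z"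
      using z root_param_product(2)[OF l, of k] by auto
  qed (use d x in auto)
  then show ?thesis using root_param(5)[OF assms] by auto
qed

lemma root_param_tendsto:
  assumes l: "1 \<le> l"
  shows "(root_param k l \<longlongrightarrow> clifford_zero (k + 1) l) (at_right 0)"
proof (rule order_tendstoI)
  fix a assume a: "a < clifford_zero (k + 1) l"
  \<comment> \<open>A point above a where the product is still positive; every q below that product
    has its root to the right of \<open>b\<close>.\<close>
  define b where "b = (max a (clifford_zero k l) + clifford_zero (k + 1) l) / 2"
  have b: "a < b" "clifford_zero k l < b" "b < clifford_zero (k + 1) l"
    using a clifford_zero_interlace(1)[OF l, of k] by (auto simp: b_def max_def)
  have "a < root_param k l q" if "0 < q" "q < clifford_product k b" for q
    using root_param_strict_antimono[OF l that, of k] root_param_product(2)[OF l b(2,3)] b(1) by simp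
  then show "\<forall>\<^sub>F q in at_right 0. a < root_param k l q"
    using root_param_product(1)[OF l b(2,3)] unfolding eventually_at_right_field by blast
next
  fix a assume "clifford_zero (k + 1) l < a"
  then show "\<forall>\<^sub>F q in at_right 0. root_param k l q < a"
    unfolding eventually_at_right_field using root_param(2)[OF l] by (metis less_trans zero_less_one)
qed

section \<open>Translation to Bessel functions and the roots of \<open>F\<close>\<close>

lemma bessel_J_eq: "bessel_J k a = (a / 2) ^ k * clifford k (a\<^sup>2 / 4)"
  and bessel_I_eq: "bessel_I k a = (a / 2) ^ k * clifford k (- (a\<^sup>2 / 4))"
proof -
  have p: "(a / 2) ^ (2 * m + k) = (a / 2) ^ k * (a\<^sup>2 / 4) ^ m" for m
  proof -
    have "a\<^sup>2 / 4 = (a / 2)\<^sup>2" by (simp add: power_divide)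
    then show ?thesis by (simp only: power_add power_mult) (rule mult.commute)
  qed
  have q: "(-1) ^ m * (- (a\<^sup>2 / 4)) ^ m = (a\<^sup>2 / 4) ^ m" for m
    by (simp add: power_mult_distrib[symmetric])
  have J: "(-1) ^ m / (fact m * fact (m + k)) * (a / 2) ^ (2 * m + k) =
      (a / 2) ^ k * ((-1) ^ m / (fact m * fact (m + k)) * (a\<^sup>2 / 4) ^ m)" for m
    unfolding p by (rule mult.left_commute)
  show "bessel_J k a = (a / 2) ^ k * clifford k (a\<^sup>2 / 4)"
    unfolding bessel_J_def clifford_def J by (rule suminf_mult[OF summable_clifford])
  have I: "1 / (fact m * fact (m + k)) * (a / 2) ^ (2 * m + k) =
      (a / 2) ^ k * ((-1) ^ m / (fact m * fact (m + k)) * (- (a\<^sup>2 / 4)) ^ m)" for m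
  proof -
    have "(-1) ^ m / (fact m * fact (m + k)) * (- (a\<^sup>2 / 4)) ^ m =
        ((-1) ^ m * (- (a\<^sup>2 / 4)) ^ m) / (fact m * fact (m + k))" by simp
    moreover have "1 / c * (A * B) = A * (B / c)" for A B c :: real by simp
    ultimately show ?thesis unfolding p q by metis
  qed
  show "bessel_I k a = (a / 2) ^ k * clifford k (- (a\<^sup>2 / 4))"
    unfolding bessel_I_def clifford_def I by (rule suminf_mult[OF summable_clifford])
qed

text \<open>One computation for both Bessel functions: \<open>e\<close> is 1 for J and -1 for
  I.\<close>

lemma power_clifford_DERIV:
  "((\<lambda>a. (a / 2) ^ k * clifford k (e * (a\<^sup>2 / 4))) has_real_derivative
     real k / 2 * (a / 2) ^ (k - 1) * clifford k (e * (a\<^sup>2 / 4)) -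
     (a / 2) ^ k * (e * (a / 2)) * clifford (k + 1) (e * (a\<^sup>2 / 4))) (at a)"
  by (rule derivative_eq_intros refl | simp)+

text \<open>The factor a restores the exponent k - 1 to k, which avoids a separate case k = 0;
  \<open>F\<close> contains the derivatives in exactly this form.\<close>

lemma deriv_bessel:
  "a * deriv (bessel_J k) a =
     (a / 2) ^ k * (k * clifford k (a\<^sup>2 / 4) - 2 * (a\<^sup>2 / 4) * clifford (k + 1) (a\<^sup>2 / 4))"
  "a * deriv (bessel_I k) a =
     (a / 2) ^ k * (k * clifford k (- (a\<^sup>2 / 4)) + 2 * (a\<^sup>2 / 4) * clifford (k + 1) (- (a\<^sup>2 / 4)))"
proof -
  have pw: "a * (real k / 2 * (a / 2) ^ (k - 1) * c) = (a / 2) ^ k * (k * c)" for c :: real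
    by (cases k) auto
  have J: "bessel_J k = (\<lambda>a. (a / 2) ^ k * clifford k (1 * (a\<^sup>2 / 4)))"
    and I: "bessel_I k = (\<lambda>a. (a / 2) ^ k * clifford k (- 1 * (a\<^sup>2 / 4)))"
    by (auto simp: bessel_J_eq bessel_I_eq)
  show "a * deriv (bessel_J k) a =
     (a / 2) ^ k * (k * clifford k (a\<^sup>2 / 4) - 2 * (a\<^sup>2 / 4) * clifford (k + 1) (a\<^sup>2 / 4))"
    unfolding J DERIV_imp_deriv[OF power_clifford_DERIV] right_diff_distrib pw
    by (simp add: power2_eq_square)
  show "a * deriv (bessel_I k) a =
     (a / 2) ^ k * (k * clifford k (- (a\<^sup>2 / 4)) + 2 * (a\<^sup>2 / 4) * clifford (k + 1) (- (a\<^sup>2 / 4)))"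
    unfolding I DERIV_imp_deriv[OF power_clifford_DERIV] right_diff_distrib pw
    by (simp add: power2_eq_square algebra_simps)
qed

text \<open>The equation of the two ratios at x and -y with denominators cleared. Up to sign it is
  the determinant of the two boundary conditions for the radial solutions with parameters x and
  -y.\<close>

definition char_fun :: "nat \<Rightarrow> real \<Rightarrow> real \<Rightarrow> real" where
  "char_fun k x y = x * clifford (k + 1) x * clifford k (- y) + y * clifford (k + 1) (- y) * clifford k x"

text \<open>At a zero of \<open>clifford k\<close> one summand survives, and it is nonzero because
  the zero is simple; so clearing denominators adds no solutions.\<close>

lemma char_fun_eq_0_iff:
  assumes "0 < x" "0 < y"
  shows "char_fun k x y = 0 \<longleftrightarrow> clifford k x \<noteq> 0 \<and> clifford_ratio k x = clifford_ratio k (- y)"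
proof -
  have "clifford k (- y) > 0" using assms by (intro clifford_pos) auto
  then show ?thesis
    using assms clifford_zero_simple[of k x]
    by (cases "clifford k x = 0")
      (auto simp: char_fun_def clifford_ratio_def divide_simps add_eq_0_iff2)
qed

text \<open>The contributions with the factor k from the two derivatives cancel.\<close>

lemma F_eq_char_fun:
  assumes "0 < a" "0 < \<kappa>"
  shows "F \<kappa> k a = 2 * (a / 2) ^ k * (\<kappa> / a / 2) ^ k * char_fun k (a\<^sup>2 / 4) ((\<kappa> / a)\<^sup>2 / 4)"
proof -
  define b where "b = \<kappa> / a"
  have "F \<kappa> k a = bessel_J k a * (b * deriv (bessel_I k) b) - bessel_I k b * (a * deriv (bessel_J k) a)"
    by (simp add: F_def b_def)
  also have "\<dots> = 2 * (a / 2) ^ k * (b / 2) ^ k * char_fun k (a\<^sup>2 / 4) (b\<^sup>2 / 4)"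
    unfolding deriv_bessel bessel_J_eq bessel_I_eq char_fun_def by (simp add: algebra_simps)
  finally show ?thesis by (simp add: b_def)
qed

lemma char_fun_root:
  assumes "0 < q" "0 < x"
  shows "char_fun k x (q / x) = 0 \<longleftrightarrow> (\<exists>l\<ge>1. x = root_param k l q)"
proof -
  have qx: "0 < q / x" using assms by simp
  show ?thesis unfolding char_fun_eq_0_iff[OF \<open>0 < x\<close> qx]
  proof
    assume *: "clifford k x \<noteq> 0 \<and> clifford_ratio k x = clifford_ratio k (- (q / x))"
    then obtain l where l: "clifford_zero k l < x" "x < clifford_zero k (Suc l)"
      using clifford_zero_interval \<open>0 < x\<close> by metis
    have "clifford_ratio k x < 0" using * clifford_ratio_neg[of "- (q / x)" k] qx by simp
    then have "l \<noteq> 0" using clifford_ratio_pos_first[of x k] l \<open>0 < x\<close> by (cases l) auto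
    then show "\<exists>l\<ge>1. x = root_param k l q"
      using root_param_unique[of l q k x] l * assms by (intro exI[of _ l]) auto
  next
    assume "\<exists>l\<ge>1. x = root_param k l q"
    then show "clifford k x \<noteq> 0 \<and> clifford_ratio k x = clifford_ratio k (- (q / x))"
      using root_param[OF _ \<open>0 < q\<close>, of _ k] clifford_nonzero_between by metis
  qed
qed

lemma alpha_eq:
  assumes "1 \<le> l" "0 < \<kappa>"
  shows "alpha \<kappa> k l = 2 * sqrt (root_param k l (\<kappa>\<^sup>2 / 16))"
  unfolding alpha_def
proof (rule pos_root_eqI[OF _ _ \<open>1 \<le> l\<close>])
  define q where "q = \<kappa>\<^sup>2 / 16"
  have q: "0 < q" using assms by (simp add: q_def)
  show "2 * sqrt (root_param k i (\<kappa>\<^sup>2 / 16)) < 2 * sqrt (root_param k j (\<kappa>\<^sup>2 / 16))" if "1 \<le> i" "i < j" for i j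
  proof -
    have "root_param k i q < clifford_zero k (Suc i)" using root_param q that by simp
    also have "\<dots> \<le> clifford_zero k j"
      using that by (simp add: strict_mono_less_eq[OF clifford_zero_strict_mono])
    also have "\<dots> < root_param k j q" using root_param q that by simp
    finally show ?thesis by (simp add: q_def)
  qed
  have *: "F \<kappa> k a = 0 \<longleftrightarrow> (\<exists>l\<ge>1. a\<^sup>2 / 4 = root_param k l q)" if "0 < a" for a
  proof -
    have "(\<kappa> / a)\<^sup>2 / 4 = q / (a\<^sup>2 / 4)" by (simp add: q_def power_divide)
    then have "F \<kappa> k a = 0 \<longleftrightarrow> char_fun k (a\<^sup>2 / 4) (q / (a\<^sup>2 / 4)) = 0"
      unfolding F_eq_char_fun[OF that \<open>0 < \<kappa>\<close>]
      using that \<open>0 < \<kappa>\<close> by (simp add: mult.commute)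
    also have "\<dots> \<longleftrightarrow> (\<exists>l\<ge>1. a\<^sup>2 / 4 = root_param k l q)"
      using q that by (intro char_fun_root) auto
    finally show ?thesis .
  qed
  show "{x. 0 < x \<and> F \<kappa> k x = 0} = (\<lambda>l. 2 * sqrt (root_param k l (\<kappa>\<^sup>2 / 16))) ` {1..}"
  proof (intro equalityI subsetI)
    fix a assume "a \<in> {x. 0 < x \<and> F \<kappa> k x = 0}"
    then obtain i where i: "0 < a" "1 \<le> i" "a\<^sup>2 / 4 = root_param k i q" using * by auto
    have "a = 2 * sqrt (a\<^sup>2 / 4)" using i(1) by (simp add: real_sqrt_divide)
    then show "a \<in> (\<lambda>l. 2 * sqrt (root_param k l (\<kappa>\<^sup>2 / 16))) ` {1..}"
      using i by (auto simp: q_def)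
  next
    fix a assume "a \<in> (\<lambda>l. 2 * sqrt (root_param k l (\<kappa>\<^sup>2 / 16))) ` {1..}"
    then obtain i where i: "1 \<le> i" "a = 2 * sqrt (root_param k i q)" by (auto simp: q_def)
    have "0 < root_param k i q" using root_param_pos i q by blast
    then have "0 < a" "a\<^sup>2 / 4 = root_param k i q" using i by (auto simp: power_mult_distrib)
    then show "a \<in> {x. 0 < x \<and> F \<kappa> k x = 0}" using * i by auto
  qed
qed

lemma bessel_root_eq:
  assumes "1 \<le> l"
  shows "bessel_root k l = 2 * sqrt (clifford_zero k l)"
  unfolding bessel_root_def
proof (rule pos_root_eqI[OF _ _ assms])
  show "2 * sqrt (clifford_zero k i) < 2 * sqrt (clifford_zero k j)" if "1 \<le> i" "i < j" for i j
    using that by (simp add: clifford_zero_less_iff)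
  show "{x. 0 < x \<and> bessel_J k x = 0} = (\<lambda>l. 2 * sqrt (clifford_zero k l)) ` {1..}"
  proof (intro equalityI subsetI)
    fix a assume "a \<in> {x. 0 < x \<and> bessel_J k x = 0}"
    then have a: "0 < a" "clifford k (a\<^sup>2 / 4) = 0" by (auto simp: bessel_J_eq)
    then obtain i where "1 \<le> i" "a\<^sup>2 / 4 = clifford_zero k i" by (auto elim!: clifford_zeroE[rotated])
    moreover have "a = 2 * sqrt (a\<^sup>2 / 4)" using a by (simp add: real_sqrt_divide)
    ultimately show "a \<in> (\<lambda>l. 2 * sqrt (clifford_zero k l)) ` {1..}" by auto
  next
    fix a assume "a \<in> (\<lambda>l. 2 * sqrt (clifford_zero k l)) ` {1..}"
    then obtain i where i: "1 \<le> i" "a = 2 * sqrt (clifford_zero k i)" by auto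
    then show "a \<in> {x. 0 < x \<and> bessel_J k x = 0}"
      using clifford_clifford_zero[OF i(1), of k] clifford_zero_pos[OF i(1), of k]
      by (simp add: bessel_J_eq power_mult_distrib)
  qed
qed

text \<open>This is \<alpha>^2 - \<kappa>^2/\<alpha>^2 for \<alpha> =
  \<open>alpha \<kappa> k l\<close>: on the J and I parts of the eigenfunction the Laplacian acts as
  -\<alpha>^2 and \<kappa>^2/\<alpha>^2, the two roots of t^2 + \<lambda> t + \<nu>.\<close>

definition eigenvalue :: "nat \<Rightarrow> nat \<Rightarrow> real \<Rightarrow> real" where
  "eigenvalue k l \<nu> = 4 * (root_param k l (- \<nu> / 16) - (- \<nu> / 16) / root_param k l (- \<nu> / 16))"

section \<open>Monotonicity, differentiability and limits of the eigenvalues\<close>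

lemma eigenvalue_strict_mono:
  assumes "1 \<le> l"
  shows "strict_mono_on {..<0} (eigenvalue k l)"
proof (rule strict_mono_onI)
  fix r s :: real assume "r \<in> {..<0}" "s \<in> {..<0}" "r < s"
  define p q where "p = - s / 16" and "q = - r / 16"
  have pq: "0 < p" "p < q" using \<open>s \<in> {..<0}\<close> \<open>r < s\<close> by (auto simp: p_def q_def)
  have "4 * (b - d) < 4 * (a - c)" if "b < a" "c < d" for a b c d :: real
    using that by simp
  from this[OF root_param_strict_antimono[OF assms pq, of k] root_param_quotient_strict_mono[OF assms pq, of k]]
  show "eigenvalue k l r < eigenvalue k l s"
    unfolding eigenvalue_def p_def[symmetric] q_def[symmetric] .
qed

lemma eigenvalue_differentiable:
  assumes "1 \<le> l"
  shows "eigenvalue k l differentiable_on {..<0}"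
proof (rule differentiable_at_imp_differentiable_on)
  fix \<nu> :: real assume "\<nu> \<in> {..<0}"
  then have q: "0 < - \<nu> / 16" by simp
  obtain d where d: "(root_param k l has_real_derivative d) (at (- \<nu> / 16))"
    using root_param_differentiable[OF assms q] by auto
  have "((\<lambda>\<nu>. root_param k l (- \<nu> / 16)) has_real_derivative d * (- 1 / 16)) (at \<nu>)"
    by (rule DERIV_chain2[where g = "\<lambda>\<nu>. - \<nu> / 16", OF d]) (auto intro!: derivative_eq_intros)
  then have "(\<lambda>\<nu>. root_param k l (- \<nu> / 16)) differentiable (at \<nu>)"
    using real_differentiable_def by blast
  then show "eigenvalue k l differentiable (at \<nu>)"
    unfolding eigenvalue_def using root_param_pos[OF assms q, of k]
    by (intro derivative_intros) auto
qed

lemma eigenvalue_at_bot: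
  assumes "1 \<le> l"
  shows "filterlim (eigenvalue k l) at_bot at_bot"
proof -
  define m where "m = clifford_zero (k + 1) l"
  have m: "m > 0" unfolding m_def by (rule clifford_zero_pos[OF assms])
  show ?thesis
    unfolding filterlim_at_bot
  proof
    fix Z :: real
    show "\<forall>\<^sub>F \<nu> in at_bot. eigenvalue k l \<nu> \<le> Z"
      \<comment> \<open>Since 0 < x < m, the eigenvalue is at most 4 m + \<nu> / (4 m); the
        threshold makes this at most Z.\<close>
      using eventually_gt_at_bot[of "min 0 ((Z - 4 * m) * (4 * m))"]
    proof eventually_elim
      fix \<nu> assume \<nu>: "\<nu> < min 0 ((Z - 4 * m) * (4 * m))"
      then have q: "0 < - \<nu> / 16" by simp
      define x where "x = root_param k l (- \<nu> / 16)"
      have x: "0 < x" "x < m"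
        using root_param_pos[OF assms q] root_param(2)[OF assms q] by (auto simp: x_def m_def)
      have "(- \<nu> / 16) / m \<le> (- \<nu> / 16) / x"
        using q x m by (intro divide_left_mono) auto
      then have "4 * (x - (- \<nu> / 16) / x) \<le> 4 * m + \<nu> / (4 * m)"
        using x by simp
      also have "\<nu> / (4 * m) \<le> Z - 4 * m" using \<nu> m by (simp add: pos_divide_le_eq)
      finally show "eigenvalue k l \<nu> \<le> Z" by (simp add: eigenvalue_def x_def)
    qed
  qed
qed

lemma eigenvalue_at_left_0:
  assumes "1 \<le> l"
  shows "(eigenvalue k l \<longlongrightarrow> (bessel_root (k + 1) l)\<^sup>2) (at_left 0)"
proof -
  let ?m = "clifford_zero (k + 1) l"
  have m: "?m > 0" by (rule clifford_zero_pos[OF assms])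
  have "filterlim (\<lambda>\<nu>::real. - \<nu> / 16) (at_right 0) (at_left 0)"
    unfolding filterlim_at
    by (auto intro!: tendsto_eq_intros simp: eventually_at_left_field intro: exI[of _ "-1"])
  from filterlim_compose[OF root_param_tendsto[OF assms] this]
  have r: "((\<lambda>\<nu>. root_param k l (- \<nu> / 16)) \<longlongrightarrow> ?m) (at_left 0)" .
  have "(eigenvalue k l \<longlongrightarrow> 4 * (?m - (- 0 / 16) / ?m)) (at_left 0)"
    unfolding eigenvalue_def using m by (intro tendsto_intros r) auto
  then show ?thesis using bessel_root_eq[OF assms, of "k + 1"] m by (simp add: power_mult_distrib)
qed

section \<open>Radial profiles\<close>

text \<open>The radial factor without r^k, in the variable \<rho> = r^2: \<open>u\<close> comes from
  J and \<open>v\<close> from I. The assumptions say that (X, Y) is the l-th root, with the pole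
  interval recorded for the later count.\<close>

locale radial_profile =
  fixes k l :: nat and X Y :: real
  assumes Y_pos: "0 < Y" and l: "1 \<le> l"
    and X_gt: "clifford_zero k l < X" and X_less: "X < clifford_zero k (Suc l)"
    and ratio_eq: "clifford_ratio k X = clifford_ratio k (- Y)"
begin

lemma X_pos: "0 < X"
  using X_gt clifford_zero_pos[OF l, of k] by simp

abbreviation "u \<rho> \<equiv> clifford k (X * \<rho>)"
abbreviation "v \<rho> \<equiv> clifford k (- Y * \<rho>)"

text \<open>u v' - u' v. It varies with \<rho> because \<open>u\<close> and \<open>v\<close> solve
  different equations; that it vanishes at 1 is the boundary condition.\<close>

definition wronskian :: "real \<Rightarrow> real" where
  "wronskian \<rho> = X * clifford (k + 1) (X * \<rho>) * v \<rho> + Y * u \<rho> * clifford (k + 1) (- Y * \<rho>)"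

lemma v_pos: "0 \<le> \<rho> \<Longrightarrow> 0 < v \<rho>"
proof -
  assume "0 \<le> \<rho>"
  then have "0 \<le> Y * \<rho>" using Y_pos by simp
  then have "- Y * \<rho> < 1" by linarith
  then show "0 < v \<rho>" by (rule clifford_pos)
qed

lemma char_fun_wronskian: "char_fun k (X * \<rho>) (Y * \<rho>) = \<rho> * wronskian \<rho>"
  by (simp add: char_fun_def wronskian_def algebra_simps)

lemma wronskian_eq_0_iff:
  assumes "0 < \<rho>"
  shows "wronskian \<rho> = 0 \<longleftrightarrow> u \<rho> \<noteq> 0 \<and> clifford_ratio k (X * \<rho>) = clifford_ratio k (- Y * \<rho>)"
  using char_fun_eq_0_iff[of "X * \<rho>" "Y * \<rho>" k] assms X_pos Y_pos
  by (simp add: char_fun_wronskian)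

text \<open>The profile that vanishes at 1 is a multiple of v(1) u - u(1) v, so its roots are the
  points where \<psi> returns to its value at 1.\<close>

definition \<psi> :: "real \<Rightarrow> real" where
  "\<psi> \<rho> = u \<rho> / v \<rho>"

lemma \<psi>_DERIV:
  assumes "0 \<le> \<rho>"
  shows "(\<psi> has_real_derivative - wronskian \<rho> / (v \<rho>)\<^sup>2) (at \<rho>)"
proof -
  have "((\<lambda>\<rho>. u \<rho> / v \<rho>) has_real_derivative - wronskian \<rho> / (v \<rho>)\<^sup>2) (at \<rho>)"
    using v_pos[OF assms]
    apply -
    apply (rule derivative_eq_intros refl | simp)+
    by (simp add: wronskian_def divide_simps power2_eq_square)
  then show ?thesis unfolding \<psi>_def .
qed

lemma wronskian_DERIV:
  "(wronskian has_real_derivative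
     Y\<^sup>2 * u \<rho> * clifford (k + 2) (- Y * \<rho>) - X\<^sup>2 * clifford (k + 2) (X * \<rho>) * v \<rho>) (at \<rho>)"
proof -
  have "((\<lambda>\<rho>. X * clifford (k + 1) (X * \<rho>) * v \<rho> + Y * u \<rho> * clifford (k + 1) (- Y * \<rho>))
    has_real_derivative
      Y\<^sup>2 * u \<rho> * clifford (k + 2) (- Y * \<rho>) - X\<^sup>2 * clifford (k + 2) (X * \<rho>) * v \<rho>) (at \<rho>)"
    apply (rule derivative_eq_intros refl | simp)+
    by (simp add: power2_eq_square algebra_simps)
  moreover have "wronskian =
      (\<lambda>\<rho>. X * clifford (k + 1) (X * \<rho>) * v \<rho> + Y * u \<rho> * clifford (k + 1) (- Y * \<rho>))"
    by (rule ext) (rule wronskian_def)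
  ultimately show ?thesis by simp
qed

lemma wronskian_ode:
  "\<rho> * (Y\<^sup>2 * u \<rho> * clifford (k + 2) (- Y * \<rho>) - X\<^sup>2 * clifford (k + 2) (X * \<rho>) * v \<rho>) =
     (X + Y) * u \<rho> * v \<rho> - (real k + 1) * wronskian \<rho>"
proof -
  have "X * \<rho> * clifford (k + 2) (X * \<rho>) = (real k + 1) * clifford (k + 1) (X * \<rho>) - u \<rho>"
    using clifford_recurrence[of k "X * \<rho>"] by simp
  moreover have "- Y * \<rho> * clifford (k + 2) (- Y * \<rho>) = (real k + 1) * clifford (k + 1) (- Y * \<rho>) - v \<rho>"
    using clifford_recurrence[of k "- Y * \<rho>"] by simp
  ultimately show ?thesis unfolding wronskian_def by algebra
qed

text \<open>Energy of the equation \<open>(P \<psi>')' + (X + Y) P \<psi> / \<rho> = 0\<close> with the increasing weight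
  \<open>P = \<rho>\<^sup>k\<^sup>+\<^sup>1 v\<^sup>2\<close>: since it decreases, so do the values of \<open>\<bar>\<psi>\<bar>\<close> at the critical points.\<close>
definition energy :: "real \<Rightarrow> real" where
  "energy \<rho> = (X + Y) * (\<psi> \<rho>)\<^sup>2 + \<rho> * (wronskian \<rho>)\<^sup>2 / (v \<rho>) ^ 4"

text \<open>The terms containing \<psi> cancel through \<open>wronskian_ode\<close>, and what
  remains is a negative multiple of the squared Wronskian.\<close>

lemma energy_DERIV:
  assumes "0 \<le> \<rho>"
  shows "(energy has_real_derivative - ((wronskian \<rho>)\<^sup>2 / (v \<rho>) ^ 4 *
      (2 * real k + 1 + 4 * \<rho> * (Y * clifford (k + 1) (- Y * \<rho>)) / v \<rho>))) (at \<rho>)"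
proof -
  let ?W = "wronskian \<rho>" and ?v = "v \<rho>" and ?u = "u \<rho>" and ?w = "Y * clifford (k + 1) (- Y * \<rho>)"
  define W' where "W' = Y\<^sup>2 * u \<rho> * clifford (k + 2) (- Y * \<rho>) - X\<^sup>2 * clifford (k + 2) (X * \<rho>) * v \<rho>"
  have v: "?v > 0" by (rule v_pos[OF assms])
  have dv: "((\<lambda>\<rho>. v \<rho>) has_real_derivative ?w) (at \<rho>)"
    apply (rule derivative_eq_intros refl | simp)+
    done
  have "((\<lambda>\<rho>. (X + Y) * (\<psi> \<rho>)\<^sup>2 + \<rho> * (wronskian \<rho>)\<^sup>2 / (v \<rho>) ^ 4) has_real_derivative
      (X + Y) * (2 * \<psi> \<rho> * (- ?W / ?v\<^sup>2)) +
      ((?W\<^sup>2 + \<rho> * (2 * ?W * W')) * ?v ^ 4 - \<rho> * ?W\<^sup>2 * (4 * ?v ^ 3 * ?w)) / (?v ^ 4 * ?v ^ 4)) (at \<rho>)"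
    using v
    apply -
    apply (rule derivative_eq_intros \<psi>_DERIV[OF assms] wronskian_DERIV[folded W'_def] dv refl | simp)+
    by (simp add: W'_def algebra_simps)
  moreover have "(X + Y) * (2 * \<psi> \<rho> * (- ?W / ?v\<^sup>2)) +
      ((?W\<^sup>2 + \<rho> * (2 * ?W * W')) * ?v ^ 4 - \<rho> * ?W\<^sup>2 * (4 * ?v ^ 3 * ?w)) / (?v ^ 4 * ?v ^ 4) =
      - (?W\<^sup>2 / ?v ^ 4 * (2 * real k + 1 + 4 * \<rho> * ?w / ?v))"
  proof -
    have "\<rho> * W' = (X + Y) * ?u * ?v - (real k + 1) * ?W"
      unfolding W'_def by (rule wronskian_ode)
    then have *: "\<rho> * (2 * ?W * W') = 2 * ?W * ((X + Y) * ?u * ?v - (real k + 1) * ?W)"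
      by (metis mult.left_commute)
    show ?thesis unfolding * \<psi>_def using v
      by (simp add: divide_simps) (simp add: eval_nat_numeral algebra_simps)
  qed
  ultimately show ?thesis unfolding energy_def by simp
qed

lemma energy_strict_antimono:
  assumes "0 \<le> a" "a < b" and nz: "\<And>\<rho>. a < \<rho> \<Longrightarrow> \<rho> < b \<Longrightarrow> wronskian \<rho> \<noteq> 0"
  shows "energy b < energy a"
proof (rule DERIV_neg_imp_decreasing_open[OF \<open>a < b\<close>])
  fix \<rho> assume \<rho>: "a < \<rho>" "\<rho> < b"
  have "Y * \<rho> > 0" using \<rho> assms Y_pos by simp
  then have "clifford (k + 1) (- Y * \<rho>) > 0" by (intro clifford_pos) simp
  then have "0 \<le> 4 * \<rho> * (Y * clifford (k + 1) (- Y * \<rho>)) / v \<rho>"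
    using \<rho> assms Y_pos v_pos[of \<rho>] by (intro divide_nonneg_pos mult_nonneg_nonneg) auto
  then have "0 < 2 * real k + 1 + 4 * \<rho> * (Y * clifford (k + 1) (- Y * \<rho>)) / v \<rho>" by linarith
  moreover have "0 < (wronskian \<rho>)\<^sup>2 / (v \<rho>) ^ 4" using nz[OF \<rho>] v_pos[of \<rho>] \<rho> assms by simp
  ultimately have "0 < (wronskian \<rho>)\<^sup>2 / (v \<rho>) ^ 4 *
      (2 * real k + 1 + 4 * \<rho> * (Y * clifford (k + 1) (- Y * \<rho>)) / v \<rho>)"
    by (intro mult_pos_pos)
  moreover have "0 \<le> \<rho>" using \<rho> assms by simp
  ultimately show "\<exists>y. (energy has_real_derivative y) (at \<rho>) \<and> y < 0"
    using energy_DERIV neg_less_0_iff_less by blast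
next
  show "continuous_on {a..b} energy"
    using \<open>0 \<le> a\<close>
    by (intro continuous_at_imp_continuous_on ballI DERIV_isCont[OF energy_DERIV]) simp
qed

text \<open>Between two poles \<open>clifford_ratio k (X * \<rho>)\<close> increases with \<rho>
  while \<open>clifford_ratio k (- Y * \<rho>)\<close> decreases, so they agree at most
  once.\<close>

lemma critical_points_unique:
  assumes "1 \<le> i" "clifford_zero k i < X * \<rho>" "X * \<rho> < clifford_zero k (Suc i)" "wronskian \<rho> = 0"
    "clifford_zero k i < X * \<rho>'" "X * \<rho>' < clifford_zero k (Suc i)" "wronskian \<rho>' = 0"
  shows "\<rho> = \<rho>'"
proof -
  have *: False if "a < b" "clifford_zero k i < X * a" "X * b < clifford_zero k (Suc i)"
    "wronskian a = 0" "wronskian b = 0" for a b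
  proof -
    have "0 < X * a" using that clifford_zero_pos[OF \<open>1 \<le> i\<close>, of k] by simp
    then have ab: "0 < a" "0 < b" using X_pos that by (auto simp: zero_less_mult_iff)
    have "clifford_ratio k (X * a) < clifford_ratio k (X * b)"
      using that X_pos by (intro clifford_ratio_strict_mono_between[of k i]) auto
    moreover have "clifford_ratio k (- (Y * b)) < clifford_ratio k (- (Y * a))"
      using ab that Y_pos by (subst clifford_ratio_minus_less_iff) auto
    ultimately show False
      using wronskian_eq_0_iff[OF ab(1)] wronskian_eq_0_iff[OF ab(2)] that by simp
  qed
  show ?thesis
    by (cases rule: linorder_cases[of \<rho> \<rho>']) (use *[of \<rho> \<rho>'] *[of \<rho>' \<rho>] assms in auto)
qed

lemma wronskian_1: "wronskian 1 = 0"
  using wronskian_eq_0_iff[of 1] ratio_eq clifford_nonzero_between[OF X_gt X_less] by simp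

lemma critical_points:
  obtains \<sigma> :: "nat \<Rightarrow> real" where "\<sigma> 0 = 0" "\<sigma> l = 1" "strict_mono \<sigma>"
    "\<And>i. clifford_zero k i \<le> X * \<sigma> i" "\<And>i. X * \<sigma> i < clifford_zero k (Suc i)"
    "\<And>i \<rho>. \<sigma> i < \<rho> \<Longrightarrow> \<rho> < \<sigma> (Suc i) \<Longrightarrow> wronskian \<rho> \<noteq> 0"
    "\<And>i. 1 \<le> i \<Longrightarrow> clifford_zero k i < X * \<sigma> i" "\<And>i. 1 \<le> i \<Longrightarrow> wronskian (\<sigma> i) = 0"
proof -
  have ex: "\<exists>\<rho>. clifford_zero k i < X * \<rho> \<and> X * \<rho> < clifford_zero k (Suc i) \<and> wronskian \<rho> = 0"
    if i: "1 \<le> i" for i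
  proof -
    have cont: "continuous_on {clifford_zero k i..clifford_zero k (Suc i)} (\<lambda>x. clifford_ratio k (- (Y / X * x)))"
    proof (intro continuous_at_imp_continuous_on ballI)
      fix x assume "x \<in> {clifford_zero k i..clifford_zero k (Suc i)}"
      then have "0 < x" using clifford_zero_pos[OF that, of k] by simp
      then have "0 < Y / X * x" using X_pos Y_pos by simp
      then have "isCont (clifford_ratio k) (- (Y / X * x))"
        by (intro isCont_clifford_ratio clifford_nonzero) auto
      moreover have "isCont (\<lambda>x. - (Y / X * x)) x" using X_pos by (auto intro!: continuous_intros)
      ultimately show "isCont (\<lambda>x. clifford_ratio k (- (Y / X * x))) x"
        by (rule isCont_o2[rotated])
    qed
    obtain x where x: "clifford_zero k i < x" "x < clifford_zero k (Suc i)"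
        "clifford_ratio k x = clifford_ratio k (- (Y / X * x))"
      using clifford_ratio_intersection[OF i cont] by blast
    have "0 < x" using x clifford_zero_pos[OF that, of k] by simp
    define \<rho> where "\<rho> = x / X"
    have \<rho>: "X * \<rho> = x" "Y / X * x = Y * \<rho>" "0 < \<rho>" using X_pos \<open>0 < x\<close> by (auto simp: \<rho>_def)
    then have "wronskian \<rho> = 0"
      using wronskian_eq_0_iff[OF \<rho>(3)] x clifford_nonzero_between[OF x(1,2)] by simp
    with x \<rho> show ?thesis by blast
  qed
  \<comment> \<open>The Wronskian is positive at 0, so \<sigma> 0 is no critical point; it only
    closes off the first interval.\<close>
  define \<sigma> where "\<sigma> i = (if i = 0 then 0 else
    (SOME \<rho>. clifford_zero k i < X * \<rho> \<and> X * \<rho> < clifford_zero k (Suc i) \<and> wronskian \<rho> = 0))" for i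
  have \<sigma>: "clifford_zero k i < X * \<sigma> i" "X * \<sigma> i < clifford_zero k (Suc i)" "wronskian (\<sigma> i) = 0"
    if "1 \<le> i" for i
    using someI_ex[OF ex[OF that]] that unfolding \<sigma>_def by auto
  have \<sigma>0: "\<sigma> 0 = 0" by (simp add: \<sigma>_def)
  have lo: "clifford_zero k i \<le> X * \<sigma> i" for i
    using \<sigma>(1)[of i] by (cases i) (auto simp: \<sigma>0 clifford_zero_0)
  have hi: "X * \<sigma> i < clifford_zero k (Suc i)" for i
    using \<sigma>(2)[of i] clifford_zero_pos[of 1 k] by (cases i) (auto simp: \<sigma>0)
  have mono: "strict_mono \<sigma>"
  proof (rule strict_monoI_Suc)
    fix i
    have "X * \<sigma> i < X * \<sigma> (Suc i)" using hi[of i] lo[of "Suc i"] by simp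
    then show "\<sigma> i < \<sigma> (Suc i)" using X_pos by simp
  qed
  have nz: "wronskian \<rho> \<noteq> 0" if \<rho>: "\<sigma> i < \<rho>" "\<rho> < \<sigma> (Suc i)" for i \<rho>
  proof
    assume w: "wronskian \<rho> = 0"
    have "0 \<le> \<sigma> i" using strict_mono_less_eq[OF mono, of 0 i] \<sigma>0 by simp
    then have "0 < \<rho>" using \<rho> by simp
    then have pos: "0 < X * \<rho>" "0 < Y * \<rho>" using X_pos Y_pos by auto
    have nzr: "u \<rho> \<noteq> 0" and eq: "clifford_ratio k (X * \<rho>) = clifford_ratio k (- Y * \<rho>)"
      using wronskian_eq_0_iff[OF \<open>0 < \<rho>\<close>] w by auto
    obtain j where j: "clifford_zero k j < X * \<rho>" "X * \<rho> < clifford_zero k (Suc j)"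
      using clifford_zero_interval[OF pos(1) nzr] .
    have "clifford_ratio k (X * \<rho>) < 0"
      unfolding eq using pos by (intro clifford_ratio_neg) simp
    then have "j \<noteq> 0" using clifford_ratio_pos_first[of "X * \<rho>" k] j pos by (cases j) auto
    then have "1 \<le> j" by simp
    then have "\<rho> = \<sigma> j" using critical_points_unique[of j \<rho> "\<sigma> j"] j w \<sigma> by blast
    then show False using \<rho> strict_mono_less[OF mono] by auto
  qed
  have "\<sigma> l = 1"
    using critical_points_unique[OF l, of "\<sigma> l" 1] \<sigma>[OF l] X_gt X_less wronskian_1 by simp
  then show ?thesis using that[of \<sigma>] \<sigma> \<sigma>0 lo hi mono nz by blast
qed

lemma \<psi>_inj_on:
  assumes "0 \<le> a" and nz: "\<And>\<rho>. a < \<rho> \<Longrightarrow> \<rho> < b \<Longrightarrow> wronskian \<rho> \<noteq> 0"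
  shows "inj_on \<psi> {a..b}"
proof -
  have *: False if "a \<le> s" "s < t" "t \<le> b" "\<psi> s = \<psi> t" for s t
  proof -
    have "continuous_on {s..t} \<psi>"
      using assms that
      by (intro continuous_at_imp_continuous_on ballI DERIV_isCont[OF \<psi>_DERIV]) simp
    moreover have "\<psi> differentiable (at x)" if "s < x" "x < t" for x
      using \<psi>_DERIV[of x] that \<open>a \<le> s\<close> \<open>0 \<le> a\<close> by (auto simp: real_differentiable_def)
    ultimately obtain x where x: "s < x" "x < t" "(\<psi> has_real_derivative 0) (at x)"
      using Rolle[OF \<open>s < t\<close> \<open>\<psi> s = \<psi> t\<close>] by (auto simp: has_field_derivative_def)
    then have "0 = - wronskian x / (v x)\<^sup>2"
      using \<psi>_DERIV[of x] that \<open>0 \<le> a\<close> by (intro DERIV_unique) auto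
    then show False using nz[of x] x that v_pos[of x] \<open>0 \<le> a\<close> by auto
  qed
  show ?thesis by (rule inj_onI) (metis "*" atLeastAtMost_iff linorder_neqE_linordered_idom)
qed

text \<open>On each interval between neighbouring points \<sigma> the function \<psi> is injective.
  On all but the last its end values have opposite signs and modulus above that of \<psi> 1, so the
  value \<psi> 1 occurs exactly once.\<close>

lemma radial_zeros:
  defines "Z \<equiv> {\<rho>. 0 < \<rho> \<and> \<rho> < 1 \<and> \<psi> \<rho> = \<psi> 1}"
  shows "finite Z" "card Z = l - 1" "\<And>\<rho>. \<rho> \<in> Z \<Longrightarrow> wronskian \<rho> \<noteq> 0"
proof -
  obtain \<sigma> where \<sigma>: "\<sigma> 0 = 0" "\<sigma> l = 1" "strict_mono \<sigma>"
    "\<And>i. clifford_zero k i \<le> X * \<sigma> i" "\<And>i. X * \<sigma> i < clifford_zero k (Suc i)"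
    and nz: "\<And>i \<rho>. \<sigma> i < \<rho> \<Longrightarrow> \<rho> < \<sigma> (Suc i) \<Longrightarrow> wronskian \<rho> \<noteq> 0"
    and \<sigma>1: "\<And>i. 1 \<le> i \<Longrightarrow> clifford_zero k i < X * \<sigma> i" "\<And>i. 1 \<le> i \<Longrightarrow> wronskian (\<sigma> i) = 0"
    using critical_points by blast
  note less = strict_mono_less[OF \<sigma>(3)] and less_eq = strict_mono_less_eq[OF \<sigma>(3)]
  have nonneg: "0 \<le> \<sigma> i" for i using less_eq[of 0 i] \<sigma>(1) by simp
  have inj: "inj_on \<psi> {\<sigma> i..\<sigma> (Suc i)}" for i by (rule \<psi>_inj_on[OF nonneg nz])
  have cont: "continuous_on {\<sigma> i..\<sigma> (Suc i)} \<psi>" for i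
    using nonneg[of i]
    by (intro continuous_at_imp_continuous_on ballI DERIV_isCont[OF \<psi>_DERIV]) simp
  have energy_Suc: "energy (\<sigma> (Suc i)) < energy (\<sigma> i)" for i
    by (rule energy_strict_antimono[OF nonneg _ nz]) (simp add: less)
  have energy_less: "energy (\<sigma> j) < energy (\<sigma> i)" if "i < j" for i j
    using that by (rule less_Suc_induct) (auto intro: energy_Suc)
  \<comment> \<open>For i = 0 it is the factor \<rho>, not the Wronskian, that removes the second
    term.\<close>
  have energy_crit: "energy (\<sigma> i) = (X + Y) * (\<psi> (\<sigma> i))\<^sup>2" for i
    by (cases "i = 0") (use \<sigma>1(2)[of i] \<sigma>(1) in \<open>auto simp: energy_def\<close>)
  have big: "\<bar>\<psi> 1\<bar> < \<bar>\<psi> (\<sigma> i)\<bar>" if "i < l" for i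
  proof -
    have "(X + Y) * (\<psi> 1)\<^sup>2 < (X + Y) * (\<psi> (\<sigma> i))\<^sup>2"
      using energy_less[OF that] energy_crit[of i] energy_crit[of l] \<sigma>(2) by simp
    then have "(\<psi> 1)\<^sup>2 < (\<psi> (\<sigma> i))\<^sup>2" using X_pos Y_pos by simp
    then show ?thesis by (metis abs_le_square_iff not_less)
  qed
  have ex: "\<exists>\<rho>. \<sigma> i < \<rho> \<and> \<rho> < \<sigma> (Suc i) \<and> \<psi> \<rho> = \<psi> 1" if i: "Suc i < l" for i
  proof -
    \<comment> \<open>A zero of \<open>u\<close> strictly between the two points; there the
      injective function \<psi> changes sign.\<close>
    define p where "p = clifford_zero k (Suc i) / X"
    have Xp: "X * p = clifford_zero k (Suc i)" using X_pos by (simp add: p_def)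
    have "X * \<sigma> i < X * p" "X * p < X * \<sigma> (Suc i)" using \<sigma>(5)[of i] \<sigma>1(1)[of "Suc i"] by (auto simp: Xp)
    then have p: "\<sigma> i < p" "p < \<sigma> (Suc i)" using X_pos by auto
    have "\<psi> p = 0" using clifford_clifford_zero[of "Suc i" k] by (simp add: \<psi>_def Xp)
    then have "\<psi> (\<sigma> i) < 0 \<and> 0 < \<psi> (\<sigma> (Suc i)) \<or> \<psi> (\<sigma> (Suc i)) < 0 \<and> 0 < \<psi> (\<sigma> i)"
      using continuous_inj_imp_mono[OF p cont inj] by auto
    moreover have "\<bar>\<psi> 1\<bar> < \<bar>\<psi> (\<sigma> i)\<bar>" "\<bar>\<psi> 1\<bar> < \<bar>\<psi> (\<sigma> (Suc i))\<bar>" using big i by auto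
    ultimately have b: "\<psi> (\<sigma> i) < \<psi> 1 \<and> \<psi> 1 < \<psi> (\<sigma> (Suc i)) \<or> \<psi> (\<sigma> (Suc i)) < \<psi> 1 \<and> \<psi> 1 < \<psi> (\<sigma> i)"
      by linarith
    have "\<sigma> i \<le> \<sigma> (Suc i)" by (simp add: less_eq)
    then obtain \<rho> where \<rho>: "\<sigma> i \<le> \<rho>" "\<rho> \<le> \<sigma> (Suc i)" "\<psi> \<rho> = \<psi> 1"
      using b IVT'[of \<psi> "\<sigma> i" "\<psi> 1" "\<sigma> (Suc i)"] IVT2'[of \<psi> "\<sigma> (Suc i)" "\<psi> 1" "\<sigma> i"] cont[of i]
      by auto
    moreover have "\<rho> \<noteq> \<sigma> i" "\<rho> \<noteq> \<sigma> (Suc i)" using \<rho>(3) b by auto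
    ultimately show ?thesis by (intro exI[of _ \<rho>]) auto
  qed
  then obtain \<tau> where \<tau>: "\<And>i. Suc i < l \<Longrightarrow> \<sigma> i < \<tau> i \<and> \<tau> i < \<sigma> (Suc i) \<and> \<psi> (\<tau> i) = \<psi> 1"
    by metis
  have between: "\<exists>i<l. \<sigma> i < \<rho> \<and> \<rho> < \<sigma> (Suc i) \<and> (Suc i < l \<and> \<rho> = \<tau> i)" if "\<rho> \<in> Z" for \<rho>
  proof -
    have \<rho>: "0 < \<rho>" "\<rho> < 1" "\<psi> \<rho> = \<psi> 1" using that by (auto simp: Z_def)
    have "\<exists>i<n. \<sigma> i \<le> \<rho> \<and> \<rho> < \<sigma> (Suc i)" if "\<rho> < \<sigma> n" for n
      using that
    proof (induction n)
      case 0 then show ?case using \<rho> \<sigma>(1) by simp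
    next
      case (Suc n) then show ?case by (cases "\<rho> < \<sigma> n") (auto intro: less_SucI)
    qed
    from this[of l] obtain i where i: "i < l" "\<sigma> i \<le> \<rho>" "\<rho> < \<sigma> (Suc i)" using \<rho> \<sigma>(2) by auto
    have "\<rho> \<noteq> \<sigma> i" using big[OF i(1)] \<rho> by auto
    then have lt: "\<sigma> i < \<rho>" using i by simp
    have "Suc i < l"
    proof (rule ccontr)
      \<comment> \<open>The last interval ends at 1, where \<psi> 1 is already taken.\<close>
      assume "\<not> Suc i < l"
      then have "Suc i = l" using i by simp
      then show False using inj_onD[OF inj[of i], of \<rho> 1] i \<rho> \<sigma>(2) by auto
    qed
    moreover from this have "\<rho> = \<tau> i"
      using inj_onD[OF inj[of i], of \<rho> "\<tau> i"] \<tau>[of i] i \<rho> by auto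
    ultimately show ?thesis using i lt by blast
  qed
  then show "wronskian \<rho> \<noteq> 0" if "\<rho> \<in> Z" for \<rho> using nz that by blast
  have "Z = \<tau> ` {..<l - 1}"
  proof (intro equalityI subsetI)
    fix \<rho> assume "\<rho> \<in> Z"
    then show "\<rho> \<in> \<tau> ` {..<l - 1}" using between by fastforce
  next
    fix \<rho> assume "\<rho> \<in> \<tau> ` {..<l - 1}"
    then obtain i where "i < l - 1" "\<rho> = \<tau> i" by auto
    then have i: "Suc i < l" "\<rho> = \<tau> i" by auto
    have "\<sigma> (Suc i) \<le> \<sigma> l" using i by (simp add: less_eq)
    then show "\<rho> \<in> Z" using \<tau>[OF i(1)] nonneg[of i] \<sigma>(2) by (auto simp: Z_def i(2))
  qed
  moreover have "inj_on \<tau> {..<l - 1}"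
  proof -
    have *: "\<tau> i < \<tau> j" if "i < j" "Suc j < l" for i j
    proof -
      have "\<tau> i < \<sigma> (Suc i)" using \<tau> that by simp
      also have "\<dots> \<le> \<sigma> j" using that by (simp add: less_eq)
      also have "\<dots> < \<tau> j" using \<tau> that by simp
      finally show ?thesis .
    qed
    show ?thesis
      by (rule linorder_inj_onI) (use * in force)+
  qed
  ultimately show "finite Z" "card Z = l - 1" by (simp_all add: card_image)
qed

end

section \<open>Eigenfunctions\<close>

text \<open>Gradients are carried as explicit functions, so that second derivatives can be formed by
  applying the rules again; \<open>partial\<close> is recovered from them afterwards.\<close>

definition has_gradient_on ::
    "(real^2) set \<Rightarrow> (real^2 \<Rightarrow> real) \<Rightarrow> (real^2 \<Rightarrow> real) \<Rightarrow> (real^2 \<Rightarrow> real) \<Rightarrow> bool" where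
  "has_gradient_on S f g1 g2 \<longleftrightarrow> (\<forall>x\<in>S. (f has_derivative (\<lambda>h. g1 x * h$1 + g2 x * h$2)) (at x))"

lemma Basis_real2: "Basis = {axis 1 1, axis 2 1 :: real^2}"
  by (auto simp: Basis_vec_def UNIV_2)

lemma axis_1_neq_axis_2: "axis 1 1 \<noteq> (axis 2 1 :: real^2)"
  by (simp add: axis_eq_axis)

lemma has_gradient_on_partial:
  assumes "has_gradient_on S f g1 g2" "x \<in> S"
  shows "f differentiable (at x)" "partial (axis 1 1) f x = g1 x" "partial (axis 2 1) f x = g2 x"
proof -
  have d: "(f has_derivative (\<lambda>h. g1 x * h$1 + g2 x * h$2)) (at x)"
    using assms by (auto simp: has_gradient_on_def)
  then show "f differentiable (at x)" by (auto simp: differentiable_def)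
  show "partial (axis 1 1) f x = g1 x" "partial (axis 2 1) f x = g2 x"
    unfolding partial_def frechet_derivative_at[OF d, symmetric] by (simp_all add: axis_def)
qed

lemma has_gradient_on_cong:
  assumes "has_gradient_on S f g1 g2" "open S" "\<And>x. x \<in> S \<Longrightarrow> f' x = f x"
  shows "has_gradient_on S f' g1 g2"
  unfolding has_gradient_on_def
proof
  fix x assume "x \<in> S"
  then show "(f' has_derivative (\<lambda>h. g1 x * h$1 + g2 x * h$2)) (at x)"
    using assms has_derivative_transform_within_open[of f _ x UNIV S f'] by (auto simp: has_gradient_on_def)
qed

text \<open>The first partial derivatives are known to equal g1 and g2 only on S; openness of S is
  what allows them to be differentiated in turn.\<close>

lemma laplacian_eq:
  assumes "open S" "x \<in> S" and f: "has_gradient_on S f g1 g2"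
    and g: "has_gradient_on S g1 g11 g12" "has_gradient_on S g2 g21 g22"
  shows "laplacian f x = g11 x + g22 x"
proof -
  have "has_gradient_on S (partial (axis 1 1) f) g11 g12"
    using has_gradient_on_partial(2)[OF f] by (intro has_gradient_on_cong[OF g(1) \<open>open S\<close>]) auto
  moreover have "has_gradient_on S (partial (axis 2 1) f) g21 g22"
    using has_gradient_on_partial(3)[OF f] by (intro has_gradient_on_cong[OF g(2) \<open>open S\<close>]) auto
  ultimately show ?thesis
    unfolding laplacian_def Basis_real2
    using has_gradient_on_partial(2,3) \<open>x \<in> S\<close> axis_1_neq_axis_2 by simp
qed

lemma has_gradient_on_const: "has_gradient_on S (\<lambda>_. c) (\<lambda>_. 0) (\<lambda>_. 0)"
  by (simp add: has_gradient_on_def)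

lemma has_gradient_on_coord:
  "has_gradient_on S (\<lambda>x. x$1) (\<lambda>_. 1) (\<lambda>_. 0)" "has_gradient_on S (\<lambda>x. x$2) (\<lambda>_. 0) (\<lambda>_. 1)"
  by (auto simp: has_gradient_on_def intro!: bounded_linear_imp_has_derivative bounded_linear_vec_nth)

lemma has_gradient_on_add:
  assumes "has_gradient_on S f f1 f2" "has_gradient_on S g g1 g2"
  shows "has_gradient_on S (\<lambda>x. f x + g x) (\<lambda>x. f1 x + g1 x) (\<lambda>x. f2 x + g2 x)"
  unfolding has_gradient_on_def
proof
  fix x assume "x \<in> S"
  then have "((\<lambda>x. f x + g x) has_derivative
      (\<lambda>h. (f1 x * h$1 + f2 x * h$2) + (g1 x * h$1 + g2 x * h$2))) (at x)"
    using assms by (intro has_derivative_add) (auto simp: has_gradient_on_def)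
  then show "((\<lambda>x. f x + g x) has_derivative (\<lambda>h. (f1 x + g1 x) * h$1 + (f2 x + g2 x) * h$2)) (at x)"
    by (rule has_derivative_eq_rhs) (auto simp: algebra_simps)
qed

lemma has_gradient_on_mult:
  assumes "has_gradient_on S f f1 f2" "has_gradient_on S g g1 g2"
  shows "has_gradient_on S (\<lambda>x. f x * g x) (\<lambda>x. f1 x * g x + f x * g1 x) (\<lambda>x. f2 x * g x + f x * g2 x)"
  unfolding has_gradient_on_def
proof
  fix x assume "x \<in> S"
  then have "((\<lambda>x. f x * g x) has_derivative
      (\<lambda>h. f x * (g1 x * h$1 + g2 x * h$2) + (f1 x * h$1 + f2 x * h$2) * g x)) (at x)"
    using assms by (intro has_derivative_mult) (auto simp: has_gradient_on_def)
  then show "((\<lambda>x. f x * g x) has_derivative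
      (\<lambda>h. (f1 x * g x + f x * g1 x) * h$1 + (f2 x * g x + f x * g2 x) * h$2)) (at x)"
    by (rule has_derivative_eq_rhs) (auto simp: algebra_simps)
qed

lemma has_gradient_on_cmult:
  "has_gradient_on S f f1 f2 \<Longrightarrow> has_gradient_on S (\<lambda>x. c * f x) (\<lambda>x. c * f1 x) (\<lambda>x. c * f2 x)"
  using has_gradient_on_mult[OF has_gradient_on_const[of S c]] by simp

definition normsq :: "real^2 \<Rightarrow> real" where
  "normsq x = (x$1)\<^sup>2 + (x$2)\<^sup>2"

lemma normsq_eq: "normsq x = (norm x)\<^sup>2"
  unfolding normsq_def power2_norm_eq_inner by (simp add: inner_vec_def sum_2 power2_eq_square)

lemma has_gradient_on_clifford:
  "has_gradient_on S (\<lambda>x. clifford k (m * normsq x))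
     (\<lambda>x. x$1 * (- 2 * m * clifford (k + 1) (m * normsq x)))
     (\<lambda>x. x$2 * (- 2 * m * clifford (k + 1) (m * normsq x)))"
  unfolding has_gradient_on_def
proof
  fix x assume "x \<in> S"
  have "((\<lambda>x::real^2. m * normsq x) has_derivative (\<lambda>h. m * (2 * x$1 * h$1 + 2 * x$2 * h$2))) (at x)"
    unfolding normsq_def
    by (auto intro!: derivative_eq_intros bounded_linear_imp_has_derivative bounded_linear_vec_nth simp: algebra_simps)
  from has_derivative_compose[OF this clifford_has_derivative[OF DERIV_ident, unfolded has_field_derivative_def]]
  show "((\<lambda>x. clifford k (m * normsq x)) has_derivative
      (\<lambda>h. x$1 * (- 2 * m * clifford (k + 1) (m * normsq x)) * h$1 +
           x$2 * (- 2 * m * clifford (k + 1) (m * normsq x)) * h$2)) (at x)"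
    by (rule has_derivative_eq_rhs) (auto simp: algebra_simps)
qed

text \<open>Being closed under partial derivatives, the functions denoted by these terms are \<open>C\<^sup>n\<close> for
  every \<open>n\<close>.\<close>
datatype smooth_term =
    Const real
  | Coord1
  | Coord2
  | Add smooth_term smooth_term
  | Mult smooth_term smooth_term
  | Clifford nat real

primrec smooth_eval :: "smooth_term \<Rightarrow> real^2 \<Rightarrow> real" where
  "smooth_eval (Const c) = (\<lambda>x. c)"
| "smooth_eval Coord1 = (\<lambda>x. x$1)"
| "smooth_eval Coord2 = (\<lambda>x. x$2)"
| "smooth_eval (Add s t) = (\<lambda>x. smooth_eval s x + smooth_eval t x)"
| "smooth_eval (Mult s t) = (\<lambda>x. smooth_eval s x * smooth_eval t x)"
| "smooth_eval (Clifford k m) = (\<lambda>x. clifford k (m * normsq x))"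

definition smooth_fun :: "(real^2 \<Rightarrow> real) set" where
  "smooth_fun = range smooth_eval"

lemma smooth_fun_intros:
  "(\<lambda>x. c) \<in> smooth_fun"
  "(\<lambda>x. x$1) \<in> smooth_fun"
  "(\<lambda>x. x$2) \<in> smooth_fun"
  "f \<in> smooth_fun \<Longrightarrow> g \<in> smooth_fun \<Longrightarrow> (\<lambda>x. f x + g x) \<in> smooth_fun"
  "f \<in> smooth_fun \<Longrightarrow> g \<in> smooth_fun \<Longrightarrow> (\<lambda>x. f x * g x) \<in> smooth_fun"
  "(\<lambda>x. clifford k (m * normsq x)) \<in> smooth_fun"
proof -
  have eval: "smooth_eval t \<in> smooth_fun" for t by (simp add: smooth_fun_def)
  note evals = eval[of "Const c"] eval[of Coord1] eval[of Coord2] eval[of "Clifford k m"]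
  show "(\<lambda>x. c) \<in> smooth_fun" "(\<lambda>x. x$1) \<in> smooth_fun" "(\<lambda>x. x$2) \<in> smooth_fun"
    "(\<lambda>x. clifford k (m * normsq x)) \<in> smooth_fun"
    using evals unfolding smooth_eval.simps .
  assume "f \<in> smooth_fun" "g \<in> smooth_fun"
  then obtain s t where st: "f = smooth_eval s" "g = smooth_eval t"
    unfolding smooth_fun_def by blast
  show "(\<lambda>x. f x + g x) \<in> smooth_fun" using eval[of "Add s t"] unfolding st smooth_eval.simps .
  show "(\<lambda>x. f x * g x) \<in> smooth_fun" using eval[of "Mult s t"] unfolding st smooth_eval.simps .
qed

lemma smooth_eval_gradient:
  "\<exists>t1 t2. has_gradient_on UNIV (smooth_eval t) (smooth_eval t1) (smooth_eval t2)"
proof (induction t)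
  case (Const c)
  have "has_gradient_on UNIV (smooth_eval (Const c)) (smooth_eval (Const 0)) (smooth_eval (Const 0))"
    by (simp add: has_gradient_on_const)
  then show ?case by blast
next
  case Coord1
  have "has_gradient_on UNIV (smooth_eval Coord1) (smooth_eval (Const 1)) (smooth_eval (Const 0))"
    by (simp add: has_gradient_on_coord)
  then show ?case by blast
next
  case Coord2
  have "has_gradient_on UNIV (smooth_eval Coord2) (smooth_eval (Const 0)) (smooth_eval (Const 1))"
    by (simp add: has_gradient_on_coord)
  then show ?case by blast
next
  case (Add s t)
  then obtain s1 s2 t1 t2 where
    "has_gradient_on UNIV (smooth_eval s) (smooth_eval s1) (smooth_eval s2)"
    "has_gradient_on UNIV (smooth_eval t) (smooth_eval t1) (smooth_eval t2)" by blast
  from has_gradient_on_add[OF this]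
  have "has_gradient_on UNIV (smooth_eval (Add s t)) (smooth_eval (Add s1 t1)) (smooth_eval (Add s2 t2))"
    by simp
  then show ?case by blast
next
  case (Mult s t)
  then obtain s1 s2 t1 t2 where
    "has_gradient_on UNIV (smooth_eval s) (smooth_eval s1) (smooth_eval s2)"
    "has_gradient_on UNIV (smooth_eval t) (smooth_eval t1) (smooth_eval t2)" by blast
  from has_gradient_on_mult[OF this]
  have "has_gradient_on UNIV (smooth_eval (Mult s t))
      (smooth_eval (Add (Mult s1 t) (Mult s t1))) (smooth_eval (Add (Mult s2 t) (Mult s t2)))"
    by simp
  then show ?case by blast
next
  case (Clifford k m)
  let ?c = "Mult (Const (- 2 * m)) (Clifford (k + 1) m)"
  have "has_gradient_on UNIV (smooth_eval (Clifford k m))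
      (smooth_eval (Mult Coord1 ?c)) (smooth_eval (Mult Coord2 ?c))"
    using has_gradient_on_clifford[of UNIV k m] by simp
  then show ?case by blast
qed

lemma smooth_fun_gradient:
  assumes "f \<in> smooth_fun"
  shows "\<exists>g1\<in>smooth_fun. \<exists>g2\<in>smooth_fun. has_gradient_on UNIV f g1 g2"
proof -
  obtain t where "f = smooth_eval t" using assms by (auto simp: smooth_fun_def)
  then show ?thesis using smooth_eval_gradient[of t] by (auto simp: smooth_fun_def)
qed

lemma smooth_fun_continuous: "f \<in> smooth_fun \<Longrightarrow> continuous_on S f"
  using smooth_fun_gradient has_gradient_on_partial(1)[of UNIV f]
  by (metis UNIV_I continuous_at_imp_continuous_on differentiable_imp_continuous_within)

lemma smooth_fun_Cn_on: "f \<in> smooth_fun \<Longrightarrow> Cn_on n S f"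
proof (induction n arbitrary: f)
  case 0
  then show ?case by (simp add: smooth_fun_continuous)
next
  case (Suc n)
  obtain g1 g2 where g: "g1 \<in> smooth_fun" "g2 \<in> smooth_fun" "has_gradient_on UNIV f g1 g2"
    using smooth_fun_gradient[OF Suc.prems] by blast
  then have "partial (axis 1 1) f = g1" "partial (axis 2 1) f = g2"
    using has_gradient_on_partial(2,3)[OF g(3)] by auto
  then show ?case
    using Suc.IH g has_gradient_on_partial(1)[OF g(3)] by (auto simp: Basis_real2)
qed

lemma smooth_fun_C1_closed_on:
  assumes "f \<in> smooth_fun"
  shows "C1_closed_on S f"
proof -
  obtain g1 g2 where g: "g1 \<in> smooth_fun" "g2 \<in> smooth_fun" "has_gradient_on UNIV f g1 g2"
    using smooth_fun_gradient[OF assms] by blast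
  define G :: "real^2 \<Rightarrow> real^2" where "G x = (\<chi> i. if i = 1 then g1 x else g2 x)" for x
  have "continuous_on S (\<lambda>x. if i = 1 then g1 x else g2 x)" for i :: 2
    by (cases "i = 1") (simp_all add: smooth_fun_continuous g)
  then have "continuous_on S G" unfolding G_def by (intro continuous_on_vec_lambda)
  moreover have "(\<lambda>h. G x \<bullet> h) = (\<lambda>h. g1 x * h$1 + g2 x * h$2)" for x
    by (auto simp: G_def inner_vec_def sum_2)
  moreover have "(f has_derivative (\<lambda>h. g1 x * h$1 + g2 x * h$2)) (at x within S)" for x
    using g(3) by (auto simp: has_gradient_on_def intro: has_derivative_at_withinI)
  ultimately show ?thesis unfolding C1_closed_on_def by (intro exI[of _ G]) auto
qed

section \<open>Harmonic polynomials and separated Helmholtz solutions\<close>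

definition zpow :: "nat \<Rightarrow> real^2 \<Rightarrow> complex" where
  "zpow k x = Complex (x$1) (x$2) ^ k"

lemma Re_zpow_Suc: "Re (zpow (Suc k) x) = x$1 * Re (zpow k x) - x$2 * Im (zpow k x)"
  and Im_zpow_Suc: "Im (zpow (Suc k) x) = x$1 * Im (zpow k x) + x$2 * Re (zpow k x)"
  by (simp_all add: zpow_def)

text \<open>The homogeneous harmonic polynomial r^k (c1 cos k\<theta> + c2 sin k\<theta>).
  Multiplying z^k by i replaces (c1, c2) by (c2, -c1), the pattern in the recursion and in the
  second partial derivative.\<close>

definition harmonic :: "real \<Rightarrow> real \<Rightarrow> nat \<Rightarrow> real^2 \<Rightarrow> real" where
  "harmonic c1 c2 k x = c1 * Re (zpow k x) + c2 * Im (zpow k x)"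

lemma harmonic_Suc:
  "harmonic c1 c2 (Suc k) x = x$1 * harmonic c1 c2 k x + x$2 * harmonic c2 (- c1) k x"
  by (simp add: harmonic_def Re_zpow_Suc Im_zpow_Suc algebra_simps)

lemma harmonic_uminus: "harmonic (- c1) (- c2) k x = - harmonic c1 c2 k x"
  by (simp add: harmonic_def)

text \<open>Euler's relation for a homogeneous polynomial of degree k, in the shape of the gradient
  computed below.\<close>

lemma harmonic_euler:
  "x$1 * (k * harmonic c1 c2 (k - 1) x) + x$2 * (k * harmonic c2 (- c1) (k - 1) x) = k * harmonic c1 c2 k x"
  by (cases k) (auto simp: harmonic_Suc algebra_simps)

lemma harmonic_scaleR: "harmonic c1 c2 k (r *\<^sub>R x) = r ^ k * harmonic c1 c2 k x"
proof (induction k arbitrary: c1 c2)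
  case (Suc k)
  then show ?case by (simp add: harmonic_Suc algebra_simps)
qed (simp add: harmonic_def zpow_def)

lemma harmonic_polar:
  "harmonic c1 c2 k (vector [r * cos \<theta>, r * sin \<theta>]) = r ^ k * angular k c1 c2 \<theta>"
proof (induction k arbitrary: c1 c2)
  case (Suc k)
  then show ?case by (simp add: harmonic_Suc angular_def distrib_right cos_add sin_add algebra_simps)
qed (simp add: harmonic_def zpow_def angular_def)

lemma smooth_fun_harmonic: "harmonic c1 c2 k \<in> smooth_fun"
proof (induction k arbitrary: c1 c2)
  case 0
  then show ?case by (simp add: harmonic_def[abs_def] zpow_def smooth_fun_intros)
next
  case (Suc k)
  have "harmonic c1 c2 (Suc k) = (\<lambda>x. x$1 * harmonic c1 c2 k x + x$2 * harmonic c2 (- c1) k x)"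
    by (rule ext) (rule harmonic_Suc)
  then show ?case using Suc by (auto intro!: smooth_fun_intros)
qed

lemma has_gradient_on_harmonic:
  "has_gradient_on S (harmonic c1 c2 k)
     (\<lambda>x. k * harmonic c1 c2 (k - 1) x) (\<lambda>x. k * harmonic c2 (- c1) (k - 1) x)"
proof (induction k arbitrary: c1 c2)
  case 0
  have "harmonic c1 c2 0 = (\<lambda>_. c1)" by (auto simp: harmonic_def zpow_def)
  then show ?case using has_gradient_on_const[of S c1] by simp
next
  case (Suc k)
  have *: "harmonic c1 c2 (Suc k) = (\<lambda>x. x$1 * harmonic c1 c2 k x + x$2 * harmonic c2 (- c1) k x)"
    by (rule ext) (rule harmonic_Suc)
  \<comment> \<open>Left unsimplified, exactly as the product rule delivers it, so that it can be
    used for rewriting.\<close>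
  have e: "1 * harmonic c1 c2 k x + x$1 * (k * harmonic c1 c2 (k - 1) x) +
      (0 * harmonic c2 (- c1) k x + x$2 * (k * harmonic c2 (- c1) (k - 1) x)) =
      Suc k * harmonic c1 c2 (Suc k - 1) x" for x c1 c2
    using harmonic_euler[of x k c1 c2] by (simp add: algebra_simps)
  have e2: "0 * harmonic c1 c2 k x + x$1 * (k * harmonic c2 (- c1) (k - 1) x) +
      (1 * harmonic c2 (- c1) k x + x$2 * (k * harmonic (- c1) (- c2) (k - 1) x)) =
      Suc k * harmonic c2 (- c1) (Suc k - 1) x" for x
    using harmonic_euler[of x k c2 "- c1"] by (simp add: algebra_simps)
  show ?case
    using has_gradient_on_add[OF has_gradient_on_mult[OF has_gradient_on_coord(1) Suc.IH[of c1 c2]]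
      has_gradient_on_mult[OF has_gradient_on_coord(2) Suc.IH[of c2 "- c1"]]]
    unfolding * e e2 .
qed

text \<open>The regular separated solution of \<Delta> w = -4 m w; m = X gives the J part and m = -Y
  the I part.\<close>

definition wave :: "nat \<Rightarrow> real \<Rightarrow> real \<Rightarrow> real \<Rightarrow> real^2 \<Rightarrow> real" where
  "wave k c1 c2 m x = harmonic c1 c2 k x * clifford k (m * normsq x)"

lemma smooth_fun_wave: "wave k c1 c2 m \<in> smooth_fun"
  unfolding wave_def[abs_def] by (intro smooth_fun_intros smooth_fun_harmonic)

text \<open>The formula g \<Delta>h + 2 \<nabla>h . \<nabla>g + h \<Delta>g for radial g. With
  gradient x p, and x q as the gradient of p, one has \<Delta>g = 2 p + |x|^2 q.\<close>

lemma product_gradients: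
  assumes h: "has_gradient_on S h a b" "has_gradient_on S a a1 a2" "has_gradient_on S b b1 b2"
    and g: "has_gradient_on S g (\<lambda>x. x$1 * p x) (\<lambda>x. x$2 * p x)"
    and p: "has_gradient_on S p (\<lambda>x. x$1 * q x) (\<lambda>x. x$2 * q x)"
  obtains g1 g2 g11 g12 g21 g22 where
    "has_gradient_on S (\<lambda>x. h x * g x) g1 g2"
    "has_gradient_on S g1 g11 g12" "has_gradient_on S g2 g21 g22"
    "\<And>x. g11 x + g22 x = (a1 x + b2 x) * g x + 2 * p x * (x$1 * a x + x$2 * b x) +
       h x * (2 * p x + normsq x * q x)"
proof (rule that[OF has_gradient_on_mult[OF h(1) g]])
  note coord = has_gradient_on_coord[of S]
  show "has_gradient_on S (\<lambda>x. a x * g x + h x * (x$1 * p x))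
      (\<lambda>x. (a1 x * g x + a x * (x$1 * p x)) + (a x * (x$1 * p x) + h x * (1 * p x + x$1 * (x$1 * q x))))
      (\<lambda>x. (a2 x * g x + a x * (x$2 * p x)) + (b x * (x$1 * p x) + h x * (0 * p x + x$1 * (x$2 * q x))))"
    by (rule has_gradient_on_add[OF has_gradient_on_mult[OF h(2) g]
          has_gradient_on_mult[OF h(1) has_gradient_on_mult[OF coord(1) p]]])
  show "has_gradient_on S (\<lambda>x. b x * g x + h x * (x$2 * p x))
      (\<lambda>x. (b1 x * g x + b x * (x$1 * p x)) + (a x * (x$2 * p x) + h x * (0 * p x + x$2 * (x$1 * q x))))
      (\<lambda>x. (b2 x * g x + b x * (x$2 * p x)) + (b x * (x$2 * p x) + h x * (1 * p x + x$2 * (x$2 * q x))))"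
    by (rule has_gradient_on_add[OF has_gradient_on_mult[OF h(3) g]
          has_gradient_on_mult[OF h(1) has_gradient_on_mult[OF coord(2) p]]])
qed (simp add: normsq_def power2_eq_square algebra_simps)

text \<open>The harmonic factor contributes no Laplacian, and Euler's relation turns the mixed term
  into 2 k p h. The rest is h (2 (k+1) p + |x|^2 q), which the recurrence of \<open>clifford\<close>
  reduces to -4 m h g.\<close>

lemma wave_gradients:
  obtains g1 g2 g11 g12 g21 g22 where
    "has_gradient_on UNIV (wave k c1 c2 m) g1 g2"
    "has_gradient_on UNIV g1 g11 g12" "has_gradient_on UNIV g2 g21 g22"
    "\<And>x. g11 x + g22 x = - 4 * m * wave k c1 c2 m x"
proof -
  define h a b where "h = harmonic c1 c2 k"
    and "a = (\<lambda>x. k * harmonic c1 c2 (k - 1) x)" and "b = (\<lambda>x. k * harmonic c2 (- c1) (k - 1) x)"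
  define a1 b2 where "a1 = (\<lambda>x. k * (real (k - 1) * harmonic c1 c2 (k - 1 - 1) x))"
    and "b2 = (\<lambda>x. k * (real (k - 1) * harmonic (- c1) (- c2) (k - 1 - 1) x))"
  define g p q where "g = (\<lambda>x. clifford k (m * normsq x))"
    and "p = (\<lambda>x. - 2 * m * clifford (k + 1) (m * normsq x))"
    and "q = (\<lambda>x. 4 * m\<^sup>2 * clifford (k + 2) (m * normsq x))"
  have w: "wave k c1 c2 m = (\<lambda>x. h x * g x)" by (auto simp: wave_def h_def g_def)
  have h: "has_gradient_on UNIV h a b"
    unfolding h_def a_def b_def by (rule has_gradient_on_harmonic)
  obtain a2 where a: "has_gradient_on UNIV a a1 a2"
    unfolding a_def a1_def using has_gradient_on_cmult[OF has_gradient_on_harmonic] by blast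
  obtain b1 where b: "has_gradient_on UNIV b b1 b2"
    unfolding b_def b2_def using has_gradient_on_cmult[OF has_gradient_on_harmonic] by blast
  have g: "has_gradient_on UNIV g (\<lambda>x. x$1 * p x) (\<lambda>x. x$2 * p x)"
    unfolding g_def p_def by (rule has_gradient_on_clifford)
  have "has_gradient_on UNIV p (\<lambda>x. - 2 * m * (x$1 * (- 2 * m * clifford (k + 1 + 1) (m * normsq x))))
      (\<lambda>x. - 2 * m * (x$2 * (- 2 * m * clifford (k + 1 + 1) (m * normsq x))))"
    unfolding p_def by (rule has_gradient_on_cmult[OF has_gradient_on_clifford])
  then have p: "has_gradient_on UNIV p (\<lambda>x. x$1 * q x) (\<lambda>x. x$2 * q x)"
    by (simp add: q_def power2_eq_square mult_ac)
  have lap: "(a1 x + b2 x) * g x + 2 * p x * (x$1 * a x + x$2 * b x) +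
       h x * (2 * p x + normsq x * q x) = - 4 * m * wave k c1 c2 m x" for x
  proof -
    have "a1 x + b2 x = 0" by (simp add: a1_def b2_def harmonic_uminus)
    moreover have "x$1 * a x + x$2 * b x = k * h x"
      unfolding a_def b_def h_def by (rule harmonic_euler)
    ultimately have "(a1 x + b2 x) * g x + 2 * p x * (x$1 * a x + x$2 * b x) +
        h x * (2 * p x + normsq x * q x) =
      - 4 * m * (h x * ((real k + 1) * clifford (k + 1) (m * normsq x) -
        m * normsq x * clifford (k + 2) (m * normsq x)))"
      by (simp add: p_def q_def power2_eq_square algebra_simps)
    also have "(real k + 1) * clifford (k + 1) (m * normsq x) -
        m * normsq x * clifford (k + 2) (m * normsq x) = g x"
      unfolding g_def by (rule clifford_recurrence[symmetric])
    finally show ?thesis unfolding w .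
  qed
  show ?thesis
  proof (rule product_gradients[OF h a b g p])
    fix g1 g2 g11 g12 g21 g22
    assume "has_gradient_on UNIV (\<lambda>x. h x * g x) g1 g2"
      "has_gradient_on UNIV g1 g11 g12" "has_gradient_on UNIV g2 g21 g22"
      and "\<And>x. g11 x + g22 x = (a1 x + b2 x) * g x + 2 * p x * (x$1 * a x + x$2 * b x) +
       h x * (2 * p x + normsq x * q x)"
    then show ?thesis by (intro that[of g1 g2 g11 g12 g21 g22]) (simp_all only: w lap)
  qed
qed

text \<open>An equality of functions whose right side again has the shape of the left, so that the
  bilaplacian is obtained by a second application.\<close>

lemma laplacian_wave_combination:
  "laplacian (\<lambda>x. A * wave k c1 c2 m x + B * wave k c1 c2 n x) =
    (\<lambda>x. (- 4 * m * A) * wave k c1 c2 m x + (- 4 * n * B) * wave k c1 c2 n x)"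
proof
  fix x
  obtain f1 f2 f11 f12 f21 f22 where f:
    "has_gradient_on UNIV (wave k c1 c2 m) f1 f2"
    "has_gradient_on UNIV f1 f11 f12" "has_gradient_on UNIV f2 f21 f22"
    "\<And>x. f11 x + f22 x = - 4 * m * wave k c1 c2 m x"
    by (rule wave_gradients[of k c1 c2 m]) (rule that)
  obtain g1 g2 g11 g12 g21 g22 where g:
    "has_gradient_on UNIV (wave k c1 c2 n) g1 g2"
    "has_gradient_on UNIV g1 g11 g12" "has_gradient_on UNIV g2 g21 g22"
    "\<And>x. g11 x + g22 x = - 4 * n * wave k c1 c2 n x"
    by (rule wave_gradients[of k c1 c2 n]) (rule that)
  have "laplacian (\<lambda>x. A * wave k c1 c2 m x + B * wave k c1 c2 n x) x =
      (A * f11 x + B * g11 x) + (A * f22 x + B * g22 x)"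
    by (rule laplacian_eq[OF open_UNIV UNIV_I
          has_gradient_on_add[OF has_gradient_on_cmult[OF f(1)] has_gradient_on_cmult[OF g(1)]]
          has_gradient_on_add[OF has_gradient_on_cmult[OF f(2)] has_gradient_on_cmult[OF g(2)]]
          has_gradient_on_add[OF has_gradient_on_cmult[OF f(3)] has_gradient_on_cmult[OF g(3)]]])
  also have "\<dots> = A * (f11 x + f22 x) + B * (g11 x + g22 x)" by (simp add: algebra_simps)
  finally show "laplacian (\<lambda>x. A * wave k c1 c2 m x + B * wave k c1 c2 n x) x =
      (- 4 * m * A) * wave k c1 c2 m x + (- 4 * n * B) * wave k c1 c2 n x"
    by (simp add: f(4) g(4))
qed

text \<open>The coefficients are chosen so that u vanishes on the circle; its radial derivative
  there is then a multiple of \<open>char_fun k X Y\<close>. The equation holds because -4 X and 4 Y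
  are the roots of t^2 + 4 (X - Y) t - 16 X Y.\<close>

lemma eigenfunction_is_solution:
  fixes k :: nat and X Y c1 c2 :: real
  assumes "char_fun k X Y = 0"
  defines "u \<equiv> (\<lambda>x. clifford k (- Y) * wave k c1 c2 X x + (- clifford k X) * wave k c1 c2 (- Y) x)"
  shows "is_solution (- 16 * X * Y) (4 * (X - Y)) u"
  unfolding is_solution_def
proof (intro conjI ballI)
  have "u \<in> smooth_fun" unfolding u_def
    by (intro smooth_fun_intros smooth_fun_wave)
  then show "Cn_on 4 (ball 0 1) u" "C1_closed_on (cball 0 1) u"
    by (simp_all add: smooth_fun_Cn_on smooth_fun_C1_closed_on)
  fix x :: "real^2"
  show "laplacian (laplacian u) x + - 16 * X * Y * u x = - (4 * (X - Y)) * laplacian u x"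
    unfolding u_def laplacian_wave_combination by (simp add: algebra_simps)
next
  fix x :: "real^2" assume "x \<in> sphere 0 1"
  then have nx: "normsq x = 1" by (simp add: normsq_eq)
  let ?h = "harmonic c1 c2 k x" and ?A = "clifford k (- Y)" and ?B = "- clifford k X"
  define N where "N r = ?A * clifford k (X * r\<^sup>2) + ?B * clifford k (- Y * r\<^sup>2)" for r
  have u: "u (r *\<^sub>R x) = r ^ k * ?h * N r" for r
  proof -
    have "normsq (r *\<^sub>R x) = r\<^sup>2" using nx by (simp add: normsq_eq power_mult_distrib)
    then show ?thesis
      by (simp add: u_def N_def wave_def harmonic_scaleR algebra_simps)
  qed
  have N1: "N 1 = 0" by (simp add: N_def)
  show "u x = 0" using u[of 1] N1 by simp
  have "(N has_real_derivative - 2 * char_fun k X Y) (at 1)"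
    unfolding N_def
    apply (rule derivative_eq_intros refl | simp)+
    by (simp add: char_fun_def algebra_simps)
  then have N': "(N has_real_derivative 0) (at 1)" using assms by simp
  have "((\<lambda>r. r ^ k * ?h) has_real_derivative k * ?h) (at 1)"
    by (rule derivative_eq_intros refl | simp)+
  from DERIV_mult[OF this N'] have "((\<lambda>r. r ^ k * ?h * N r) has_real_derivative 0) (at 1)"
    by (simp add: N1)
  then show "((\<lambda>r. u (r *\<^sub>R x)) has_real_derivative 0) (at_left 1)"
    unfolding u by (rule has_field_derivative_at_within)
qed

section \<open>Fourier modes of solutions\<close>

text \<open>With \<open>A = r\<^sup>k clifford k (m r\<^sup>2)\<close> and \<open>B = r A'\<close>, the Wronskian \<open>W = r (y A' - y' A)\<close> is
  constant and vanishes at 0, so that \<open>(y, r y')\<close> is a multiple of \<open>(A, B) \<noteq> (0, 0)\<close>.\<close>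
lemma bessel_ode_regular_solution:
  fixes y y1 y2 :: "real \<Rightarrow> real"
  assumes y: "\<And>r. \<bar>r\<bar> < 1 \<Longrightarrow> (y has_real_derivative y1 r) (at r)"
    and y1: "\<And>r. \<bar>r\<bar> < 1 \<Longrightarrow> (y1 has_real_derivative y2 r) (at r)"
    and ode: "\<And>r. 0 < r \<Longrightarrow> r < 1 \<Longrightarrow> r\<^sup>2 * y2 r + r * y1 r + (4 * m * r\<^sup>2 - (real k)\<^sup>2) * y r = 0"
    and "m \<noteq> 0"
  obtains c where "\<And>r. 0 < r \<Longrightarrow> r < 1 \<Longrightarrow> y r = c * (r ^ k * clifford k (m * r\<^sup>2))"
proof -
  define A where "A r = r ^ k * clifford k (m * r\<^sup>2)" for r
  define B where "B r = r ^ k * (k * clifford k (m * r\<^sup>2) - 2 * m * r\<^sup>2 * clifford (k + 1) (m * r\<^sup>2))" for r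
  define \<mu> where "\<mu> r = (real k)\<^sup>2 - 4 * m * r\<^sup>2" for r
  define b where "b r = r * y1 r" for r
  define W where "W r = y r * B r - b r * A r" for r
  have dk: "((\<lambda>r. r ^ k) has_real_derivative k * r ^ k / r) (at r)" if "r \<noteq> 0" for r :: real
    using that by (intro DERIV_cong[OF DERIV_pow]) (cases k; simp)
  have dC: "((\<lambda>r. clifford j (m * r\<^sup>2)) has_real_derivative - clifford (j + 1) (m * r\<^sup>2) * (2 * m * r)) (at r)"
    for j r
    by (rule clifford_has_derivative) (auto intro!: derivative_eq_intros)
  have dA: "(A has_real_derivative B r / r) (at r)" if "r \<noteq> 0" for r
  proof (rule DERIV_cong)
    show "(A has_real_derivative k * r ^ k / r * clifford k (m * r\<^sup>2) +
        - clifford (k + 1) (m * r\<^sup>2) * (2 * m * r) * r ^ k) (at r)"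
      unfolding A_def[abs_def] by (intro DERIV_mult dk[OF that] dC)
    show "k * r ^ k / r * clifford k (m * r\<^sup>2) + - clifford (k + 1) (m * r\<^sup>2) * (2 * m * r) * r ^ k = B r / r"
      using that by (simp add: B_def divide_simps power2_eq_square) (simp add: algebra_simps)
  qed
  have dB: "(B has_real_derivative \<mu> r * A r / r) (at r)" if "r \<noteq> 0" for r
  proof (rule DERIV_cong)
    let ?C = "clifford k (m * r\<^sup>2)" and ?C1 = "clifford (k + 1) (m * r\<^sup>2)" and ?C2 = "clifford (k + 2) (m * r\<^sup>2)"
    have C2: "m * r\<^sup>2 * ?C2 = (real k + 1) * ?C1 - ?C"
      using clifford_recurrence[of k "m * r\<^sup>2"] by simp
    have dm: "((\<lambda>r. 2 * m * r\<^sup>2) has_real_derivative 4 * m * r) (at r)"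
      by (auto intro!: derivative_eq_intros)
    have dC2: "((\<lambda>r. clifford (k + 1) (m * r\<^sup>2)) has_real_derivative - ?C2 * (2 * m * r)) (at r)"
      using dC[of "k + 1" r] by simp
    show "(B has_real_derivative k * r ^ k / r * (k * ?C - 2 * m * r\<^sup>2 * ?C1) +
        (k * (- ?C1 * (2 * m * r)) - (4 * m * r * ?C1 + - ?C2 * (2 * m * r) * (2 * m * r\<^sup>2))) * r ^ k) (at r)"
      unfolding B_def[abs_def] by (intro DERIV_mult DERIV_diff DERIV_cmult dk[OF that] dC dm dC2)
    have "- ?C2 * (2 * m * r) * (2 * m * r\<^sup>2) = - (4 * m * r) * (m * r\<^sup>2 * ?C2)"
      by (simp add: algebra_simps)
    also have "\<dots> = - (4 * m * r) * ((real k + 1) * ?C1 - ?C)" unfolding C2 ..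
    finally have e: "- ?C2 * (2 * m * r) * (2 * m * r\<^sup>2) = - (4 * m * r) * ((real k + 1) * ?C1 - ?C)" .
    show "k * r ^ k / r * (k * ?C - 2 * m * r\<^sup>2 * ?C1) +
        (k * (- ?C1 * (2 * m * r)) - (4 * m * r * ?C1 + - ?C2 * (2 * m * r) * (2 * m * r\<^sup>2))) * r ^ k =
        \<mu> r * A r / r"
      unfolding e using that
      by (simp add: \<mu>_def A_def divide_simps power2_eq_square) (simp add: algebra_simps)
  qed
  have db: "(b has_real_derivative \<mu> r * y r / r) (at r)" if "0 < r" "r < 1" for r
  proof -
    have "(b has_real_derivative 1 * y1 r + y2 r * r) (at r)"
      unfolding b_def[abs_def] using that by (intro DERIV_mult DERIV_ident y1) auto
    moreover have "1 * y1 r + y2 r * r = \<mu> r * y r / r"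
      using ode[OF that] that by (simp add: \<mu>_def field_simps power2_eq_square)
    ultimately show ?thesis by simp
  qed
  have dy: "(y has_real_derivative b r / r) (at r)" if "0 < r" "r < 1" for r
    using y[of r] that by (simp add: b_def)
  have W: "W r = 0" if r: "0 < r" "r < 1" for r
  proof -
    have "W r = W 0"
    proof (rule DERIV_isconst_end[OF r(1)])
      have "isCont A t" "isCont B t" for t unfolding A_def[abs_def] B_def[abs_def] by (intro continuous_intros)+
      moreover have "isCont y t" "isCont b t" if "\<bar>t\<bar> < 1" for t
        unfolding b_def[abs_def] by (intro continuous_intros DERIV_isCont[OF y[OF that]] DERIV_isCont[OF y1[OF that]])+
      ultimately show "continuous_on {0..r} W"
        unfolding W_def[abs_def] using r by (intro continuous_at_imp_continuous_on ballI continuous_intros) auto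
      fix t assume t: "0 < t" "t < r"
      then have "(W has_real_derivative
          (b t / t * B t + \<mu> t * A t / t * y t) - (\<mu> t * y t / t * A t + B t / t * b t)) (at t)"
        unfolding W_def[abs_def] using r by (intro DERIV_diff DERIV_mult dy dB db dA) auto
      then show "(W has_real_derivative 0) (at t)" by (simp add: algebra_simps)
    qed
    \<comment> \<open>Regularity at the centre enters here: r y'(r) and B vanish at 0, which
      excludes the second, singular solution.\<close>
    also have "W 0 = 0" by (cases k) (auto simp: W_def b_def B_def)
    finally show ?thesis .
  qed
  have AB: "(A r)\<^sup>2 + (B r)\<^sup>2 > 0" if "0 < r" for r
  proof (rule ccontr)
    assume "\<not> ?thesis"
    then have "A r = 0" "B r = 0" by (auto simp: not_less sum_power2_le_zero_iff)
    then have "clifford k (m * r\<^sup>2) = 0" "clifford (k + 1) (m * r\<^sup>2) = 0"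
      using that \<open>m \<noteq> 0\<close> by (auto simp: A_def B_def)
    then show False using clifford_zero_simple by blast
  qed
  \<comment> \<open>The quotient y / A would break down at zeros of A. Projecting (y, b) onto (A, B)
    gives the same factor with a denominator that never vanishes.\<close>
  define c where "c r = (y r * A r + b r * B r) / ((A r)\<^sup>2 + (B r)\<^sup>2)" for r
  have c: "y r = c r * A r" if "0 < r" "r < 1" for r
  proof -
    have "y r * B r = b r * A r" using W[OF that] by (simp add: W_def)
    then have "y r * ((A r)\<^sup>2 + (B r)\<^sup>2) = (y r * A r + b r * B r) * A r" by algebra
    then have "y r = (y r * A r + b r * B r) * A r / ((A r)\<^sup>2 + (B r)\<^sup>2)"
      using AB[OF that(1)] by (subst nonzero_eq_divide_eq) auto
    then show ?thesis by (simp add: c_def)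
  qed
  have dc: "(c has_real_derivative 0) (at r)" if r: "0 < r" "r < 1" for r
  proof -
    define N M where "N r = y r * A r + b r * B r" and "M r = (A r)\<^sup>2 + (B r)\<^sup>2" for r
    have c_eq: "c = (\<lambda>r. N r / M r)" by (auto simp: c_def N_def M_def)
    have eq: "b r * A r = y r * B r" using W[OF r] by (simp add: W_def)
    have "(N has_real_derivative (b r / r * A r + B r / r * y r) + (\<mu> r * y r / r * B r + \<mu> r * A r / r * b r)) (at r)"
      unfolding N_def[abs_def] using r by (intro DERIV_add DERIV_mult dy dA db dB) auto
    then have dN: "(N has_real_derivative 2 * (1 + \<mu> r) * (y r * B r) / r) (at r)"
    proof (rule DERIV_cong)
      have "b r / r * A r + B r / r * y r + (\<mu> r * y r / r * B r + \<mu> r * A r / r * b r) =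
          ((b r * A r + y r * B r) + \<mu> r * (y r * B r + b r * A r)) / r"
        by (simp add: add_divide_distrib algebra_simps)
      also have "\<dots> = 2 * (1 + \<mu> r) * (y r * B r) / r" unfolding eq by (simp add: algebra_simps)
      finally show "b r / r * A r + B r / r * y r + (\<mu> r * y r / r * B r + \<mu> r * A r / r * b r) =
          2 * (1 + \<mu> r) * (y r * B r) / r" .
    qed
    have dM: "(M has_real_derivative 2 * (1 + \<mu> r) * (A r * B r) / r) (at r)"
    proof -
      have "((\<lambda>r. A r * A r + B r * B r) has_real_derivative
          (B r / r * A r + B r / r * A r) + (\<mu> r * A r / r * B r + \<mu> r * A r / r * B r)) (at r)"
        using r by (intro DERIV_add DERIV_mult dA dB) auto
      moreover have "(B r / r * A r + B r / r * A r) + (\<mu> r * A r / r * B r + \<mu> r * A r / r * B r) =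
          2 * (1 + \<mu> r) * (A r * B r) / r"
        by (simp add: add_divide_distrib algebra_simps)
      ultimately show ?thesis by (simp add: M_def[abs_def] power2_eq_square)
    qed
    have M: "M r \<noteq> 0" using AB[OF r(1)] unfolding M_def by (metis less_irrefl)
    have "(y r * B r) * M r = N r * (A r * B r)"
      using eq unfolding M_def N_def by algebra
    moreover have "2 * (1 + \<mu> r) * (y r * B r) / r * M r - N r * (2 * (1 + \<mu> r) * (A r * B r) / r) =
        2 * (1 + \<mu> r) / r * ((y r * B r) * M r - N r * (A r * B r))"
      by (simp add: algebra_simps)
    ultimately have z: "2 * (1 + \<mu> r) * (y r * B r) / r * M r - N r * (2 * (1 + \<mu> r) * (A r * B r) / r) = 0"
      by simp
    from DERIV_divide[OF dN dM M] show ?thesis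
      unfolding c_eq z div_0 .
  qed
  show ?thesis
  proof (rule that[of "c (1 / 2)"])
    fix r :: real assume r: "0 < r" "r < 1"
    then have "c r = c (1 / 2)"
      by (intro DERIV_isconst3[of 0 1 r "1/2" c] dc) auto
    then show "y r = c (1 / 2) * (r ^ k * clifford k (m * r\<^sup>2))"
      using c[OF r] unfolding A_def by metis
  qed
qed

text \<open>Written with \<open>axis\<close> instead of \<open>vector\<close>, so that the rules for
  scaling and addition give continuity and derivatives. Negative r is allowed, which makes Fourier
  coefficients differentiable on both sides of 0.\<close>

definition pol :: "real \<Rightarrow> real \<Rightarrow> real^2" where
  "pol r \<theta> = (r * cos \<theta>) *\<^sub>R axis 1 1 + (r * sin \<theta>) *\<^sub>R axis 2 1"

lemma pol_nth [simp]: "pol r \<theta> $ 1 = r * cos \<theta>" "pol r \<theta> $ 2 = r * sin \<theta>"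
  by (simp_all add: pol_def axis_def)

lemma norm_pol: "norm (pol r \<theta>) = \<bar>r\<bar>"
proof -
  have "(norm (pol r \<theta>))\<^sup>2 = r\<^sup>2 * ((cos \<theta>)\<^sup>2 + (sin \<theta>)\<^sup>2)"
    by (simp only: normsq_eq[symmetric] normsq_def pol_nth power_mult_distrib distrib_left)
  then have "(norm (pol r \<theta>))\<^sup>2 = \<bar>r\<bar>\<^sup>2" by simp
  then show ?thesis by (rule power2_eq_imp_eq) simp_all
qed

lemma scaleR_pol: "s *\<^sub>R pol r \<theta> = pol (s * r) \<theta>"
  by (simp add: pol_def scaleR_add_right mult.assoc)

lemma exists_pol:
  obtains \<theta> where "0 \<le> \<theta>" "\<theta> \<le> 2 * pi" "x = pol (norm x) \<theta>"
proof (cases "x = 0")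
  case True
  then show ?thesis using that[of 0] by (simp add: pol_def)
next
  case False
  then have "(x$1 / norm x)\<^sup>2 + (x$2 / norm x)\<^sup>2 = 1"
    using normsq_eq[of x] by (simp add: normsq_def power_divide add_divide_distrib[symmetric])
  then obtain \<theta> where \<theta>: "0 \<le> \<theta>" "\<theta> \<le> 2 * pi" "x$1 / norm x = cos \<theta>" "x$2 / norm x = sin \<theta>"
    using sincos_total_2pi_le[of "x$1 / norm x" "x$2 / norm x"] by metis
  have "x$1 = norm x * cos \<theta>" "x$2 = norm x * sin \<theta>"
    using False unfolding \<theta>(3,4)[symmetric] by simp_all
  then have "x = pol (norm x) \<theta>" by (simp add: vec_eq_iff forall_2)
  with \<theta>(1,2) show ?thesis by (rule that)
qed

lemma continuous_on_pol [continuous_intros]: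
  fixes f g :: "'a::t2_space \<Rightarrow> real"
  shows "continuous_on S f \<Longrightarrow> continuous_on S g \<Longrightarrow> continuous_on S (\<lambda>x. pol (f x) (g x))"
  unfolding pol_def by (intro continuous_intros)

lemma has_gradient_on_curve:
  assumes f: "has_gradient_on S f g1 g2" "p1 t *\<^sub>R axis 1 1 + p2 t *\<^sub>R axis 2 1 \<in> S"
    and p: "(p1 has_real_derivative d1) (at t)" "(p2 has_real_derivative d2) (at t)"
  defines "p \<equiv> (\<lambda>t. p1 t *\<^sub>R axis 1 1 + p2 t *\<^sub>R axis 2 1 :: real^2)"
  shows "((\<lambda>t. f (p t)) has_real_derivative g1 (p t) * d1 + g2 (p t) * d2) (at t)"
proof -
  have "(p has_derivative (\<lambda>h. (h * d1) *\<^sub>R axis 1 1 + (h * d2) *\<^sub>R axis 2 1)) (at t)"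
    unfolding p_def using p unfolding has_field_derivative_def
    by (auto intro!: derivative_eq_intros simp: mult.commute)
  moreover have "(f has_derivative (\<lambda>h. g1 (p t) * h$1 + g2 (p t) * h$2)) (at (p t))"
    using f by (auto simp: has_gradient_on_def p_def)
  ultimately have "((\<lambda>t. f (p t)) has_derivative
      (\<lambda>h. g1 (p t) * ((h * d1) *\<^sub>R axis 1 1 + (h * d2) *\<^sub>R axis 2 1 :: real^2)$1 +
           g2 (p t) * ((h * d1) *\<^sub>R axis 1 1 + (h * d2) *\<^sub>R axis 2 1 :: real^2)$2)) (at t)"
    by (rule has_derivative_compose)
  then show ?thesis
    unfolding has_field_derivative_def
    by (rule has_derivative_eq_rhs) (auto simp: axis_def algebra_simps)
qed

lemma has_gradient_on_pol:
  assumes "has_gradient_on S f g1 g2" "pol r \<theta> \<in> S"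
  shows "((\<lambda>r. f (pol r \<theta>)) has_real_derivative cos \<theta> * g1 (pol r \<theta>) + sin \<theta> * g2 (pol r \<theta>)) (at r)"
    and "((\<lambda>\<theta>. f (pol r \<theta>)) has_real_derivative
           r * cos \<theta> * g2 (pol r \<theta>) - r * sin \<theta> * g1 (pol r \<theta>)) (at \<theta>)"
proof -
  have "((\<lambda>r. r * cos \<theta>) has_real_derivative cos \<theta>) (at r)"
    "((\<lambda>r. r * sin \<theta>) has_real_derivative sin \<theta>) (at r)"
    "((\<lambda>\<theta>. r * cos \<theta>) has_real_derivative - r * sin \<theta>) (at \<theta>)"
    "((\<lambda>\<theta>. r * sin \<theta>) has_real_derivative r * cos \<theta>) (at \<theta>)"
    by (auto intro!: derivative_eq_intros)
  note d = this
  from has_gradient_on_curve[OF assms(1) assms(2)[unfolded pol_def] d(1,2)]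
  show "((\<lambda>r. f (pol r \<theta>)) has_real_derivative cos \<theta> * g1 (pol r \<theta>) + sin \<theta> * g2 (pol r \<theta>)) (at r)"
    by (simp add: pol_def[symmetric] mult.commute)
  from has_gradient_on_curve[OF assms(1) assms(2)[unfolded pol_def] d(3,4)]
  show "((\<lambda>\<theta>. f (pol r \<theta>)) has_real_derivative
           r * cos \<theta> * g2 (pol r \<theta>) - r * sin \<theta> * g1 (pol r \<theta>)) (at \<theta>)"
    by (simp add: pol_def[symmetric] mult_ac)
qed

lemma has_gradient_on_continuous:
  assumes "has_gradient_on S f g1 g2"
  shows "continuous_on S f"
  using has_gradient_on_partial(1)[OF assms]
  by (intro continuous_at_imp_continuous_on ballI differentiable_imp_continuous_within) auto

text \<open>The weight \<open>h\<close> is arbitrary because differentiation in r multiplies it by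
  cosines and sines.\<close>

definition fourier :: "(real \<Rightarrow> real) \<Rightarrow> (real^2 \<Rightarrow> real) \<Rightarrow> real \<Rightarrow> real" where
  "fourier h f r = integral {0..2 * pi} (\<lambda>\<theta>. f (pol r \<theta>) * h \<theta>)"

lemma continuous_on_fourier:
  fixes f :: "real^2 \<Rightarrow> real"
  assumes "continuous_on S f" "continuous_on {0..2 * pi} h" "\<And>\<theta>. pol r \<theta> \<in> S"
  shows "continuous_on {0..2 * pi} (\<lambda>\<theta>. f (pol r \<theta>) * h \<theta>)"
proof -
  have "continuous_on {0..2 * pi} (pol r)" by (intro continuous_intros)
  then have "continuous_on {0..2 * pi} (\<lambda>\<theta>. f (pol r \<theta>))"
    using assms(3) by (intro continuous_on_compose2[OF assms(1)]) auto
  then show ?thesis by (intro continuous_on_mult assms(2))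
qed

lemma fourier_has_integral:
  assumes "continuous_on S f" "continuous_on {0..2 * pi} h" "\<And>\<theta>. pol r \<theta> \<in> S"
  shows "((\<lambda>\<theta>. f (pol r \<theta>) * h \<theta>) has_integral fourier h f r) {0..2 * pi}"
  unfolding fourier_def
  by (intro integrable_integral integrable_continuous_real continuous_on_fourier[OF assms])

lemma fourier_DERIV:
  assumes f: "has_gradient_on (ball 0 1) f f1 f2" "continuous_on (ball 0 1) f1" "continuous_on (ball 0 1) f2"
    and h: "continuous_on {0..2 * pi} h" and r: "\<bar>r\<bar> < 1"
  shows "(fourier h f has_real_derivative
     fourier (\<lambda>\<theta>. cos \<theta> * h \<theta>) f1 r + fourier (\<lambda>\<theta>. sin \<theta> * h \<theta>) f2 r) (at r)"
proof -
  have b: "pol s \<theta> \<in> ball 0 1" if "\<bar>s\<bar> < 1" for s \<theta> using that by (simp add: norm_pol)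
  define U where "U = {-1<..<1::real}"
  have "((\<lambda>s. integral (cbox 0 (2 * pi)) (\<lambda>\<theta>. f (pol s \<theta>) * h \<theta>)) has_field_derivative
      integral (cbox 0 (2 * pi)) (\<lambda>\<theta>. (cos \<theta> * f1 (pol r \<theta>) + sin \<theta> * f2 (pol r \<theta>)) * h \<theta>)) (at r within U)"
  proof (rule leibniz_rule_field_derivative[where fx = "\<lambda>s \<theta>. (cos \<theta> * f1 (pol s \<theta>) + sin \<theta> * f2 (pol s \<theta>)) * h \<theta>"])
    fix s \<theta> assume "s \<in> U"
    then have s: "\<bar>s\<bar> < 1" by (auto simp: U_def)
    show "((\<lambda>s. f (pol s \<theta>) * h \<theta>) has_real_derivative
        (cos \<theta> * f1 (pol s \<theta>) + sin \<theta> * f2 (pol s \<theta>)) * h \<theta>) (at s within U)"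
      by (rule has_field_derivative_at_within)
        (intro DERIV_cmult_right has_gradient_on_pol(1)[OF f(1)] b s)
    show "(\<lambda>\<theta>. f (pol s \<theta>) * h \<theta>) integrable_on cbox 0 (2 * pi)"
      using continuous_on_fourier[OF has_gradient_on_continuous[OF f(1)] h b[OF s]]
      by (simp add: integrable_continuous_real)
  next
    have "continuous_on (U \<times> {0..2 * pi}) (\<lambda>x. (cos (snd x) * f1 (pol (fst x) (snd x)) +
        sin (snd x) * f2 (pol (fst x) (snd x))) * h (snd x))"
      by (intro continuous_intros continuous_on_compose2[OF f(2)] continuous_on_compose2[OF f(3)]
          continuous_on_compose2[OF h]) (auto simp: U_def intro!: b)
    then show "continuous_on (U \<times> cbox 0 (2 * pi))
        (\<lambda>(s, \<theta>). (cos \<theta> * f1 (pol s \<theta>) + sin \<theta> * f2 (pol s \<theta>)) * h \<theta>)"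
      by (simp add: case_prod_beta)
  qed (use r in \<open>auto simp: U_def\<close>)
  moreover have "at r within U = at r" using r by (intro at_within_open) (auto simp: U_def)
  moreover have "((\<lambda>\<theta>. (cos \<theta> * f1 (pol r \<theta>) + sin \<theta> * f2 (pol r \<theta>)) * h \<theta>) has_integral
      fourier (\<lambda>\<theta>. cos \<theta> * h \<theta>) f1 r + fourier (\<lambda>\<theta>. sin \<theta> * h \<theta>) f2 r) {0..2 * pi}"
    using has_integral_add[OF
        fourier_has_integral[OF f(2) _ b[OF r], of "\<lambda>\<theta>. cos \<theta> * h \<theta>"]
        fourier_has_integral[OF f(3) _ b[OF r], of "\<lambda>\<theta>. sin \<theta> * h \<theta>"]] h
    by (simp add: continuous_intros algebra_simps)
  ultimately show ?thesis
    unfolding fourier_def[abs_def] by (simp add: integral_unique)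
qed

definition fourier_mode :: "nat \<Rightarrow> (real \<Rightarrow> real) \<Rightarrow> (real \<Rightarrow> real) \<Rightarrow> bool" where
  "fourier_mode k h h' \<longleftrightarrow>
     (\<forall>\<theta>. (h has_real_derivative h' \<theta>) (at \<theta>)) \<and>
     (\<forall>\<theta>. (h' has_real_derivative - (real k)\<^sup>2 * h \<theta>) (at \<theta>)) \<and>
     h (2 * pi) = h 0 \<and> h' (2 * pi) = h' 0"

text \<open>The Bessel expression of the coefficient is an integral over the circle. Adding the
  integral of a \<theta>-derivative, which is 0 by periodicity, makes the integrand r^2 h (\<Delta>f
  + 4 m f), which is identically 0.\<close>

lemma fourier_ode:
  assumes f: "has_gradient_on (ball 0 1) f f1 f2"
    "has_gradient_on (ball 0 1) f1 f11 f12" "has_gradient_on (ball 0 1) f2 f21 f22"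
    and cont: "continuous_on (ball 0 1) f11" "continuous_on (ball 0 1) f12"
      "continuous_on (ball 0 1) f21" "continuous_on (ball 0 1) f22"
    and helmholtz: "\<And>x. x \<in> ball 0 1 \<Longrightarrow> f11 x + f22 x = - 4 * m * f x" and "m \<noteq> 0"
    and h: "fourier_mode k h h'"
  obtains c where "\<And>r. 0 < r \<Longrightarrow> r < 1 \<Longrightarrow> fourier h f r = c * (r ^ k * clifford k (m * r\<^sup>2))"
proof -
  have dh: "(h has_real_derivative h' \<theta>) (at \<theta>)" "(h' has_real_derivative - (real k)\<^sup>2 * h \<theta>) (at \<theta>)" for \<theta>
    using h by (auto simp: fourier_mode_def)
  have h_cont: "continuous_on {0..2 * pi} h"
    using dh by (intro continuous_at_imp_continuous_on) (auto intro: DERIV_isCont)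
  have b: "pol s \<theta> \<in> ball 0 1" if "\<bar>s\<bar> < 1" for s \<theta> using that by (simp add: norm_pol)
  note fc = has_gradient_on_continuous[OF f(1)]
  note f1c = has_gradient_on_continuous[OF f(2)] and f2c = has_gradient_on_continuous[OF f(3)]
  have hc: "continuous_on {0..2 * pi} (\<lambda>\<theta>. cos \<theta> * h \<theta>)" "continuous_on {0..2 * pi} (\<lambda>\<theta>. sin \<theta> * h \<theta>)"
    by (intro continuous_intros h_cont)+
  have hcc: "continuous_on {0..2 * pi} (\<lambda>\<theta>. cos \<theta> * (cos \<theta> * h \<theta>))"
    "continuous_on {0..2 * pi} (\<lambda>\<theta>. sin \<theta> * (cos \<theta> * h \<theta>))"
    "continuous_on {0..2 * pi} (\<lambda>\<theta>. cos \<theta> * (sin \<theta> * h \<theta>))"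
    "continuous_on {0..2 * pi} (\<lambda>\<theta>. sin \<theta> * (sin \<theta> * h \<theta>))"
    by (intro continuous_intros hc)+
  define y1 where "y1 r = fourier (\<lambda>\<theta>. cos \<theta> * h \<theta>) f1 r + fourier (\<lambda>\<theta>. sin \<theta> * h \<theta>) f2 r" for r
  define y2 where "y2 r =
     (fourier (\<lambda>\<theta>. cos \<theta> * (cos \<theta> * h \<theta>)) f11 r + fourier (\<lambda>\<theta>. sin \<theta> * (cos \<theta> * h \<theta>)) f12 r) +
     (fourier (\<lambda>\<theta>. cos \<theta> * (sin \<theta> * h \<theta>)) f21 r + fourier (\<lambda>\<theta>. sin \<theta> * (sin \<theta> * h \<theta>)) f22 r)" for r
  have dy: "(fourier h f has_real_derivative y1 r) (at r)" if "\<bar>r\<bar> < 1" for r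
    unfolding y1_def by (rule fourier_DERIV[OF f(1) f1c f2c h_cont that])
  have dy1: "(y1 has_real_derivative y2 r) (at r)" if "\<bar>r\<bar> < 1" for r
    unfolding y1_def[abs_def] y2_def
    by (intro DERIV_add fourier_DERIV[OF f(2) cont(1,2) hc(1) that] fourier_DERIV[OF f(3) cont(3,4) hc(2) that])
  \<comment> \<open>The polar form of the Laplacian as a polynomial identity: \<open>c\<close>,
    \<open>s\<close> are cosine and sine, the a's partial derivatives, \<open>H\<close> the weight,
    \<open>K\<close> stands for k^2.\<close>
  have rotate: "r\<^sup>2 * ((a11 * (c * (c * H)) + a12 * (s * (c * H))) + (a21 * (c * (s * H)) + a22 * (s * (s * H)))) +
      r * (a1 * (c * H) + a2 * (s * H)) + (4 * m * r\<^sup>2 - K) * (a * H) +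
      ((r * (c * (r * c * a22 - r * s * a21) - s * a2) -
        r * (s * (r * c * a12 - r * s * a11) + c * a1)) * H + K * (a * H)) =
      r\<^sup>2 * H * ((a11 + a22) * (s\<^sup>2 + c\<^sup>2) + 4 * m * a)" for r c s H K a a1 a2 a11 a12 a21 a22
    by (simp add: algebra_simps power2_eq_square)
  have ode: "r\<^sup>2 * y2 r + r * y1 r + (4 * m * r\<^sup>2 - (real k)\<^sup>2) * fourier h f r = 0" if r: "0 < r" "r < 1" for r
  proof -
    have br: "pol r \<theta> \<in> ball 0 1" for \<theta> using r by (intro b) auto
    define V where "V f \<theta> = f (pol r \<theta>)" for f :: "real^2 \<Rightarrow> real" and \<theta>
    \<comment> \<open>The boundary term f_\<theta> h - f h' of two integrations by parts in
      \<theta>; its derivative is (f_\<theta>\<theta> + k^2 f) h.\<close>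
    define Q where "Q \<theta> = (r * cos \<theta> * V f2 \<theta> - r * sin \<theta> * V f1 \<theta>) * h \<theta> - V f \<theta> * h' \<theta>" for \<theta>
    define Q' where "Q' \<theta> = (r * (cos \<theta> * (r * cos \<theta> * V f22 \<theta> - r * sin \<theta> * V f21 \<theta>) - sin \<theta> * V f2 \<theta>) -
       r * (sin \<theta> * (r * cos \<theta> * V f12 \<theta> - r * sin \<theta> * V f11 \<theta>) + cos \<theta> * V f1 \<theta>)) * h \<theta> +
       (real k)\<^sup>2 * (V f \<theta> * h \<theta>)" for \<theta>
    have dQ: "(Q has_real_derivative Q' \<theta>) (at \<theta>)" for \<theta>
    proof -
      have d: "(V f has_real_derivative r * cos \<theta> * V f2 \<theta> - r * sin \<theta> * V f1 \<theta>) (at \<theta>)"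
        "(V f1 has_real_derivative r * cos \<theta> * V f12 \<theta> - r * sin \<theta> * V f11 \<theta>) (at \<theta>)"
        "(V f2 has_real_derivative r * cos \<theta> * V f22 \<theta> - r * sin \<theta> * V f21 \<theta>) (at \<theta>)"
        unfolding V_def[abs_def] by (intro has_gradient_on_pol(2)[of "ball 0 1"] f br)+
      show ?thesis
        unfolding Q_def[abs_def]
        apply (rule derivative_eq_intros d dh refl)+
        by (simp add: Q'_def algebra_simps)
    qed
    have "(Q' has_integral (Q (2 * pi) - Q 0)) {0..2 * pi}"
      by (intro fundamental_theorem_of_calculus)
        (auto simp: has_real_derivative_iff_has_vector_derivative[symmetric] intro!: has_field_derivative_at_within[OF dQ])
    moreover have "Q (2 * pi) = Q 0" using h by (simp add: Q_def V_def pol_def fourier_mode_def)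
    ultimately have 0: "(Q' has_integral 0) {0..2 * pi}" by simp
    note int = fourier_has_integral[OF _ _ br]
    have "((\<lambda>\<theta>. r\<^sup>2 * ((f11 (pol r \<theta>) * (cos \<theta> * (cos \<theta> * h \<theta>)) + f12 (pol r \<theta>) * (sin \<theta> * (cos \<theta> * h \<theta>))) +
        (f21 (pol r \<theta>) * (cos \<theta> * (sin \<theta> * h \<theta>)) + f22 (pol r \<theta>) * (sin \<theta> * (sin \<theta> * h \<theta>)))) +
        r * (f1 (pol r \<theta>) * (cos \<theta> * h \<theta>) + f2 (pol r \<theta>) * (sin \<theta> * h \<theta>)) +
        (4 * m * r\<^sup>2 - (real k)\<^sup>2) * (f (pol r \<theta>) * h \<theta>) + Q' \<theta>) has_integral
       r\<^sup>2 * y2 r + r * y1 r + (4 * m * r\<^sup>2 - (real k)\<^sup>2) * fourier h f r + 0) {0..2 * pi}"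
      (is "(?E has_integral _) _")
      unfolding y1_def y2_def
      by (intro has_integral_add has_integral_mult_right 0 int[OF cont(1) hcc(1)] int[OF cont(2) hcc(2)]
          int[OF cont(3) hcc(3)] int[OF cont(4) hcc(4)] int[OF f1c hc(1)] int[OF f2c hc(2)] int[OF fc h_cont])
    moreover have "?E \<theta> = 0" for \<theta>
    proof -
      have lap: "V f11 \<theta> + V f22 \<theta> = - 4 * m * V f \<theta>" unfolding V_def by (rule helmholtz[OF br])
      have sc: "(sin \<theta>)\<^sup>2 + (cos \<theta>)\<^sup>2 = 1" by simp
      have "?E \<theta> = r\<^sup>2 * h \<theta> * ((V f11 \<theta> + V f22 \<theta>) * ((sin \<theta>)\<^sup>2 + (cos \<theta>)\<^sup>2) + 4 * m * V f \<theta>)"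
        unfolding Q'_def V_def by (rule rotate)
      then show ?thesis unfolding lap sc by simp
    qed
    ultimately have "((\<lambda>\<theta>. 0) has_integral
       r\<^sup>2 * y2 r + r * y1 r + (4 * m * r\<^sup>2 - (real k)\<^sup>2) * fourier h f r) {0..2 * pi}" by simp
    then show ?thesis by (rule has_integral_unique) (rule has_integral_0)
  qed
  show ?thesis
    by (rule bessel_ode_regular_solution[of "fourier h f" y1 y2 m k, OF dy dy1 ode \<open>m \<noteq> 0\<close>];
      (assumption | rule that))
qed

section \<open>Completeness and boundary conditions\<close>

lemma fourier_linear:
  assumes "continuous_on S f" "continuous_on S g" "continuous_on {0..2 * pi} h" "\<And>\<theta>. pol r \<theta> \<in> S"
  shows "fourier h (\<lambda>x. a * f x + b * g x) r = a * fourier h f r + b * fourier h g r"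
proof -
  have "((\<lambda>\<theta>. a * (f (pol r \<theta>) * h \<theta>) + b * (g (pol r \<theta>) * h \<theta>)) has_integral
      a * fourier h f r + b * fourier h g r) {0..2 * pi}"
    using assms by (intro has_integral_add has_integral_mult_right fourier_has_integral[of S]) auto
  then show ?thesis
    unfolding fourier_def[of h "\<lambda>x. a * f x + b * g x"]
    by (intro integral_unique) (simp add: algebra_simps)
qed

lemma fourier_linear_mode:
  assumes "continuous_on S f" "continuous_on {0..2 * pi} h" "continuous_on {0..2 * pi} h'" "\<And>\<theta>. pol r \<theta> \<in> S"
  shows "fourier (\<lambda>\<theta>. a * h \<theta> + b * h' \<theta>) f r = a * fourier h f r + b * fourier h' f r"
proof -
  have "((\<lambda>\<theta>. a * (f (pol r \<theta>) * h \<theta>) + b * (f (pol r \<theta>) * h' \<theta>)) has_integral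
      a * fourier h f r + b * fourier h' f r) {0..2 * pi}"
    using assms by (intro has_integral_add has_integral_mult_right fourier_has_integral[of S]) auto
  then show ?thesis
    unfolding fourier_def[of "\<lambda>\<theta>. a * h \<theta> + b * h' \<theta>"]
    by (intro integral_unique) (simp add: algebra_simps)
qed

definition null_modes :: "real \<Rightarrow> (real^2 \<Rightarrow> real) \<Rightarrow> bool" where
  "null_modes r q \<longleftrightarrow> continuous_on (sphere 0 r) q \<and>
     (\<forall>k::nat. fourier (\<lambda>\<theta>. cos (k * \<theta>)) q r = 0 \<and> fourier (\<lambda>\<theta>. sin (k * \<theta>)) q r = 0)"

context
  fixes r :: real
  assumes r: "0 \<le> r"
begin

lemma pol_sphere: "pol r \<theta> \<in> sphere 0 r"
  using r by (simp add: norm_pol)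

lemma null_modes_linear:
  assumes "null_modes r f" "null_modes r g"
  shows "null_modes r (\<lambda>x. a * f x + b * g x)"
proof -
  have "fourier h (\<lambda>x. a * f x + b * g x) r = a * fourier h f r + b * fourier h g r"
    if "continuous_on {0..2 * pi} h" for h
    using assms that by (intro fourier_linear[of "sphere 0 r"] pol_sphere) (auto simp: null_modes_def)
  then have "fourier (\<lambda>\<theta>. cos (k * \<theta>)) (\<lambda>x. a * f x + b * g x) r = 0"
    "fourier (\<lambda>\<theta>. sin (k * \<theta>)) (\<lambda>x. a * f x + b * g x) r = 0" for k :: nat
    using assms by (simp_all add: null_modes_def continuous_intros)
  then show ?thesis using assms by (simp add: null_modes_def continuous_intros)
qed

text \<open>Negative frequencies are included because shifting the frequency 0 down by one leads to
  -1.\<close>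

lemma null_modes_int:
  assumes "null_modes r q"
  shows "fourier (\<lambda>\<theta>. cos (of_int n * \<theta>)) q r = 0" "fourier (\<lambda>\<theta>. sin (of_int n * \<theta>)) q r = 0"
proof -
  obtain k :: nat where "n = int k \<or> n = - int k" by (metis int_cases2)
  moreover have "fourier (\<lambda>\<theta>. - sin (k * \<theta>)) q r = - fourier (\<lambda>\<theta>. sin (k * \<theta>)) q r"
    unfolding fourier_def by simp
  ultimately show "fourier (\<lambda>\<theta>. cos (of_int n * \<theta>)) q r = 0" "fourier (\<lambda>\<theta>. sin (of_int n * \<theta>)) q r = 0"
    using assms by (auto simp: null_modes_def)
qed

text \<open>On the circle a coordinate is r cos \<theta> or r sin \<theta>, and multiplying by it
  only shifts frequencies by one up and down.\<close>

lemma null_modes_mult_coord: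
  assumes q: "null_modes r q"
  shows "null_modes r (\<lambda>x. x$1 * q x)" "null_modes r (\<lambda>x. x$2 * q x)"
proof -
  have cont: "continuous_on (sphere 0 r) q" using q by (simp add: null_modes_def)
  have lin: "fourier (\<lambda>\<theta>. a * h \<theta> + b * h' \<theta>) q r = a * fourier h q r + b * fourier h' q r"
    if "continuous_on {0..2 * pi} h" "continuous_on {0..2 * pi} h'" for a b h h'
    by (rule fourier_linear_mode[OF cont that pol_sphere])
  define C S where "C n \<theta> = cos (of_int n * \<theta>)" and "S n \<theta> = sin (of_int n * \<theta>)" for n :: int and \<theta> :: real
  have CS: "continuous_on {0..2 * pi} (C n)" "continuous_on {0..2 * pi} (S n)" for n
    unfolding C_def[abs_def] S_def[abs_def] by (intro continuous_intros)+
  have zero: "fourier (C n) q r = 0" "fourier (S n) q r = 0" for n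
    unfolding C_def[abs_def] S_def[abs_def] by (intro null_modes_int[OF q])+
  have arg: "of_int (int k + 1) * \<theta> = k * \<theta> + \<theta>" "of_int (int k - 1) * \<theta> = k * \<theta> - \<theta>"
    for k :: nat and \<theta> :: real by (simp_all add: algebra_simps)
  have shift: "fourier h (\<lambda>x. x$i * q x) r = fourier (\<lambda>\<theta>. a * h1 \<theta> + b * h2 \<theta>) q r"
    if "\<And>\<theta>. pol r \<theta> $ i * h \<theta> = a * h1 \<theta> + b * h2 \<theta>" for i h h1 h2 a b
    unfolding fourier_def that[symmetric] by (simp add: mult_ac)
  have "fourier (\<lambda>\<theta>. cos (k * \<theta>)) (\<lambda>x. x$1 * q x) r =
      fourier (\<lambda>\<theta>. r / 2 * C (int k + 1) \<theta> + r / 2 * C (int k - 1) \<theta>) q r"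
    "fourier (\<lambda>\<theta>. sin (k * \<theta>)) (\<lambda>x. x$1 * q x) r =
      fourier (\<lambda>\<theta>. r / 2 * S (int k + 1) \<theta> + r / 2 * S (int k - 1) \<theta>) q r"
    "fourier (\<lambda>\<theta>. cos (k * \<theta>)) (\<lambda>x. x$2 * q x) r =
      fourier (\<lambda>\<theta>. r / 2 * S (int k + 1) \<theta> + (- r / 2) * S (int k - 1) \<theta>) q r"
    "fourier (\<lambda>\<theta>. sin (k * \<theta>)) (\<lambda>x. x$2 * q x) r =
      fourier (\<lambda>\<theta>. (- r / 2) * C (int k + 1) \<theta> + r / 2 * C (int k - 1) \<theta>) q r" for k :: nat
    by (rule shift; simp add: C_def S_def arg cos_add cos_diff sin_add sin_diff field_simps)+
  then have "fourier (\<lambda>\<theta>. cos (k * \<theta>)) (\<lambda>x. x$1 * q x) r = 0"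
    "fourier (\<lambda>\<theta>. sin (k * \<theta>)) (\<lambda>x. x$1 * q x) r = 0"
    "fourier (\<lambda>\<theta>. cos (k * \<theta>)) (\<lambda>x. x$2 * q x) r = 0"
    "fourier (\<lambda>\<theta>. sin (k * \<theta>)) (\<lambda>x. x$2 * q x) r = 0" for k :: nat
    unfolding lin[OF CS(1) CS(1)] lin[OF CS(2) CS(2)] zero by simp_all
  then show "null_modes r (\<lambda>x. x$1 * q x)" "null_modes r (\<lambda>x. x$2 * q x)"
    using cont by (auto simp: null_modes_def intro!: continuous_intros)
qed

text \<open>A linear form is a combination of the two coordinates; \<open>q\<close> is generalised
  because the product case applies one hypothesis to the result of the other.\<close>

lemma null_modes_mult_polynomial:
  assumes "real_polynomial_function p" "null_modes r q"
  shows "null_modes r (\<lambda>x. p x * q x)"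
  using assms
proof (induction arbitrary: q rule: real_polynomial_function.induct)
  case (linear f)
  have eq: "f x = f (axis 1 1) * x$1 + f (axis 2 1) * x$2" for x :: "real^2"
  proof -
    interpret bounded_linear f by fact
    have "x = x$1 *\<^sub>R axis 1 1 + x$2 *\<^sub>R axis 2 1" by (simp add: vec_eq_iff forall_2 axis_def)
    then have "f x = f (x$1 *\<^sub>R axis 1 1 + x$2 *\<^sub>R axis 2 1)" by simp
    then show ?thesis by (simp add: add scaleR mult.commute)
  qed
  have "(\<lambda>x. f x * q x) = (\<lambda>x. f (axis 1 1) * (x$1 * q x) + f (axis 2 1) * (x$2 * q x))"
    by (rule ext, subst eq) (simp add: algebra_simps)
  then show ?case using linear by (simp add: null_modes_linear null_modes_mult_coord)
next
  case (const c)
  then show ?case using null_modes_linear[of q q c 0] by simp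
next
  case (add f g)
  then show ?case
    using null_modes_linear[OF add.IH(1)[OF add.prems] add.IH(2)[OF add.prems], of 1 1]
    by (simp add: distrib_right)
next
  case (mult f g)
  show ?case using mult.IH(1)[OF mult.IH(2)[OF mult.prems]] by (simp add: mult.assoc)
qed

text \<open>By Stone-Weierstrass, \<open>q\<close> is uniformly close to a polynomial, and it is orthogonal to
  every polynomial on the circle.\<close>
lemma null_modes_eq_0:
  assumes q: "null_modes r q" and x: "norm x = r"
  shows "q x = 0"
proof -
  have cont: "continuous_on (sphere 0 r) q" using q by (simp add: null_modes_def)
  define Q where "Q \<theta> = q (pol r \<theta>)" for \<theta>
  have pc: "continuous_on {0..2 * pi} (\<lambda>\<theta>. g (pol r \<theta>))" if "continuous_on (sphere 0 r) g"
    for g :: "real^2 \<Rightarrow> real"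
    using continuous_on_fourier[OF that continuous_on_const pol_sphere, of 1] by simp
  have Qc: "continuous_on {0..2 * pi} Q" unfolding Q_def[abs_def] by (rule pc[OF cont])
  define I K where "I = integral {0..2 * pi} (\<lambda>\<theta>. (Q \<theta>)\<^sup>2)" and "K = integral {0..2 * pi} (\<lambda>\<theta>. \<bar>Q \<theta>\<bar>)"
  have int: "(\<lambda>\<theta>. (Q \<theta>)\<^sup>2) integrable_on {0..2 * pi}" "(\<lambda>\<theta>. \<bar>Q \<theta>\<bar>) integrable_on {0..2 * pi}"
    by (intro integrable_continuous_real continuous_intros Qc)+
  have K: "K \<ge> 0" unfolding K_def using int by (intro integral_nonneg) auto
  have bound: "I \<le> e * K" if e: "e > 0" for e
  proof -
    obtain p where p: "real_polynomial_function p" "\<And>x. x \<in> sphere 0 r \<Longrightarrow> \<bar>q x - p x\<bar> < e"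
      using Stone_Weierstrass_real_polynomial_function[OF compact_sphere cont e] by blast
    have "null_modes r (\<lambda>x. p x * q x)" by (rule null_modes_mult_polynomial[OF p(1) q])
    \<comment> \<open>The cosine mode of frequency 0 is the plain integral of p q, whence
      orthogonality.\<close>
    then have pq: "continuous_on (sphere 0 r) (\<lambda>x. p x * q x)"
        "fourier (\<lambda>\<theta>. cos (real 0 * \<theta>)) (\<lambda>x. p x * q x) r = 0"
      unfolding null_modes_def by blast+
    have pi: "(\<lambda>\<theta>. p (pol r \<theta>) * Q \<theta>) integrable_on {0..2 * pi}"
      using integrable_continuous_real[OF pc[OF pq(1)]] by (simp add: Q_def)
    have p0: "integral {0..2 * pi} (\<lambda>\<theta>. p (pol r \<theta>) * Q \<theta>) = 0"
      using pq(2) by (simp add: fourier_def Q_def)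
    have "I = integral {0..2 * pi} (\<lambda>\<theta>. (Q \<theta>)\<^sup>2 - p (pol r \<theta>) * Q \<theta>)"
      unfolding I_def using p0 by (subst integral_diff[OF int(1) pi]) simp
    also have "\<dots> \<le> integral {0..2 * pi} (\<lambda>\<theta>. e * \<bar>Q \<theta>\<bar>)"
    proof (rule integral_le)
      fix \<theta>
      have "(Q \<theta>)\<^sup>2 - p (pol r \<theta>) * Q \<theta> = (q (pol r \<theta>) - p (pol r \<theta>)) * Q \<theta>"
        by (simp add: Q_def power2_eq_square algebra_simps)
      also have "\<dots> \<le> \<bar>q (pol r \<theta>) - p (pol r \<theta>)\<bar> * \<bar>Q \<theta>\<bar>" by (metis abs_ge_self abs_mult)
      also have "\<dots> \<le> e * \<bar>Q \<theta>\<bar>"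
        using p(2)[OF pol_sphere, of \<theta>] by (intro mult_right_mono) auto
      finally show "(Q \<theta>)\<^sup>2 - p (pol r \<theta>) * Q \<theta> \<le> e * \<bar>Q \<theta>\<bar>" .
    qed (intro integrable_diff integrable_on_mult_right int pi)+
    also have "\<dots> = e * K" by (simp add: K_def)
    finally show ?thesis .
  qed
  have "I \<le> 0"
  proof (rule ccontr)
    assume "\<not> I \<le> 0"
    then have I: "I > 0" by simp
    \<comment> \<open>K may be 0, hence the denominator K + 1.\<close>
    have "I \<le> I / (2 * (K + 1)) * K" using I K by (intro bound) auto
    also have "\<dots> < I" using I K by (simp add: field_simps add_nonneg_pos)
    finally show False by simp
  qed
  moreover have "I \<ge> 0" unfolding I_def using int by (intro integral_nonneg) auto
  ultimately have "integral {0..2 * pi} (\<lambda>\<theta>. (Q \<theta>)\<^sup>2) = 0" by (simp add: I_def)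
  moreover have "continuous_on {0..2 * pi} (\<lambda>\<theta>. (Q \<theta>)\<^sup>2)" by (intro continuous_intros Qc)
  ultimately have Q0: "\<forall>\<theta>\<in>{0..2 * pi}. (Q \<theta>)\<^sup>2 = 0"
    using integral_eq_0_iff[of 0 "2 * pi" "\<lambda>\<theta>. (Q \<theta>)\<^sup>2"] by simp
  obtain \<theta> where "0 \<le> \<theta>" "\<theta> \<le> 2 * pi" "x = pol (norm x) \<theta>" using exists_pol by metis
  with Q0 x show ?thesis by (auto simp: Q_def)
qed

end

section \<open>From the classical solution to its Fourier modes\<close>

lemma Cn_on_gradient:
  assumes "Cn_on (Suc n) S f"
  shows "has_gradient_on S f (partial (axis 1 1) f) (partial (axis 2 1) f)"
    "Cn_on n S (partial (axis 1 1) f)" "Cn_on n S (partial (axis 2 1) f)"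
proof -
  show "Cn_on n S (partial (axis 1 1) f)" "Cn_on n S (partial (axis 2 1) f)"
    using assms by (auto simp: Basis_real2)
  show "has_gradient_on S f (partial (axis 1 1) f) (partial (axis 2 1) f)"
    unfolding has_gradient_on_def
  proof
    fix x assume "x \<in> S"
    define D where "D = frechet_derivative f (at x)"
    have d: "(f has_derivative D) (at x)"
      using assms \<open>x \<in> S\<close> by (auto simp: D_def frechet_derivative_works)
    have "D h = D (axis 1 1) * h$1 + D (axis 2 1) * h$2" for h
    proof -
      interpret bounded_linear D using d by (rule has_derivative_bounded_linear)
      have "h = h$1 *\<^sub>R axis 1 1 + h$2 *\<^sub>R axis 2 1" by (simp add: vec_eq_iff forall_2 axis_def)
      then have "D h = D (h$1 *\<^sub>R axis 1 1 + h$2 *\<^sub>R axis 2 1)" by simp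
      then show ?thesis by (simp add: add scaleR mult.commute)
    qed
    then have "D = (\<lambda>h. D (axis 1 1) * h$1 + D (axis 2 1) * h$2)" by blast
    with d show "(f has_derivative (\<lambda>h. partial (axis 1 1) f x * h$1 + partial (axis 2 1) f x * h$2)) (at x)"
      by (simp add: partial_def D_def)
  qed
qed

lemma laplacian_real2:
  "laplacian (f :: real^2 \<Rightarrow> real) x =
     partial (axis 1 1) (partial (axis 1 1) f) x + partial (axis 2 1) (partial (axis 2 1) f) x"
  using axis_1_neq_axis_2 by (simp add: laplacian_def Basis_real2)

text \<open>The hypothesis says that w = \<Delta>u + a u satisfies \<Delta>w = -4 m w. Four
  continuous derivatives of u supply the continuous second derivatives of w that the mode equation
  asks for.\<close>

lemma fourier_laplacian_mode:
  assumes u: "Cn_on 4 (ball 0 1) u"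
    and eq: "\<And>x. x \<in> ball 0 1 \<Longrightarrow>
      laplacian (laplacian u) x + a * laplacian u x = - 4 * m * (laplacian u x + a * u x)"
    and "m \<noteq> 0" and h: "fourier_mode k h h'"
  obtains c where "\<And>r. 0 < r \<Longrightarrow> r < 1 \<Longrightarrow>
    fourier h (\<lambda>x. laplacian u x + a * u x) r = c * (r ^ k * clifford k (m * r\<^sup>2))"
proof -
  let ?B = "ball 0 1 :: (real^2) set"
  let ?x = "partial (axis 1 1) :: (real^2 \<Rightarrow> real) \<Rightarrow> real^2 \<Rightarrow> real"
  let ?y = "partial (axis 2 1) :: (real^2 \<Rightarrow> real) \<Rightarrow> real^2 \<Rightarrow> real"
  have C: "Cn_on (Suc (Suc (Suc (Suc 0)))) ?B u" using u by (simp add: numeral_eq_Suc)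
  note g1 = Cn_on_gradient[OF C]
  note gx = Cn_on_gradient[OF g1(2)] and gy = Cn_on_gradient[OF g1(3)]
  note gxx = Cn_on_gradient[OF gx(2)] and gyy = Cn_on_gradient[OF gy(3)]
  note gxxx = Cn_on_gradient[OF gxx(2)] and gxxy = Cn_on_gradient[OF gxx(3)]
  note gyyx = Cn_on_gradient[OF gyy(2)] and gyyy = Cn_on_gradient[OF gyy(3)]
  have cont: "continuous_on ?B f" if "Cn_on 0 ?B f" for f using that by simp
  have cont1: "continuous_on ?B f" if "Cn_on (Suc n) ?B f" for f n
    using Cn_on_gradient(1)[OF that] by (rule has_gradient_on_continuous)
  have lap: "laplacian u = (\<lambda>x. ?x (?x u) x + ?y (?y u) x)" by (rule ext) (rule laplacian_real2)
  note lap_grad = has_gradient_on_add[OF gxx(1) gyy(1)]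
  note lap_x = has_gradient_on_add[OF gxxx(1) gyyx(1)] and lap_y = has_gradient_on_add[OF gxxy(1) gyyy(1)]
  have ll: "laplacian (laplacian u) x =
      (?x (?x (?x (?x u))) x + ?x (?x (?y (?y u))) x) + (?y (?y (?x (?x u))) x + ?y (?y (?y (?y u))) x)"
    if "x \<in> ?B" for x
    unfolding lap by (rule laplacian_eq[OF open_ball that lap_grad lap_x lap_y])
  note f = has_gradient_on_add[OF lap_grad has_gradient_on_cmult[OF g1(1), of a]]
  note fx = has_gradient_on_add[OF lap_x has_gradient_on_cmult[OF gx(1), of a]]
  note fy = has_gradient_on_add[OF lap_y has_gradient_on_cmult[OF gy(1), of a]]
  show ?thesis
    unfolding lap
  proof (rule fourier_ode[OF f fx fy])
    show "continuous_on ?B (\<lambda>x. ?x (?x (?x (?x u))) x + ?x (?x (?y (?y u))) x + a * ?x (?x u) x)"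
      "continuous_on ?B (\<lambda>x. ?y (?x (?x (?x u))) x + ?y (?x (?y (?y u))) x + a * ?y (?x u) x)"
      "continuous_on ?B (\<lambda>x. ?x (?y (?x (?x u))) x + ?x (?y (?y (?y u))) x + a * ?x (?y u) x)"
      "continuous_on ?B (\<lambda>x. ?y (?y (?x (?x u))) x + ?y (?y (?y (?y u))) x + a * ?y (?y u) x)"
      by (intro continuous_on_add continuous_on_mult continuous_on_const cont gxxx gxxy gyyx gyyy
          cont1[OF gx(2)] cont1[OF gx(3)] cont1[OF gy(2)] cont1[OF gy(3)])+
  next
    fix x assume x: "x \<in> ?B"
    show "?x (?x (?x (?x u))) x + ?x (?x (?y (?y u))) x + a * ?x (?x u) x +
      (?y (?y (?x (?x u))) x + ?y (?y (?y (?y u))) x + a * ?y (?y u) x) =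
      - 4 * m * (?x (?x u) x + ?y (?y u) x + a * u x)"
      using eq[OF x] unfolding ll[OF x] unfolding lap by (simp add: algebra_simps)
  next
    fix c assume "\<And>r. 0 < r \<Longrightarrow> r < 1 \<Longrightarrow> fourier h (\<lambda>x. ?x (?x u) x + ?y (?y u) x + a * u x) r =
        c * (r ^ k * clifford k (m * r\<^sup>2))"
    then show thesis using that[of c] by (simp only: lap)
  qed (use \<open>m \<noteq> 0\<close> h in auto)
qed

text \<open>Differentiation under the integral is done within [0,1] along radii, using the gradient
  that is continuous up to the circle. Uniqueness of one-sided derivatives identifies its radial
  part at r = 1 with the prescribed 0.\<close>

lemma fourier_boundary:
  assumes u: "C1_closed_on (cball 0 1) u" and h: "continuous_on {0..2 * pi} h"
    and bc: "\<And>x. x \<in> sphere 0 1 \<Longrightarrow> u x = 0"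
      "\<And>x. x \<in> sphere 0 1 \<Longrightarrow> ((\<lambda>r. u (r *\<^sub>R x)) has_real_derivative 0) (at_left 1)"
  shows "fourier h u 1 = 0" "(fourier h u has_real_derivative 0) (at 1 within {0..1})"
proof -
  show "fourier h u 1 = 0" by (simp add: fourier_def bc(1) norm_pol)
  obtain g where g: "continuous_on (cball 0 1) g"
    "\<And>x. x \<in> cball 0 1 \<Longrightarrow> (u has_derivative (\<lambda>h. g x \<bullet> h)) (at x within cball 0 1)"
    using u by (auto simp: C1_closed_on_def)
  have cb: "pol s \<theta> \<in> cball 0 1" if "s \<in> {0..1}" for s \<theta> using that by (simp add: norm_pol)
  have uc: "continuous_on (cball 0 1) u"
    unfolding continuous_on_eq_continuous_within using has_derivative_continuous[OF g(2)] by blast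
  have du: "((\<lambda>s. u (pol s \<theta>)) has_real_derivative g (pol s \<theta>) \<bullet> pol 1 \<theta>) (at s within {0..1})"
    if s: "s \<in> {0..1}" for s \<theta>
  proof -
    have "((\<lambda>s. pol s \<theta>) has_derivative (\<lambda>h. h *\<^sub>R pol 1 \<theta>)) (at s within {0..1})"
      unfolding pol_def by (auto intro!: derivative_eq_intros simp: algebra_simps)
    moreover have "(u has_derivative (\<lambda>h. g (pol s \<theta>) \<bullet> h)) (at (pol s \<theta>) within (\<lambda>s. pol s \<theta>) ` {0..1})"
      using cb by (intro has_derivative_subset[OF g(2)[OF cb[OF s]]]) auto
    ultimately have "((\<lambda>s. u (pol s \<theta>)) has_derivative (\<lambda>h. g (pol s \<theta>) \<bullet> (h *\<^sub>R pol 1 \<theta>))) (at s within {0..1})"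
      by (rule has_derivative_in_compose)
    then show ?thesis
      unfolding has_field_derivative_def
      by (rule has_derivative_eq_rhs) (auto simp: mult.commute)
  qed
  have "((\<lambda>s. integral (cbox 0 (2 * pi)) (\<lambda>\<theta>. u (pol s \<theta>) * h \<theta>)) has_field_derivative
      integral (cbox 0 (2 * pi)) (\<lambda>\<theta>. (g (pol 1 \<theta>) \<bullet> pol 1 \<theta>) * h \<theta>)) (at 1 within {0..1})"
  proof (rule leibniz_rule_field_derivative[where fx = "\<lambda>s \<theta>. (g (pol s \<theta>) \<bullet> pol 1 \<theta>) * h \<theta>"])
    fix s :: real and \<theta> assume s: "s \<in> {0..1}"
    show "((\<lambda>s. u (pol s \<theta>) * h \<theta>) has_real_derivative (g (pol s \<theta>) \<bullet> pol 1 \<theta>) * h \<theta>) (at s within {0..1})"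
      by (rule DERIV_cmult_right[OF du[OF s]])
    show "(\<lambda>\<theta>. u (pol s \<theta>) * h \<theta>) integrable_on cbox 0 (2 * pi)"
      using continuous_on_fourier[OF uc h cb[OF s]] by (simp add: integrable_continuous_real)
  next
    have "continuous_on ({0..1} \<times> {0..2 * pi}) (\<lambda>x. (g (pol (fst x) (snd x)) \<bullet> pol 1 (snd x)) * h (snd x))"
      by (intro continuous_intros continuous_on_compose2[OF g(1)] continuous_on_compose2[OF h])
        (auto intro!: cb[simplified])
    then show "continuous_on ({0..1} \<times> cbox 0 (2 * pi)) (\<lambda>(s, \<theta>). (g (pol s \<theta>) \<bullet> pol 1 \<theta>) * h \<theta>)"
      by (simp add: case_prod_beta)
  qed auto
  moreover have "g (pol 1 \<theta>) \<bullet> pol 1 \<theta> = 0" for \<theta>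
  proof -
    have left: "at 1 within {0..1} = at_left (1::real)" by (rule at_within_Icc_at_left) simp
    have "((\<lambda>s. u (pol s \<theta>)) has_real_derivative g (pol 1 \<theta>) \<bullet> pol 1 \<theta>) (at_left 1)"
      using du[of 1 \<theta>] by (simp add: left)
    moreover have "((\<lambda>s. u (pol s \<theta>)) has_real_derivative 0) (at_left 1)"
      using bc(2)[of "pol 1 \<theta>"] by (simp add: scaleR_pol norm_pol)
    ultimately show ?thesis
      unfolding has_field_derivative_iff by (intro tendsto_unique[OF trivial_limit_at_left_real])
  qed
  ultimately show "(fourier h u has_real_derivative 0) (at 1 within {0..1})"
    unfolding fourier_def[abs_def] by simp
qed

lemma fourier_mode_cos: "fourier_mode k (\<lambda>\<theta>. cos (real k * \<theta>)) (\<lambda>\<theta>. - real k * sin (real k * \<theta>))"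
  and fourier_mode_sin: "fourier_mode k (\<lambda>\<theta>. sin (real k * \<theta>)) (\<lambda>\<theta>. real k * cos (real k * \<theta>))"
proof -
  have *: "sin (real k * (2 * pi)) = 0" "cos (real k * (2 * pi)) = 1"
    by (simp_all add: mult.left_commute[of "real k"] sin_double cos_double_sin)
  show "fourier_mode k (\<lambda>\<theta>. cos (real k * \<theta>)) (\<lambda>\<theta>. - real k * sin (real k * \<theta>))"
    "fourier_mode k (\<lambda>\<theta>. sin (real k * \<theta>)) (\<lambda>\<theta>. real k * cos (real k * \<theta>))"
    unfolding fourier_mode_def
    by (auto intro!: derivative_eq_intros simp: * power2_eq_square)
qed

text \<open>The operator factors as (\<Delta> + 4 X)(\<Delta> - 4 Y), so \<Delta>u - 4 Y u and
  \<Delta>u + 4 X u solve Helmholtz equations, and their difference recovers 4 (X + Y) u.\<close>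

lemma solution_fourier_eq_0:
  assumes sol: "is_solution (- 16 * X * Y) (4 * (X - Y)) u" and XY: "0 < X" "0 < Y"
    and char: "char_fun k X Y \<noteq> 0" and h: "fourier_mode k h h'" and r: "0 < r" "r < 1"
  shows "fourier h u r = 0"
proof -
  let ?L = "laplacian u"
  have u: "Cn_on 4 (ball 0 1) u" "C1_closed_on (cball 0 1) u"
    and pde: "\<And>x. x \<in> ball 0 1 \<Longrightarrow> laplacian ?L x + (- 16 * X * Y) * u x = - (4 * (X - Y)) * ?L x"
    and bc: "\<And>x. x \<in> sphere 0 1 \<Longrightarrow> u x = 0"
      "\<And>x. x \<in> sphere 0 1 \<Longrightarrow> ((\<lambda>r. u (r *\<^sub>R x)) has_real_derivative 0) (at_left 1)"
    using sol by (auto simp: is_solution_def)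
  have hc: "continuous_on {0..2 * pi} h"
    using h by (intro continuous_at_imp_continuous_on) (auto simp: fourier_mode_def intro: DERIV_isCont)
  have C: "Cn_on (Suc (Suc (Suc (Suc 0)))) (ball 0 1) u" using u(1) by (simp add: numeral_eq_Suc)
  note g1 = Cn_on_gradient[OF C]
  have uc: "continuous_on (ball 0 1) u" by (rule has_gradient_on_continuous[OF g1(1)])
  have Lc: "continuous_on (ball 0 1) ?L"
  proof -
    have "?L = (\<lambda>x. partial (axis 1 1) (partial (axis 1 1) u) x + partial (axis 2 1) (partial (axis 2 1) u) x)"
      by (rule ext) (rule laplacian_real2)
    moreover have "continuous_on (ball 0 1) (partial (axis 1 1) (partial (axis 1 1) u))"
      using Cn_on_gradient(1)[OF Cn_on_gradient(2)[OF g1(2)]] by (rule has_gradient_on_continuous)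
    moreover have "continuous_on (ball 0 1) (partial (axis 2 1) (partial (axis 2 1) u))"
      using Cn_on_gradient(1)[OF Cn_on_gradient(3)[OF g1(3)]] by (rule has_gradient_on_continuous)
    ultimately show ?thesis by (simp add: continuous_on_add)
  qed
  obtain c where c: "\<And>r. 0 < r \<Longrightarrow> r < 1 \<Longrightarrow>
      fourier h (\<lambda>x. ?L x + - 4 * Y * u x) r = c * (r ^ k * clifford k (X * r\<^sup>2))"
  proof (rule fourier_laplacian_mode[OF u(1) _ _ h, of "- 4 * Y" X])
    show "laplacian ?L x + - 4 * Y * ?L x = - 4 * X * (?L x + - 4 * Y * u x)" if "x \<in> ball 0 1" for x
      using pde[OF that] by (simp add: algebra_simps)
  qed (use XY in auto)
  obtain d where d: "\<And>r. 0 < r \<Longrightarrow> r < 1 \<Longrightarrow>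
      fourier h (\<lambda>x. ?L x + 4 * X * u x) r = d * (r ^ k * clifford k (- Y * r\<^sup>2))"
  proof (rule fourier_laplacian_mode[OF u(1) _ _ h, of "4 * X" "- Y"])
    show "laplacian ?L x + 4 * X * ?L x = - 4 * (- Y) * (?L x + 4 * X * u x)" if "x \<in> ball 0 1" for x
      using pde[OF that] by (simp add: algebra_simps)
  qed (use XY in auto)
  define A where "A = - c / (4 * (X + Y))"
  define B where "B = d / (4 * (X + Y))"
  \<comment> \<open>An explicit function that is smooth across r = 1 and agrees with the mode
    inside; it inherits value and slope 0 through left limits.\<close>
  define P where "P r = r ^ k * (A * clifford k (X * r\<^sup>2) + B * clifford k (- Y * r\<^sup>2))" for r
  have fP: "fourier h u r = P r" if r: "0 < r" "r < 1" for r
  proof -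
    have b: "pol r \<theta> \<in> ball 0 1" for \<theta> using r by (simp add: norm_pol)
    have lin: "fourier h (\<lambda>x. ?L x + a * u x) r = fourier h ?L r + a * fourier h u r" for a
      using fourier_linear[OF Lc uc hc b, of 1 a] by simp
    have "4 * (X + Y) * fourier h u r =
        d * (r ^ k * clifford k (- Y * r\<^sup>2)) - c * (r ^ k * clifford k (X * r\<^sup>2))"
      using c[OF r] d[OF r] unfolding lin by (simp add: algebra_simps)
    note eq = this
    have "P r = (d * (r ^ k * clifford k (- Y * r\<^sup>2)) - c * (r ^ k * clifford k (X * r\<^sup>2))) / (4 * (X + Y))"
      unfolding P_def A_def B_def by (simp add: diff_divide_distrib algebra_simps)
    also have "\<dots> = fourier h u r"
      unfolding eq[symmetric] using XY by simp
    finally show ?thesis ..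
  qed
  have f1: "fourier h u 1 = 0" and df: "(fourier h u has_real_derivative 0) (at 1 within {0..1})"
    using fourier_boundary[OF u(2) hc bc] by auto
  define D where "D = k * (A * clifford k X + B * clifford k (- Y)) -
    2 * (A * (X * clifford (k + 1) X) - B * (Y * clifford (k + 1) (- Y)))"
  have dP: "(P has_real_derivative D) (at 1)"
    unfolding P_def[abs_def] D_def by (rule derivative_eq_intros refl | simp)+
  have left: "at 1 within {0..1} = at_left (1::real)" by (rule at_within_Icc_at_left) simp
  have ev: "\<forall>\<^sub>F r in at_left 1. fourier h u r = P r"
    unfolding eventually_at_left_field using fP by (intro exI[of _ 0]) auto
  have P1: "P 1 = 0"
  proof -
    have "(fourier h u \<longlongrightarrow> 0) (at_left 1)"
      using DERIV_continuous[OF df] by (simp add: left continuous_within f1)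
    then have "(P \<longlongrightarrow> 0) (at_left 1)" by (rule tendsto_cong[OF ev, THEN iffD1])
    moreover have "(P \<longlongrightarrow> P 1) (at_left 1)"
      using DERIV_isCont[OF dP] by (simp add: isCont_def filterlim_at_split)
    ultimately show ?thesis by (intro tendsto_unique[OF trivial_limit_at_left_real])
  qed
  have "D = 0"
  proof -
    have "((\<lambda>r. (fourier h u r - fourier h u 1) / (r - 1)) \<longlongrightarrow> 0) (at_left 1)"
      using df by (simp add: has_field_derivative_iff left)
    moreover have ev': "\<forall>\<^sub>F r in at_left 1. (fourier h u r - fourier h u 1) / (r - 1) = (P r - P 1) / (r - 1)"
      using ev by eventually_elim (simp add: f1 P1)
    ultimately have "((\<lambda>r. (P r - P 1) / (r - 1)) \<longlongrightarrow> 0) (at_left 1)"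
      by (simp only: tendsto_cong[OF ev'])
    moreover have "((\<lambda>r. (P r - P 1) / (r - 1)) \<longlongrightarrow> D) (at_left 1)"
      using dP by (simp add: has_field_derivative_iff filterlim_at_split)
    ultimately show ?thesis by (intro tendsto_unique[OF trivial_limit_at_left_real])
  qed
  have e1: "A * clifford k X + B * clifford k (- Y) = 0" using P1 by (simp add: P_def)
  with \<open>D = 0\<close> have e2: "A * (X * clifford (k + 1) X) = B * (Y * clifford (k + 1) (- Y))"
    unfolding D_def by simp
  \<comment> \<open>Cramer's rule for \<open>e1\<close> and \<open>e2\<close>, whose determinant is
    \<open>char_fun k X Y\<close> up to sign.\<close>
  have "A * char_fun k X Y = 0" "B * char_fun k X Y = 0"
    unfolding char_fun_def using e1 e2 by algebra+
  then have "A = 0" "B = 0" using char by auto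
  then show ?thesis using fP[OF r] by (simp add: P_def)
qed

lemma eigenfunction_char_fun:
  assumes eig: "is_eigenfunction (- 16 * X * Y) (4 * (X - Y)) u" and XY: "0 < X" "0 < Y"
  shows "\<exists>k. char_fun k X Y = 0"
proof (rule ccontr)
  assume none: "\<nexists>k. char_fun k X Y = 0"
  have sol: "is_solution (- 16 * X * Y) (4 * (X - Y)) u"
    and "\<exists>x\<in>ball 0 1. u x \<noteq> 0" using eig by (auto simp: is_eigenfunction_def)
  then obtain x where x: "x \<in> ball 0 1" "u x \<noteq> 0" by blast
  have "Cn_on (Suc (Suc (Suc (Suc 0)))) (ball 0 1) u"
    using sol by (simp add: is_solution_def numeral_eq_Suc)
  from has_gradient_on_continuous[OF Cn_on_gradient(1)[OF this]]
  have uc: "continuous_on (ball 0 1) u" .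
  have zero: "u x = 0" if "0 < norm x" "norm x < 1" for x
  proof (rule null_modes_eq_0[OF _ _ refl])
    have "sphere 0 (norm x) \<subseteq> ball 0 1" using that by auto
    then have "continuous_on (sphere 0 (norm x)) u" using uc continuous_on_subset by blast
    then show "null_modes (norm x) u"
      unfolding null_modes_def
      using none solution_fourier_eq_0[OF sol XY _ fourier_mode_cos that]
        solution_fourier_eq_0[OF sol XY _ fourier_mode_sin that] by blast
  qed simp
  then have "x = 0" using x by force
  \<comment> \<open>Circles of positive radius do not reach the centre, which is covered by
    continuity.\<close>
  have "isCont u 0" using continuous_on_interior[OF uc, of 0] by simp
  then have lim: "(u \<longlongrightarrow> u 0) (at 0)" by (simp add: isCont_def)
  have "\<forall>\<^sub>F x in at 0. u x = 0"
    unfolding eventually_at using zero by (intro exI[of _ 1]) (auto simp: dist_norm)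
  then have "(u \<longlongrightarrow> 0) (at 0)" by (rule tendsto_eventually)
  with lim have "u 0 = 0" by (intro tendsto_unique[of "at 0" u "u 0" 0]) auto
  then show False using x \<open>x = 0\<close> by simp
qed

section \<open>Eigenspaces and spectrum\<close>

lemma pol_eq_vector: "vector [r * cos \<theta>, r * sin \<theta>] = pol r \<theta>"
  by (simp add: vec_eq_iff forall_2)

lemma eigenspace:
  fixes k l :: nat and \<nu> :: real
  assumes "\<nu> < 0" and l: "1 \<le> l"
  shows "\<exists>c d. (c, d) \<noteq> (0, 0) \<and>
    (\<forall>c1 c2. \<exists>u. has_polar_form u (radial (sqrt (- \<nu>)) k l c d) (angular k c1 c2) \<and>
       is_solution \<nu> (eigenvalue k l \<nu>) u \<and>
       ((\<exists>\<theta>. angular k c1 c2 \<theta> \<noteq> 0) \<longrightarrow> is_eigenfunction \<nu> (eigenvalue k l \<nu>) u)) \<and>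
    finite {r. 0 < r \<and> r < 1 \<and> radial (sqrt (- \<nu>)) k l c d r = 0} \<and>
    card {r. 0 < r \<and> r < 1 \<and> radial (sqrt (- \<nu>)) k l c d r = 0} = l - 1 \<and>
    (\<forall>r. 0 < r \<and> r < 1 \<and> radial (sqrt (- \<nu>)) k l c d r = 0 \<longrightarrow>
       deriv (radial (sqrt (- \<nu>)) k l c d) r \<noteq> 0)"
proof -
  define \<kappa> where "\<kappa> = sqrt (- \<nu>)"
  define q where "q = - \<nu> / 16"
  define X where "X = root_param k l q"
  define Y where "Y = q / X"
  have q: "0 < q" and \<kappa>: "0 < \<kappa>" "\<kappa>\<^sup>2 / 16 = q" using \<open>\<nu> < 0\<close> by (auto simp: q_def \<kappa>_def)
  have X: "0 < X" unfolding X_def by (rule root_param_pos[OF l q])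
  have Y: "0 < Y" using X q by (simp add: Y_def)
  have \<nu>: "\<nu> = - 16 * X * Y" using X by (simp add: Y_def q_def)
  have ev: "eigenvalue k l \<nu> = 4 * (X - Y)" by (simp add: eigenvalue_def X_def Y_def q_def)
  interpret radial_profile k l X Y
    using root_param[OF l q, of k] l Y by unfold_locales (auto simp: X_def Y_def)
  have char: "char_fun k X Y = 0"
    using char_fun_root[OF q X, of k] l by (auto simp: X_def Y_def)
  define a b where "a = alpha \<kappa> k l" and "b = \<kappa> / a"
  have a: "a = 2 * sqrt X" unfolding a_def alpha_eq[OF l \<kappa>(1)] \<kappa>(2) X_def ..
  have a2: "0 < a" "a\<^sup>2 = 4 * X" using X by (auto simp: a power_mult_distrib)
  have b2: "0 < b" "b\<^sup>2 = 4 * Y"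
    using \<kappa> a2 by (auto simp: b_def power_divide Y_def \<kappa>(2)[symmetric])
  define N where "N \<rho> = clifford k (- Y) * clifford k (X * \<rho>) - clifford k X * clifford k (- Y * \<rho>)" for \<rho>
  \<comment> \<open>The powers undo the factors (a r/2)^k and (b r/2)^k of the Bessel functions,
    leaving r^k times the profile that vanishes at r = 1.\<close>
  define c d where "c = clifford k (- Y) * (2 / a) ^ k" and "d = - clifford k X * (2 / b) ^ k"
  have cY: "clifford k (- Y) > 0" using Y by (intro clifford_pos) simp
  have radial: "radial \<kappa> k l c d r = r ^ k * N (r\<^sup>2)" for r
  proof -
    have pw: "(2 / s) ^ k * (s * r / 2) ^ k = r ^ k" if "s > 0" for s
      using that by (simp add: power_mult_distrib[symmetric])
    have "radial \<kappa> k l c d r = c * bessel_J k (a * r) + d * bessel_I k (b * r)"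
      by (simp add: radial_def a_def b_def)
    also have "\<dots> = clifford k (- Y) * ((2 / a) ^ k * (a * r / 2) ^ k) * clifford k (X * r\<^sup>2) -
        clifford k X * ((2 / b) ^ k * (b * r / 2) ^ k) * clifford k (- Y * r\<^sup>2)"
      unfolding bessel_J_eq bessel_I_eq c_def d_def
      by (simp add: power_mult_distrib a2 b2 mult_ac)
    also have "\<dots> = r ^ k * N (r\<^sup>2)"
      unfolding pw[OF a2(1)] pw[OF b2(1)] N_def by (simp add: algebra_simps)
    finally show ?thesis .
  qed
  have N_zero: "N \<rho> = 0 \<longleftrightarrow> \<psi> \<rho> = \<psi> 1" if "0 \<le> \<rho>" for \<rho>
    using v_pos[OF that] cY by (simp add: N_def \<psi>_def frac_eq_eq) (auto simp: mult.commute)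
  define Z where "Z = {\<rho>. 0 < \<rho> \<and> \<rho> < 1 \<and> \<psi> \<rho> = \<psi> 1}"
  note Z = radial_zeros[folded Z_def]
  have roots: "{r. 0 < r \<and> r < 1 \<and> radial \<kappa> k l c d r = 0} = sqrt ` Z"
  proof (intro equalityI subsetI)
    fix r assume "r \<in> {r. 0 < r \<and> r < 1 \<and> radial \<kappa> k l c d r = 0}"
    then have r: "0 < r" "r < 1" "N (r\<^sup>2) = 0" by (auto simp: radial)
    then have "r\<^sup>2 \<in> Z" using N_zero[of "r\<^sup>2"] by (auto simp: Z_def abs_square_less_1)
    moreover have "r = sqrt (r\<^sup>2)" using r by simp
    ultimately show "r \<in> sqrt ` Z" by blast
  next
    fix r assume "r \<in> sqrt ` Z"
    then obtain \<rho> where "\<rho> \<in> Z" "r = sqrt \<rho>" by auto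
    then show "r \<in> {r. 0 < r \<and> r < 1 \<and> radial \<kappa> k l c d r = 0}"
      using N_zero[of \<rho>] by (auto simp: radial Z_def)
  qed
  have fin: "finite {r. 0 < r \<and> r < 1 \<and> radial \<kappa> k l c d r = 0}"
    unfolding roots using Z(1) by simp
  show ?thesis
    unfolding \<kappa>_def[symmetric]
  proof (rule exI[of _ c], rule exI[of _ d], intro conjI allI impI)
    show "(c, d) \<noteq> (0, 0)" using cY a2 by (simp add: c_def)
    show "finite {r. 0 < r \<and> r < 1 \<and> radial \<kappa> k l c d r = 0}" by (rule fin)
    show "card {r. 0 < r \<and> r < 1 \<and> radial \<kappa> k l c d r = 0} = l - 1"
      unfolding roots using Z(2) by (subst card_image) (auto simp: inj_on_def)
  next
    fix r :: real assume "0 < r \<and> r < 1 \<and> radial \<kappa> k l c d r = 0"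
    then have r: "0 < r" "r < 1" "radial \<kappa> k l c d r = 0" by auto
    then have N0: "N (r\<^sup>2) = 0" by (simp add: radial)
    have "r\<^sup>2 \<in> Z" using N_zero[of "r\<^sup>2"] N0 r by (auto simp: Z_def abs_square_less_1)
    then have w: "wronskian (r\<^sup>2) \<noteq> 0" by (rule Z(3))
    define N' where "N' = - (clifford k (- Y) * (X * clifford (k + 1) (X * r\<^sup>2))) -
      clifford k X * (Y * clifford (k + 1) (- Y * r\<^sup>2))"
    \<comment> \<open>At a root of the profile its slope is a nonzero multiple of the Wronskian, and
      roots avoid the critical points of \<psi>; hence simplicity.\<close>
    have "clifford k (- Y * r\<^sup>2) * N' = - clifford k (- Y) * wronskian (r\<^sup>2)"
      using N0 unfolding N_def N'_def wronskian_def by algebra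
    then have "N' \<noteq> 0" using w cY by auto
    have dN: "((\<lambda>r. N (r\<^sup>2)) has_real_derivative N' * (2 * r)) (at r)"
      unfolding N_def N'_def
      apply (rule derivative_eq_intros refl | simp)+
      by (simp add: algebra_simps)
    have "((\<lambda>r. r ^ k * N (r\<^sup>2)) has_real_derivative
        real k * r ^ (k - Suc 0) * N (r\<^sup>2) + N' * (2 * r) * r ^ k) (at r)"
      by (rule DERIV_mult[OF DERIV_pow dN])
    then have "(radial \<kappa> k l c d has_real_derivative N' * (2 * r) * r ^ k) (at r)"
      unfolding N0 by (simp add: radial[abs_def] fun_eq_iff[symmetric])
    then show "deriv (radial \<kappa> k l c d) r \<noteq> 0"
      using \<open>N' \<noteq> 0\<close> r by (simp add: DERIV_imp_deriv)
  next
    fix c1 c2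
    define u where "u = (\<lambda>x. clifford k (- Y) * wave k c1 c2 X x + (- clifford k X) * wave k c1 c2 (- Y) x)"
    have polar: "u (pol r \<theta>) = radial \<kappa> k l c d r * angular k c1 c2 \<theta>" for r \<theta>
    proof -
      have "harmonic c1 c2 k (pol r \<theta>) = r ^ k * angular k c1 c2 \<theta>"
        using harmonic_polar[of c1 c2 k r \<theta>] by (simp add: pol_eq_vector)
      moreover have "normsq (pol r \<theta>) = r\<^sup>2" by (simp add: normsq_eq norm_pol)
      ultimately show ?thesis by (simp add: u_def wave_def radial N_def algebra_simps)
    qed
    have sol: "is_solution \<nu> (eigenvalue k l \<nu>) u"
      unfolding ev u_def by (subst \<nu>) (rule eigenfunction_is_solution[OF char])
    have "is_eigenfunction \<nu> (eigenvalue k l \<nu>) u" if "angular k c1 c2 \<theta> \<noteq> 0" for \<theta>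
    proof -
      have "infinite ({0<..<1} - {r. 0 < r \<and> r < 1 \<and> radial \<kappa> k l c d r = 0})"
        using fin by (intro Diff_infinite_finite infinite_Ioo) auto
      then have "{0<..<1} - {r. 0 < r \<and> r < 1 \<and> radial \<kappa> k l c d r = 0} \<noteq> {}"
        by (metis finite.emptyI)
      then obtain r where "r \<in> {0<..<1} - {r. 0 < r \<and> r < 1 \<and> radial \<kappa> k l c d r = 0}"
        by (meson ex_in_conv)
      then have r: "0 < r" "r < 1" "radial \<kappa> k l c d r \<noteq> 0" by simp_all
      then have "pol r \<theta> \<in> ball 0 1" "u (pol r \<theta>) \<noteq> 0" using that by (auto simp: polar norm_pol)
      with sol show ?thesis by (auto simp: is_eigenfunction_def)
    qed
    moreover have "has_polar_form u (radial \<kappa> k l c d) (angular k c1 c2)"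
      by (simp add: has_polar_form_def pol_eq_vector polar)
    ultimately show "\<exists>u. has_polar_form u (radial \<kappa> k l c d) (angular k c1 c2) \<and>
       is_solution \<nu> (eigenvalue k l \<nu>) u \<and>
       ((\<exists>\<theta>. angular k c1 c2 \<theta> \<noteq> 0) \<longrightarrow> is_eigenfunction \<nu> (eigenvalue k l \<nu>) u)"
      using sol by blast
  qed
qed

lemma spectrum_eq:
  assumes "\<nu> < 0"
  shows "spectrum \<nu> = {eigenvalue k l \<nu> | k l. 1 \<le> l}"
proof (intro equalityI subsetI)
  fix s assume "s \<in> spectrum \<nu>"
  then obtain u where u: "is_eigenfunction \<nu> s u" by (auto simp: spectrum_def)
  \<comment> \<open>The quadratic formula for X - Y = L and X Y = q; both are positive because q > 0
    makes D exceed |L|.\<close>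
  define q L D where "q = - \<nu> / 16" and "L = s / 4" and "D = sqrt (L\<^sup>2 + 4 * q)"
  define X Y where "X = (D + L) / 2" and "Y = (D - L) / 2"
  have q: "0 < q" using assms by (simp add: q_def)
  have "sqrt (L\<^sup>2) < D" unfolding D_def using q by (intro real_sqrt_less_mono) simp
  then have "\<bar>L\<bar> < D" by simp
  then have XY: "0 < X" "0 < Y" by (auto simp: X_def Y_def)
  have "D\<^sup>2 = L\<^sup>2 + 4 * q" unfolding D_def using q by simp
  then have prod: "X * Y = q" by (simp add: X_def Y_def power2_eq_square algebra_simps)
  have "\<nu> = - 16 * X * Y" using prod by (simp add: q_def)
  moreover have "s = 4 * (X - Y)" by (simp add: X_def Y_def L_def field_simps)
  ultimately obtain k where k: "char_fun k X Y = 0"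
    using eigenfunction_char_fun[of X Y u] u XY by auto
  have Y: "Y = q / X" using prod XY by (simp add: field_simps)
  then obtain l where l: "1 \<le> l" "X = root_param k l q"
    using char_fun_root[OF q XY(1), of k] k by auto
  have "s = eigenvalue k l \<nu>"
    using \<open>s = 4 * (X - Y)\<close> Y l(2) by (simp add: eigenvalue_def q_def)
  with l(1) show "s \<in> {eigenvalue k l \<nu> | k l. 1 \<le> l}" by blast
next
  fix s assume "s \<in> {eigenvalue k l \<nu> | k l. 1 \<le> l}"
  then obtain k l where l: "1 \<le> l" and s: "s = eigenvalue k l \<nu>" by blast
  obtain c d where "\<forall>c1 c2. \<exists>u. has_polar_form u (radial (sqrt (- \<nu>)) k l c d) (angular k c1 c2) \<and>
      is_solution \<nu> s u \<and> ((\<exists>\<theta>. angular k c1 c2 \<theta> \<noteq> 0) \<longrightarrow> is_eigenfunction \<nu> s u)"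
    using eigenspace[OF assms l, of k] unfolding s by (elim exE conjE)
  then obtain u where "(\<exists>\<theta>. angular k 1 0 \<theta> \<noteq> 0) \<longrightarrow> is_eigenfunction \<nu> s u" by metis
  moreover have "angular k 1 0 0 \<noteq> 0" by (simp add: angular_def)
  ultimately have "is_eigenfunction \<nu> s u" by blast
  then show "s \<in> spectrum \<nu>" by (auto simp: spectrum_def)
qed

theorem theorem2:
  shows "\<exists>lam :: nat \<Rightarrow> nat \<Rightarrow> real \<Rightarrow> real.
    (\<forall>k l. 1 \<le> l \<longrightarrow>
       strict_mono_on {..<0} (lam k l) \<and>
       lam k l differentiable_on {..<0} \<and>
       filterlim (lam k l) at_bot at_bot \<and>
       (lam k l \<longlongrightarrow> (bessel_root (k + 1) l)\<^sup>2) (at_left 0)) \<and>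
    (\<forall>\<nu><0. spectrum \<nu> = {lam k l \<nu> | k l. 1 \<le> l}) \<and>
    (\<forall>\<nu><0. \<forall>k l. 1 \<le> l \<longrightarrow>
       (\<exists>c d. (c, d) \<noteq> (0, 0) \<and>
          (\<forall>c1 c2. \<exists>u. has_polar_form u (radial (sqrt (- \<nu>)) k l c d) (angular k c1 c2) \<and>
             is_solution \<nu> (lam k l \<nu>) u \<and>
             ((\<exists>\<theta>. angular k c1 c2 \<theta> \<noteq> 0) \<longrightarrow> is_eigenfunction \<nu> (lam k l \<nu>) u)) \<and>
          finite {r. 0 < r \<and> r < 1 \<and> radial (sqrt (- \<nu>)) k l c d r = 0} \<and>
          card {r. 0 < r \<and> r < 1 \<and> radial (sqrt (- \<nu>)) k l c d r = 0} = l - 1 \<and>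
          (\<forall>r. 0 < r \<and> r < 1 \<and> radial (sqrt (- \<nu>)) k l c d r = 0 \<longrightarrow>
             deriv (radial (sqrt (- \<nu>)) k l c d) r \<noteq> 0)))"
proof (rule exI[of _ eigenvalue], intro conjI)
  show "\<forall>k l. 1 \<le> l \<longrightarrow>
       strict_mono_on {..<0} (eigenvalue k l) \<and>
       eigenvalue k l differentiable_on {..<0} \<and>
       filterlim (eigenvalue k l) at_bot at_bot \<and>
       (eigenvalue k l \<longlongrightarrow> (bessel_root (k + 1) l)\<^sup>2) (at_left 0)"
    using eigenvalue_strict_mono eigenvalue_differentiable eigenvalue_at_bot eigenvalue_at_left_0 by blast
  show "\<forall>\<nu><0. spectrum \<nu> = {eigenvalue k l \<nu> | k l. 1 \<le> l}"
    by (intro allI impI spectrum_eq)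
qed (intro allI impI eigenspace)

end
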